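(* Let $\mathbb{Z}/4$ act on $\mathbb{T}^6$ by the linear action induced from the action on $\mathbb{C}^3$ in which a generator $\tau$ acts by $\tau(z_1,z_2,z_3)=(-z_1,iz_2,iz_3)$, and let $Y_1=\mathbb{T}^6/(\mathbb{Z}/4)$ be the resulting orbifold. Then $$FGb(Y_1)\cong U(1)^5\oplus(\mathbb{Z}/2)^4,\qquad Gb(Y_1)\cong \mathbb{Z}^4\oplus(\mathbb{Z}/2)^4 .$$
   Context: For a finite group $G$ acting on a space $X$, $EG\times_G X$ denotes the Borel construction, where $EG$ is a contractible free $G$-space. The group of isomorphism classes of gerbes on the orbifold $X/G$ is identified with $Gb(X/G)=H^3(EG\times_G X,\mathbb{Z})$, and the group of isomorphism classes of flat gerbes with $FGb(X/G)=H^2(EG\times_G X,U(1))$. Here $U(1)$ is taken with the discrete topology, so that $FGb(X/G)$ is the torsion subgroup of $H_2(EG\times_G X,\mathbb{Z})$ plus (torsion-free part of $H_2(EG\times_G X,\mathbb{Z})$) $\otimes\, U(1)$, up to isomorphism. The torus is $\mathbb{T}^6=(M\otimes\mathbb{R})/M$, where $M\cong\mathbb{Z}^6$ is the $\mathbb{Z}[\mathbb{Z}/4]$-lattice $M=(M_1)^2\oplus(M_2)^2$. Here $M_1$ has rank one with the generator acting by multiplication by $-1$, and $M_2$ has rank two with basis $x,y$ and the generator acting by $x\mapsto -y$, $y\mapsto x$. The space $E(\mathbb{Z}/4)\times_{\mathbb{Z}/4}\mathbb{T}^6$ is an Eilenberg--MacLane space $K(\Gamma,1)$ with $\Gamma=M\rtimes\mathbb{Z}/4$.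 *)

theory Defs
  imports
    "HOL-Analysis.Analysis"
    "HOL-Homology.Homology"
    "HOL-Algebra.Group_Action"
    "HOL-Algebra.Product_Groups"
begin

section \<open>Singular cohomology with coefficients in an abelian group\<close>

definition hom_group ::
  "('a, 'm) monoid_scheme \<Rightarrow> ('b, 'n) monoid_scheme \<Rightarrow> ('a \<Rightarrow> 'b) monoid" where
  "hom_group G A =
     \<lparr>carrier = hom G A \<inter> extensional (carrier G),
      monoid.mult = (\<lambda>f g. \<lambda>x\<in>carrier G. f x \<otimes>\<^bsub>A\<^esub> g x),
      one = (\<lambda>x\<in>carrier G. \<one>\<^bsub>A\<^esub>)\<rparr>"

definition cochain_group ::
  "nat \<Rightarrow> 'a topology \<Rightarrow> ('b, 'n) monoid_scheme \<Rightarrow> ('a chain \<Rightarrow> 'b) monoid" where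
  "cochain_group p X A = hom_group (chain_group p X) A"

definition cochain_coboundary ::
  "nat \<Rightarrow> 'a topology \<Rightarrow> ('a chain \<Rightarrow> 'b) \<Rightarrow> 'a chain \<Rightarrow> 'b" where
  "cochain_coboundary p X f =
     (\<lambda>c\<in>carrier (chain_group (Suc p) X). f (chain_boundary (Suc p) c))"

definition cocycles ::
  "nat \<Rightarrow> 'a topology \<Rightarrow> ('b, 'n) monoid_scheme \<Rightarrow> ('a chain \<Rightarrow> 'b) set" where
  "cocycles p X A =
     {f \<in> carrier (cochain_group p X A).
        cochain_coboundary p X f = \<one>\<^bsub>cochain_group (Suc p) X A\<^esub>}"

definition coboundaries ::
  "nat \<Rightarrow> 'a topology \<Rightarrow> ('b, 'n) monoid_scheme \<Rightarrow> ('a chain \<Rightarrow> 'b) set" where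
  "coboundaries p X A =
     (case p of
        0 \<Rightarrow> {\<one>\<^bsub>cochain_group 0 X A\<^esub>}
      | Suc q \<Rightarrow> cochain_coboundary q X ` carrier (cochain_group q X A))"

definition singular_cohomology ::
  "nat \<Rightarrow> 'a topology \<Rightarrow> ('b, 'n) monoid_scheme \<Rightarrow> ('a chain \<Rightarrow> 'b) set monoid" where
  "singular_cohomology p X A =
     (cochain_group p X A)\<lparr>carrier := cocycles p X A\<rparr> Mod coboundaries p X A"


section \<open>Group actions on spaces and the Borel construction\<close>

definition continuous_group_action ::
  "('g, 'm) monoid_scheme \<Rightarrow> 'a topology \<Rightarrow> ('g \<Rightarrow> 'a \<Rightarrow> 'a) \<Rightarrow> bool" where
  "continuous_group_action G X \<phi> \<longleftrightarrow>
     group_action G (topspace X) \<phi> \<and> (\<forall>g\<in>carrier G. continuous_map X X (\<phi> g))"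

lemma continuous_group_actionI:
  assumes G: "group G"
    and cont: "\<And>g. g \<in> carrier G \<Longrightarrow> continuous_map X X (\<phi> g)"
    and ext: "\<And>g. g \<in> carrier G \<Longrightarrow> \<phi> g \<in> extensional (topspace X)"
    and one: "\<And>x. x \<in> topspace X \<Longrightarrow> \<phi> \<one>\<^bsub>G\<^esub> x = x"
    and mult: "\<And>g h x. \<lbrakk>g \<in> carrier G; h \<in> carrier G; x \<in> topspace X\<rbrakk>
                 \<Longrightarrow> \<phi> (g \<otimes>\<^bsub>G\<^esub> h) x = \<phi> g (\<phi> h x)"
  shows "continuous_group_action G X \<phi>"
proof -
  interpret G: group G by (rule G)
  have closed: "\<phi> g x \<in> topspace X" if "g \<in> carrier G" "x \<in> topspace X" for g x
    using cont[OF that(1)] that(2) by (auto simp: continuous_map_def)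
  have cancel: "\<phi> (inv\<^bsub>G\<^esub> g) (\<phi> g x) = x" "\<phi> g (\<phi> (inv\<^bsub>G\<^esub> g) x) = x"
    if "g \<in> carrier G" "x \<in> topspace X" for g x
    using mult[of "inv\<^bsub>G\<^esub> g" g x] mult[of g "inv\<^bsub>G\<^esub> g" x] that one[of x] by simp_all
  have Bij: "\<phi> g \<in> Bij (topspace X)" if "g \<in> carrier G" for g
  proof -
    have "bij_betw (\<phi> g) (topspace X) (topspace X)"
      by (rule bij_betw_byWitness[where f' = "\<phi> (inv\<^bsub>G\<^esub> g)"])
         (use that closed cancel in auto)
    then show ?thesis
      using ext[OF that] by (simp add: Bij_def)
  qed
  have "\<phi> \<in> hom G (BijGroup (topspace X))"
  proof (rule homI)
    fix g h assume g: "g \<in> carrier G" and h: "h \<in> carrier G"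
    have "\<phi> (g \<otimes>\<^bsub>G\<^esub> h) = compose (topspace X) (\<phi> g) (\<phi> h)"
      by (rule extensionalityI[where A = "topspace X"])
         (use g h ext mult in \<open>auto simp: compose_eq\<close>)
    then show "\<phi> (g \<otimes>\<^bsub>G\<^esub> h) = \<phi> g \<otimes>\<^bsub>BijGroup (topspace X)\<^esub> \<phi> h"
      using Bij[OF g] Bij[OF h] by (simp add: BijGroup_def)
  qed (simp add: Bij BijGroup_def)
  then have "group_action G (topspace X) \<phi>"
    unfolding group_action_def group_hom_def group_hom_axioms_def
    using G group_BijGroup by blast
  then show ?thesis
    using cont by (simp add: continuous_group_action_def)
qed

text \<open>The set of orbits with the quotient topology.\<close>

definition orbit_space ::
  "('g, 'm) monoid_scheme \<Rightarrow> 'a topology \<Rightarrow> ('g \<Rightarrow> 'a \<Rightarrow> 'a) \<Rightarrow> 'a set topology" where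
  "orbit_space G X \<phi> =
     topology (\<lambda>U. U \<subseteq> orbits G (topspace X) \<phi> \<and>
                   openin X {x \<in> topspace X. orbit G \<phi> x \<in> U})"


lemma openin_orbit_space:
  "openin (orbit_space G X \<phi>) U \<longleftrightarrow>
     U \<subseteq> orbits G (topspace X) \<phi> \<and> openin X {x \<in> topspace X. orbit G \<phi> x \<in> U}"
proof -
  have "istopology (\<lambda>U. U \<subseteq> orbits G (topspace X) \<phi> \<and>
                   openin X {x \<in> topspace X. orbit G \<phi> x \<in> U})"
    unfolding istopology_def
  proof (intro conjI allI impI)
    fix S T
    assume S: "S \<subseteq> orbits G (topspace X) \<phi> \<and> openin X {x \<in> topspace X. orbit G \<phi> x \<in> S}"
      and T: "T \<subseteq> orbits G (topspace X) \<phi> \<and> openin X {x \<in> topspace X. orbit G \<phi> x \<in> T}"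
    have "{x \<in> topspace X. orbit G \<phi> x \<in> S \<inter> T} =
          {x \<in> topspace X. orbit G \<phi> x \<in> S} \<inter> {x \<in> topspace X. orbit G \<phi> x \<in> T}"
      by auto
    then show "openin X {x \<in> topspace X. orbit G \<phi> x \<in> S \<inter> T}"
      using openin_Int[OF conjunct2[OF S] conjunct2[OF T]] by (simp only:)
    show "S \<inter> T \<subseteq> orbits G (topspace X) \<phi>"
      using S by auto
  next
    fix \<K>
    assume K: "\<forall>K\<in>\<K>. K \<subseteq> orbits G (topspace X) \<phi> \<and>
                       openin X {x \<in> topspace X. orbit G \<phi> x \<in> K}"
    then show "\<Union>\<K> \<subseteq> orbits G (topspace X) \<phi>"
      by auto
    have "{x \<in> topspace X. orbit G \<phi> x \<in> \<Union>\<K>} =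
          (\<Union>K\<in>\<K>. {x \<in> topspace X. orbit G \<phi> x \<in> K})"
      by auto
    moreover have "openin X (\<Union>K\<in>\<K>. {x \<in> topspace X. orbit G \<phi> x \<in> K})"
      by (rule openin_Union) (use K in blast)
    ultimately show "openin X {x \<in> topspace X. orbit G \<phi> x \<in> \<Union>\<K>}"
      by (simp only:)
  qed
  then show ?thesis
    by (simp add: orbit_space_def)
qed

lemma topspace_orbit_space: "topspace (orbit_space G X \<phi>) = orbits G (topspace X) \<phi>"
proof
  show "topspace (orbit_space G X \<phi>) \<subseteq> orbits G (topspace X) \<phi>"
    using openin_topspace[of "orbit_space G X \<phi>"] unfolding openin_orbit_space by (rule conjunct1)
  have "{x \<in> topspace X. orbit G \<phi> x \<in> orbits G (topspace X) \<phi>} = topspace X"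
    by (auto simp: orbits_def)
  then show "orbits G (topspace X) \<phi> \<subseteq> topspace (orbit_space G X \<phi>)"
    by (intro openin_subset) (simp add: openin_orbit_space)
qed

lemma quotient_map_orbit: "quotient_map X (orbit_space G X \<phi>) (orbit G \<phi>)"
  unfolding quotient_map_def
proof (intro conjI allI impI)
  show "orbit G \<phi> ` topspace X = topspace (orbit_space G X \<phi>)"
    unfolding topspace_orbit_space by (auto simp: orbits_def)
next
  fix U assume "U \<subseteq> topspace (orbit_space G X \<phi>)"
  then show "openin X {x \<in> topspace X. orbit G \<phi> x \<in> U} = openin (orbit_space G X \<phi>) U"
    by (simp only: openin_orbit_space topspace_orbit_space) blast
qed

definition diagonal_action ::
  "'a set \<Rightarrow> ('g \<Rightarrow> 'a \<Rightarrow> 'a) \<Rightarrow> 'b set \<Rightarrow> ('g \<Rightarrow> 'b \<Rightarrow> 'b) \<Rightarrow> 'g \<Rightarrow> 'a \<times> 'b \<Rightarrow> 'a \<times> 'b" where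
  "diagonal_action S \<phi> T \<psi> g = (\<lambda>(x, y)\<in>S \<times> T. (\<phi> g x, \<psi> g y))"

definition borel_construction ::
  "('g, 'm) monoid_scheme \<Rightarrow> 'e topology \<Rightarrow> ('g \<Rightarrow> 'e \<Rightarrow> 'e)
     \<Rightarrow> 'a topology \<Rightarrow> ('g \<Rightarrow> 'a \<Rightarrow> 'a) \<Rightarrow> ('e \<times> 'a) set topology" where
  "borel_construction G E \<epsilon> X \<phi> =
     orbit_space G (prod_topology E X) (diagonal_action (topspace E) \<epsilon> (topspace X) \<phi>)"

text \<open>
  A contractible free \<open>G\<close>-space, for a finite (discrete) group \<open>G\<close>. Spaces are Hausdorff by
  convention; without this, for example any nonempty indiscrete free \<open>G\<close>-space would qualify,
  although \<open>E \<rightarrow> E/G\<close> would not be a covering. The library counts the empty space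
  as contractible, so nonemptiness has to be required separately.
\<close>

definition is_EG ::
  "('g, 'm) monoid_scheme \<Rightarrow> 'e topology \<Rightarrow> ('g \<Rightarrow> 'e \<Rightarrow> 'e) \<Rightarrow> bool" where
  "is_EG G E \<epsilon> \<longleftrightarrow>
     Hausdorff_space E \<and> topspace E \<noteq> {} \<and> contractible_space E \<and>
     continuous_group_action G E \<epsilon> \<and>
     (\<forall>x\<in>topspace E. stabilizer G \<epsilon> x = {\<one>\<^bsub>G\<^esub>})"


text \<open>
  Contractible free Hausdorff \<open>\<int>/4\<close>-spaces exist: for instance the nonzero complex sequences with the
  product topology, the generator acting by multiplication by \<open>\<i>\<close>.
\<close>

lemma contractible_nonzero_sequences:
  "contractible (- {\<lambda>_. 0} :: (nat \<Rightarrow> complex) set)"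
proof -
  define S where "S = (- {\<lambda>_. 0} :: (nat \<Rightarrow> complex) set)"
  define shift :: "(nat \<Rightarrow> complex) \<Rightarrow> nat \<Rightarrow> complex"
    where "shift f n = (case n of 0 \<Rightarrow> 0 | Suc m \<Rightarrow> f m)" for f n
  define e :: "nat \<Rightarrow> complex" where "e n = (if n = 0 then 1 else 0)" for n
  have coord: "continuous_on A (\<lambda>x::real \<times> (nat \<Rightarrow> complex). snd x n)" for n A
    by (rule continuous_on_product_then_coordinatewise) (intro continuous_intros)
  have sh: "continuous_on A (\<lambda>x::real \<times> (nat \<Rightarrow> complex). shift (snd x) n)" for n A
    unfolding shift_def by (cases n) (simp_all add: coord)
  define h1 where "h1 = (\<lambda>x n. complex_of_real (1 - fst x) * snd x n + complex_of_real (fst x) * shift (snd x) n)"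
  define h2 where "h2 = (\<lambda>x n. complex_of_real (1 - fst x) * shift (snd x) n + complex_of_real (fst x) * e n)"
  have c1: "continuous_on A h1" for A
    unfolding h1_def
    by (rule continuous_on_coordinatewise_then_product) (intro continuous_intros coord sh)
  have c2: "continuous_on A h2" for A
    unfolding h2_def
    by (rule continuous_on_coordinatewise_then_product) (intro continuous_intros coord sh)
  have S1: "h1 (t, f) \<in> S" if "f \<in> S" for t f
  proof (rule ccontr)
    assume "h1 (t, f) \<notin> S"
    then have eq: "complex_of_real (1 - t) * f n + complex_of_real t * shift f n = 0" for n
      by (auto simp: S_def h1_def dest: fun_cong)
    have "f n = 0" for n
    proof (cases "t = 1")
      case True
      then show ?thesis using eq[of "Suc n"] by (simp add: shift_def)
    next
      case False
      then have nz: "complex_of_real (1 - t) \<noteq> 0"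
        by (simp flip: of_real_diff)
      show ?thesis
      proof (induction n)
        case 0
        then show ?case using eq[of 0] nz by (simp add: shift_def)
      next
        case (Suc n)
        then show ?case using eq[of "Suc n"] nz by (simp add: shift_def)
      qed
    qed
    then show False
      using that by (auto simp: S_def)
  qed
  have S2: "h2 (t, f) \<in> S" if "f \<in> S" for t f
  proof (rule ccontr)
    assume "h2 (t, f) \<notin> S"
    then have eq: "complex_of_real (1 - t) * shift f n + complex_of_real t * e n = 0" for n
      by (auto simp: S_def h2_def dest: fun_cong)
    have "t = 0"
      using eq[of 0] by (simp add: shift_def e_def)
    then have "f n = 0" for n
      using eq[of "Suc n"] by (simp add: shift_def)
    then show False
      using that by (auto simp: S_def)
  qed
  have "homotopic_with_canon (\<lambda>_. True) S S id shift"
    unfolding homotopic_with_def prod_topology_subtopology_eu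
  proof (intro exI conjI ballI allI)
    show "continuous_map (top_of_set ({0..1} \<times> S)) (top_of_set S) h1"
      using c1 S1 by auto
  qed (auto simp: h1_def)
  moreover have "homotopic_with_canon (\<lambda>_. True) S S shift (\<lambda>_. e)"
    unfolding homotopic_with_def prod_topology_subtopology_eu
  proof (intro exI conjI ballI allI)
    show "continuous_map (top_of_set ({0..1} \<times> S)) (top_of_set S) h2"
      using c2 S2 by auto
  qed (auto simp: h2_def)
  ultimately show ?thesis
    unfolding contractible_def S_def[symmetric] using homotopic_with_trans by blast
qed

lemma is_EG_nonzero_sequences:
  defines "S \<equiv> - {\<lambda>_. 0} :: (nat \<Rightarrow> complex) set"
  shows "is_EG (integer_mod_group 4) (top_of_set S) (\<lambda>k. \<lambda>f\<in>S. \<lambda>n. \<i> ^ nat k * f n)"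
  unfolding is_EG_def
proof (intro conjI ballI)
  show "Hausdorff_space (top_of_set S)"
    by (rule Hausdorff_space_subtopology)
       (simp only: euclidean_product_topology[symmetric] Hausdorff_space_product_topology
          Hausdorff_space_euclidean simp_thms ball_simps)
  show "topspace (top_of_set S) \<noteq> {}"
  proof -
    have "(\<lambda>_. 1) \<in> S" by (simp add: S_def fun_eq_iff)
    then show ?thesis by auto
  qed
  show "contractible_space (top_of_set S)"
    unfolding S_def by (simp add: contractible_nonzero_sequences)
  show "continuous_group_action (integer_mod_group 4) (top_of_set S) (\<lambda>k. \<lambda>f\<in>S. \<lambda>n. \<i> ^ nat k * f n)"
  proof (rule continuous_group_actionI)
    fix k :: int
    have "continuous_on S (\<lambda>f n. \<i> ^ nat k * f n)"
      by (intro continuous_on_coordinatewise_then_product continuous_intros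
            continuous_on_product_then_coordinatewise[OF continuous_on_id])
    moreover have "(\<lambda>n. \<i> ^ nat k * f n) \<in> S" if "f \<in> S" for f
      using that by (auto simp: S_def fun_eq_iff)
    ultimately show "continuous_map (top_of_set S) (top_of_set S) (\<lambda>f\<in>S. \<lambda>n. \<i> ^ nat k * f n)"
      by (auto simp: continuous_map_in_subtopology cong: continuous_on_cong)
  next
    fix g h f assume "g \<in> carrier (integer_mod_group 4)" "h \<in> carrier (integer_mod_group 4)"
      and f: "f \<in> topspace (top_of_set S)"
    then have gh: "0 \<le> g" "0 \<le> h"
      by (auto simp: carrier_integer_mod_group)
    have "nat ((g + h) mod 4) = (nat g + nat h) mod 4"
      using gh by (simp add: nat_mod_distrib nat_add_distrib)
    moreover have "\<i> ^ (m mod 4) = \<i> ^ m" for m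
    proof -
      have "\<i> ^ m = \<i> ^ (4 * (m div 4) + m mod 4)" by simp
      also have "\<dots> = (\<i> ^ 4) ^ (m div 4) * \<i> ^ (m mod 4)"
        by (simp only: power_add power_mult)
      also have "\<i> ^ 4 = 1" by (simp add: eval_nat_numeral)
      finally show ?thesis by simp
    qed
    ultimately have "\<i> ^ nat ((g + h) mod 4) = \<i> ^ (nat g + nat h)"
      by simp
    moreover have "(\<lambda>n. \<i> ^ nat h * f n) \<in> S"
      using f by (auto simp: S_def fun_eq_iff)
    ultimately show "(\<lambda>f\<in>S. \<lambda>n. \<i> ^ nat (g \<otimes>\<^bsub>integer_mod_group 4\<^esub> h) * f n) f =
      (\<lambda>f\<in>S. \<lambda>n. \<i> ^ nat g * f n) ((\<lambda>f\<in>S. \<lambda>n. \<i> ^ nat h * f n) f)"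
      using f by (simp add: power_add mult.assoc)
  qed auto
next
  fix f assume "f \<in> topspace (top_of_set S)"
  then have f: "f \<in> S" by simp
  then obtain n where n: "f n \<noteq> 0" by (auto simp: S_def)
  have k0: "k = 0" if "0 \<le> k" "k < 4" "\<i> ^ nat k * f n = f n" for k :: int
  proof -
    have "\<i> ^ nat k = 1" using that(3) n by simp
    moreover have "k = 0 \<or> k = 1 \<or> k = 2 \<or> k = 3" using that by linarith
    moreover have "\<i> ^ 3 = - \<i>" "\<i> \<noteq> 1" "- \<i> \<noteq> 1"
      by (simp_all add: eval_nat_numeral complex_eq_iff)
    ultimately show ?thesis by (elim disjE) simp_all
  qed
  show "stabilizer (integer_mod_group 4) (\<lambda>k. \<lambda>f\<in>S. \<lambda>n. \<i> ^ nat k * f n) f =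
        {\<one>\<^bsub>integer_mod_group 4\<^esub>}"
  proof (intro equalityI subsetI)
    fix k assume "k \<in> stabilizer (integer_mod_group 4) (\<lambda>k. \<lambda>f\<in>S. \<lambda>n. \<i> ^ nat k * f n) f"
    then have k: "k \<in> carrier (integer_mod_group 4)" and "(\<lambda>n. \<i> ^ nat k * f n) = f"
      using f by (simp_all add: stabilizer_def)
    from this(2) have "\<i> ^ nat k * f n = f n"
      by (rule fun_cong)
    then show "k \<in> {\<one>\<^bsub>integer_mod_group 4\<^esub>}"
      using k k0 by (simp add: carrier_integer_mod_group)
  next
    fix k assume "k \<in> {\<one>\<^bsub>integer_mod_group 4\<^esub>}"
    then show "k \<in> stabilizer (integer_mod_group 4) (\<lambda>k. \<lambda>f\<in>S. \<lambda>n. \<i> ^ nat k * f n) f"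
      using f by (simp add: stabilizer_def carrier_integer_mod_group)
  qed
qed

section \<open>Gerbes on a global quotient orbifold\<close>

definition U1 :: "complex monoid" where
  "U1 = \<lparr>carrier = sphere 0 1, monoid.mult = (*), one = 1\<rparr>"

text \<open>
  The groups of isomorphism classes of gerbes and of flat gerbes on the orbifold \<open>X/G\<close>, computed
  with the model \<open>(E, \<epsilon>)\<close> of \<open>EG\<close>. Using the abstract group \<^const>\<open>U1\<close> as coefficients of
  singular cohomology amounts to giving \<open>U(1)\<close> the discrete topology.
\<close>

definition Gb ::
  "('g, 'm) monoid_scheme \<Rightarrow> 'e topology \<Rightarrow> ('g \<Rightarrow> 'e \<Rightarrow> 'e)
     \<Rightarrow> 'a topology \<Rightarrow> ('g \<Rightarrow> 'a \<Rightarrow> 'a) \<Rightarrow> (('e \<times> 'a) set chain \<Rightarrow> int) set monoid" where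
  "Gb G E \<epsilon> X \<phi> = singular_cohomology 3 (borel_construction G E \<epsilon> X \<phi>) integer_group"

definition FGb ::
  "('g, 'm) monoid_scheme \<Rightarrow> 'e topology \<Rightarrow> ('g \<Rightarrow> 'e \<Rightarrow> 'e)
     \<Rightarrow> 'a topology \<Rightarrow> ('g \<Rightarrow> 'a \<Rightarrow> 'a) \<Rightarrow> (('e \<times> 'a) set chain \<Rightarrow> complex) set monoid" where
  "FGb G E \<epsilon> X \<phi> = singular_cohomology 2 (borel_construction G E \<epsilon> X \<phi>) U1"


section \<open>The \<open>\<int>/4\<close>-action on the six-torus\<close>

definition tau :: "complex ^ 3 \<Rightarrow> complex ^ 3" where
  "tau z = vector [- z $ 1, \<i> * z $ 2, \<i> * z $ 3]"

text \<open>
  The lattice \<open>M = M\<^sub>1\<^sup>2 \<oplus> M\<^sub>2\<^sup>2\<close> inside \<open>M \<otimes> \<real> = \<complex>\<^sup>3\<close>: the first coordinate contributes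
  \<open>\<int>\<cdot>1 \<oplus> \<int>\<cdot>\<i> = M\<^sub>1\<^sup>2\<close>; the second and the third contribute one copy of \<open>M\<^sub>2\<close> each, with basis
  \<open>x = 1\<close>, \<open>y = -\<i>\<close>, for which multiplication by \<open>\<i>\<close> is \<open>x \<mapsto> -y\<close>, \<open>y \<mapsto> x\<close>.
\<close>

definition lattice_M :: "(complex ^ 3) set" where
  "lattice_M = {z. \<forall>j. Re (z $ j) \<in> \<int> \<and> Im (z $ j) \<in> \<int>}"

definition lattice_M_group :: "(complex ^ 3) monoid" where
  "lattice_M_group = \<lparr>carrier = lattice_M, monoid.mult = (+), one = 0\<rparr>"

text \<open>The points of the torus \<open>(M \<otimes> \<real>)/M\<close> are the cosets of \<open>M\<close>.\<close>

definition torus6 :: "(complex ^ 3) set topology" where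
  "torus6 = orbit_space lattice_M_group euclidean (+)"

text \<open>The residue class of \<open>k\<close> acts by the \<open>k\<close>-th power of \<^const>\<open>tau\<close> on cosets.\<close>

definition torus6_action :: "int \<Rightarrow> (complex ^ 3) set \<Rightarrow> (complex ^ 3) set" where
  "torus6_action k = (\<lambda>C\<in>topspace torus6. (tau ^^ nat k) ` C)"


lemma tau_component:
  "tau z $ 1 = - z $ 1" "tau z $ 2 = \<i> * z $ 2" "tau z $ 3 = \<i> * z $ 3"
  by (simp_all add: tau_def)

lemma tau_power4: "(tau ^^ 4) z = z"
proof -
  have "(tau ^^ 4) z = tau (tau (tau (tau z)))"
    by (simp add: eval_nat_numeral)
  then show ?thesis
    by (simp add: vec_eq_iff forall_3 tau_component)
qed

lemma tau_power_4_mult: "(tau ^^ (4 * n)) z = z"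
proof (induction n)
  case (Suc n)
  have "(tau ^^ (4 * Suc n)) z = (tau ^^ 4) ((tau ^^ (4 * n)) z)"
    by (simp only: mult_Suc_right funpow_add o_apply)
  then show ?case
    by (simp only: Suc.IH tau_power4)
qed simp

lemma tau_add: "tau (z + w) = tau z + tau w"
  by (simp add: vec_eq_iff forall_3 tau_component algebra_simps)

lemma tau_funpow_add: "(tau ^^ n) (z + w) = (tau ^^ n) z + (tau ^^ n) w"
  by (induction n) (simp_all add: tau_add)

lemma tau_lattice_M: "z \<in> lattice_M \<Longrightarrow> tau z \<in> lattice_M"
  by (simp add: lattice_M_def forall_3 tau_component)

lemma tau_funpow_lattice_M: "z \<in> lattice_M \<Longrightarrow> (tau ^^ n) z \<in> lattice_M"
  by (induction n) (simp_all add: tau_lattice_M)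

lemma continuous_on_tau_funpow: "continuous_on UNIV (tau ^^ n)"
proof (induction n)
  case (Suc n)
  have "continuous_on UNIV tau"
  proof -
    have tau_eq: "tau = (\<lambda>z. \<chi> j. if j = 1 then - z $ j else \<i> * z $ j)"
      by (rule ext) (simp add: vec_eq_iff forall_3 tau_component)
    have "continuous_on UNIV (\<lambda>z::complex^3. if j = 1 then - z $ j else \<i> * z $ j)" for j
      by (cases "j = 1") (auto intro!: continuous_intros continuous_on_component)
    then show ?thesis
      unfolding tau_eq by (rule continuous_on_vec_lambda)
  qed
  then show ?case
    using continuous_on_compose2[OF _ Suc, of UNIV tau] by (simp add: o_def)
qed (simp add: id_def)

lemma torus6_coset: "orbit lattice_M_group (+) z = {m + z |m. m \<in> lattice_M}"
  by (auto simp: orbit_def lattice_M_group_def)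

lemma topspace_torus6: "topspace torus6 = range (orbit lattice_M_group (+))"
  by (auto simp: torus6_def topspace_orbit_space orbits_def)

lemma tau_funpow_coset:
  "(tau ^^ n) ` orbit lattice_M_group (+) z = orbit lattice_M_group (+) ((tau ^^ n) z)"
proof
  show "(tau ^^ n) ` orbit lattice_M_group (+) z \<subseteq> orbit lattice_M_group (+) ((tau ^^ n) z)"
    unfolding torus6_coset by (auto simp: tau_funpow_add intro: tau_funpow_lattice_M)
  have inv: "(tau ^^ n) ((tau ^^ (3 * n)) w) = w" for w
  proof -
    have "(tau ^^ n) ((tau ^^ (3 * n)) w) = (tau ^^ (n + 3 * n)) w"
      by (simp only: funpow_add o_apply)
    then show ?thesis
      using tau_power_4_mult[of n w] by simp
  qed
  show "orbit lattice_M_group (+) ((tau ^^ n) z) \<subseteq> (tau ^^ n) ` orbit lattice_M_group (+) z"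
  proof
    fix w assume "w \<in> orbit lattice_M_group (+) ((tau ^^ n) z)"
    then obtain m where m: "m \<in> lattice_M" and w: "w = m + (tau ^^ n) z"
      unfolding torus6_coset by blast
    have "w = (tau ^^ n) ((tau ^^ (3 * n)) m + z)"
      by (simp only: w tau_funpow_add inv)
    then show "w \<in> (tau ^^ n) ` orbit lattice_M_group (+) z"
      unfolding torus6_coset using tau_funpow_lattice_M[OF m] by blast
  qed
qed

lemma torus6_action_coset:
  "torus6_action k (orbit lattice_M_group (+) z) = orbit lattice_M_group (+) ((tau ^^ nat k) z)"
proof -
  have "orbit lattice_M_group (+) z \<in> topspace torus6"
    unfolding topspace_torus6 by (rule rangeI)
  then show ?thesis
    unfolding torus6_action_def by (simp only: restrict_apply' tau_funpow_coset)
qed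

lemma continuous_group_action_torus6:
  "continuous_group_action (integer_mod_group 4) torus6 torus6_action"
proof (rule continuous_group_actionI)
  have q: "quotient_map euclidean torus6 (orbit lattice_M_group (+))"
    unfolding torus6_def by (rule quotient_map_orbit)
  show "continuous_map torus6 torus6 (torus6_action k)" for k
  proof (rule continuous_compose_quotient_map[OF q])
    have "torus6_action k \<circ> orbit lattice_M_group (+) =
          orbit lattice_M_group (+) \<circ> (tau ^^ nat k)"
      by (rule ext) (simp add: torus6_action_coset)
    moreover have "continuous_map euclidean torus6 (orbit lattice_M_group (+) \<circ> (tau ^^ nat k))"
      by (rule continuous_map_compose[OF _ quotient_imp_continuous_map[OF q]])
         (simp add: continuous_on_tau_funpow)
    ultimately show "continuous_map euclidean torus6 (torus6_action k \<circ> orbit lattice_M_group (+))"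
      by (simp only:)
  qed
  show "torus6_action k \<in> extensional (topspace torus6)" for k
    by (simp add: torus6_action_def)
next
  fix C assume "C \<in> topspace torus6"
  then obtain z where C: "C = orbit lattice_M_group (+) z"
    unfolding topspace_torus6 by blast
  show "torus6_action \<one>\<^bsub>integer_mod_group 4\<^esub> C = C"
    by (simp add: C torus6_action_coset)
  fix g h assume "g \<in> carrier (integer_mod_group 4)" "h \<in> carrier (integer_mod_group 4)"
  then have gh: "0 \<le> g" "g < 4" "0 \<le> h" "h < 4"
    by (auto simp: carrier_integer_mod_group)
  have "(tau ^^ nat ((g + h) mod 4)) z = (tau ^^ nat g) ((tau ^^ nat h) z)"
  proof (cases "g + h < 4")
    case True
    then have "nat ((g + h) mod 4) = nat g + nat h"
      using gh by (simp add: mod_pos_pos_trivial nat_add_distrib)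
    then show ?thesis
      by (simp only: funpow_add o_apply)
  next
    case False
    have "(g + h) mod 4 = (g + h - 4) mod 4"
      by presburger
    also have "\<dots> = g + h - 4"
      using gh False by (intro mod_pos_pos_trivial) auto
    finally have "nat g + nat h = 4 + nat ((g + h) mod 4)"
      using gh False by linarith
    then have "(tau ^^ (nat g + nat h)) z = (tau ^^ (4 + nat ((g + h) mod 4))) z"
      by (simp only:)
    then show ?thesis
      by (simp only: tau_power4 funpow_add o_apply)
  qed
  then show "torus6_action (g \<otimes>\<^bsub>integer_mod_group 4\<^esub> h) C = torus6_action g (torus6_action h C)"
    by (simp only: C torus6_action_coset mult_integer_mod_group of_nat_numeral)
qed simp

end

(* The universal cover of the Borel construction is the contractible space X = E x C^3, on which
   Gamma = M x| Z/4 acts freely and properly discontinuously.  Hence the singular chains of X form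
   a free acyclic Gamma-complex.  The cubical decomposition of R^6 = M (x) R is preserved by M and,
   up to signs, by the generator of Z/4, so its tensor product with the periodic resolution of Z/4
   is another one.  By the comparison theorem the two have chain homotopy equivalent complexes of
   orbits.  The boundary of each cube vanishes modulo M, so the second complex of orbits is a direct
   sum of the periodic complexes of Z/4 with coefficients in the exterior powers of M, and its
   cohomology can be read off from the orbits of a signed permutation of the 64 subsets of the
   six coordinates. *)

theory Submission
  imports Defs
begin

text \<open>Cubes alone do not form a free complex: the generator fixes the origin. Tensoring with
  the periodic resolution restores freeness, since Z/4 acts freely on the first factor and M on the
  second. Cubes are suitable because multiplication by -1 and by i carries coordinate axes to
  coordinate axes. Group elements then act by signed permutations of cells, and modules over the
  group ring reduce to bookkeeping: each cell records its orbit, a normal form "rotation after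
  translation" and a sign, and freeness says how these data change under the group. All torsion has
  one source. The second exterior power of M contains four summands M_1 (x) M_2, each isomorphic to
  M_2, and H^1(Z/4, M_2) = Z[i]/(1 - i) = Z/2. With circle coefficients the same four orbits
  contribute already in cyclic degree 0, as invariant characters with values 1 and -1. The free
  parts come from invariants of rank 5 and 4 in the second and third exterior powers.\<close>

section \<open>Free resolutions and the comparison theorem\<close>

text \<open>
  A complex of free modules over \<open>\<int>[M \<rtimes> \<int>/4]\<close>, where \<open>rot\<close> is the action of the generator of
  \<open>\<int>/4\<close> and \<open>transl\<close> that of \<open>M\<close>. The group permutes the cells up to sign. The last six fields
  witness freeness: \<open>orbs\<close> indexes the orbits, \<open>lift\<close> chooses representatives, and every cell \<open>s\<close>
  is \<open>csgn s \<cdot> rot^(rexp s) (transl (shft s) (lift (orb s)))\<close>.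
\<close>

record ('s, 'm, 't) gcomplex =
  cells :: "nat \<Rightarrow> 's set"
  bdry :: "nat \<Rightarrow> 's \<Rightarrow> 's \<Rightarrow>\<^sub>0 int"
  rot :: "nat \<Rightarrow> 's \<Rightarrow> 's \<Rightarrow>\<^sub>0 int"
  transl :: "nat \<Rightarrow> 'm \<Rightarrow> 's \<Rightarrow> 's \<Rightarrow>\<^sub>0 int"
  orbs :: "nat \<Rightarrow> 't set"
  lift :: "nat \<Rightarrow> 't \<Rightarrow> 's"
  orb :: "nat \<Rightarrow> 's \<Rightarrow> 't"
  rexp :: "nat \<Rightarrow> 's \<Rightarrow> nat"
  shft :: "nat \<Rightarrow> 's \<Rightarrow> 'm"
  csgn :: "nat \<Rightarrow> 's \<Rightarrow> int"

definition chains :: "('s, 'm, 't) gcomplex \<Rightarrow> nat \<Rightarrow> ('s \<Rightarrow>\<^sub>0 int) set"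
  where "chains C n = {c. Poly_Mapping.keys c \<subseteq> cells C n}"

lemma frag_of_in_chains [simp]: "frag_of s \<in> chains C n \<longleftrightarrow> s \<in> cells C n"
  by (simp add: chains_def)

lemma zero_in_chains [simp]: "0 \<in> chains C n"
  by (simp add: chains_def)

lemma chains_diff: "a \<in> chains C n \<Longrightarrow> b \<in> chains C n \<Longrightarrow> a - b \<in> chains C n"
  using keys_diff[of a b] by (auto simp: chains_def)

lemma chains_cmul: "a \<in> chains C n \<Longrightarrow> frag_cmul k a \<in> chains C n"
  using keys_cmul[of k a] by (auto simp: chains_def)

lemma chains_extend:
  "c \<in> chains C n \<Longrightarrow> (\<And>s. s \<in> cells C n \<Longrightarrow> f s \<in> chains D k) \<Longrightarrow> frag_extend f c \<in> chains D k"
  using keys_frag_extend[of f c] by (fastforce simp: chains_def)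

lemma chains_eqI:
  assumes "c \<in> chains C n" "\<And>s. s \<in> cells C n \<Longrightarrow> frag_extend f (g s) = frag_extend h (k s)"
  shows "frag_extend f (frag_extend g c) = frag_extend h (frag_extend k c)"
proof -
  have "Poly_Mapping.keys c \<subseteq> cells C n" using assms(1) by (simp add: chains_def)
  then show ?thesis
    by (induction c rule: frag_induction) (simp_all add: frag_extend_diff assms(2))
qed

lemma chains_eqI1:
  assumes "c \<in> chains C n" "\<And>s. s \<in> cells C n \<Longrightarrow> frag_extend f (g s) = k s"
  shows "frag_extend f (frag_extend g c) = frag_extend k c"
proof -
  have "Poly_Mapping.keys c \<subseteq> cells C n" using assms(1) by (simp add: chains_def)
  then show ?thesis
    by (induction c rule: frag_induction) (simp_all add: frag_extend_diff assms(2))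
qed

text \<open>Valued in the free abelian group on a point rather than in the integers: the
  augmentation is then itself a \<open>frag_extend\<close>, so \<open>chains_eqI1\<close> applies to
  it.\<close>

definition augm :: "('s \<Rightarrow>\<^sub>0 int) \<Rightarrow> (unit \<Rightarrow>\<^sub>0 int)"
  where "augm = frag_extend (\<lambda>_. frag_of ())"

text \<open>For k < 4 this is the normal form of a group element: first translate, then
  rotate.\<close>

abbreviation act_word :: "('s, 'm, 't) gcomplex \<Rightarrow> nat \<Rightarrow> nat \<Rightarrow> 'm \<Rightarrow> ('s \<Rightarrow>\<^sub>0 int) \<Rightarrow> ('s \<Rightarrow>\<^sub>0 int)"
  where "act_word C n k m c \<equiv> (frag_extend (rot C n) ^^ k) (frag_extend (transl C n m) c)"

text \<open>The map \<open>tw\<close> is the inverse of the action of the generator on \<open>M\<close>.\<close>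

locale resolution =
  fixes C :: "('s, 'm::ab_group_add, 't) gcomplex" and tw :: "'m \<Rightarrow> 'm"
  assumes bdry_chains: "s \<in> cells C (Suc n) \<Longrightarrow> bdry C (Suc n) s \<in> chains C n"
    and bdry_bdry: "s \<in> cells C (Suc (Suc n)) \<Longrightarrow>
          frag_extend (bdry C (Suc n)) (bdry C (Suc (Suc n)) s) = 0"
    and augm_bdry: "s \<in> cells C 1 \<Longrightarrow> augm (bdry C 1 s) = 0"
    and exact: "\<lbrakk>c \<in> chains C (Suc n); frag_extend (bdry C (Suc n)) c = 0\<rbrakk> \<Longrightarrow>
          \<exists>y\<in>chains C (Suc (Suc n)). frag_extend (bdry C (Suc (Suc n))) y = c"
    and exact0: "\<lbrakk>c \<in> chains C 0; augm c = 0\<rbrakk> \<Longrightarrow>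
          \<exists>y\<in>chains C 1. frag_extend (bdry C 1) y = c"
    and nonempty: "cells C 0 \<noteq> {}"
    and bdry_rot: "s \<in> cells C (Suc n) \<Longrightarrow>
          frag_extend (bdry C (Suc n)) (rot C (Suc n) s) = frag_extend (rot C n) (bdry C (Suc n) s)"
    and bdry_trans: "s \<in> cells C (Suc n) \<Longrightarrow>
          frag_extend (bdry C (Suc n)) (transl C (Suc n) m s) = frag_extend (transl C n m) (bdry C (Suc n) s)"
    and augm_rot: "s \<in> cells C 0 \<Longrightarrow> augm (rot C 0 s) = frag_of ()"
    and augm_trans: "s \<in> cells C 0 \<Longrightarrow> augm (transl C 0 m s) = frag_of ()"
    and rot_power4: "s \<in> cells C n \<Longrightarrow> (frag_extend (rot C n) ^^ 4) (frag_of s) = frag_of s"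
    and trans_zero: "s \<in> cells C n \<Longrightarrow> transl C n 0 s = frag_of s"
    and trans_add: "s \<in> cells C n \<Longrightarrow> frag_extend (transl C n m) (transl C n m' s) = transl C n (m + m') s"
    and trans_rot: "s \<in> cells C n \<Longrightarrow>
          frag_extend (transl C n m) (rot C n s) = frag_extend (rot C n) (transl C n (tw m) s)"
    and lift_cells: "t \<in> orbs C n \<Longrightarrow> lift C n t \<in> cells C n"
    and orb_lift: "t \<in> orbs C n \<Longrightarrow> orb C n (lift C n t) = t"
    and rexp_lift: "t \<in> orbs C n \<Longrightarrow> rexp C n (lift C n t) = 0"
    and shft_lift: "t \<in> orbs C n \<Longrightarrow> shft C n (lift C n t) = 0"
    and csgn_lift: "t \<in> orbs C n \<Longrightarrow> csgn C n (lift C n t) = 1"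
    and orb_orbs: "s \<in> cells C n \<Longrightarrow> orb C n s \<in> orbs C n"
    and rexp_less: "s \<in> cells C n \<Longrightarrow> rexp C n s < 4"
    and cell_word: "s \<in> cells C n \<Longrightarrow>
          frag_of s = frag_cmul (csgn C n s)
            (act_word C n (rexp C n s) (shft C n s) (frag_of (lift C n (orb C n s))))"
    and rot_cell: "s \<in> cells C n \<Longrightarrow> \<exists>e s'. e * e = 1 \<and> s' \<in> cells C n \<and>
          rot C n s = frag_cmul e (frag_of s') \<and> orb C n s' = orb C n s \<and>
          rexp C n s' = (rexp C n s + 1) mod 4 \<and> shft C n s' = shft C n s \<and>
          csgn C n s' = e * csgn C n s"
    and trans_cell: "s \<in> cells C n \<Longrightarrow> \<exists>s'. s' \<in> cells C n \<and>
          transl C n m s = frag_of s' \<and> orb C n s' = orb C n s \<and>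
          rexp C n s' = rexp C n s \<and> shft C n s' = shft C n s + (tw ^^ rexp C n s) m \<and>
          csgn C n s' = csgn C n s"
begin

lemma rot_chains: "s \<in> cells C n \<Longrightarrow> rot C n s \<in> chains C n"
  using rot_cell[of s n] by (metis chains_cmul frag_of_in_chains)

lemma trans_chains: "s \<in> cells C n \<Longrightarrow> transl C n m s \<in> chains C n"
  using trans_cell[of s n m] by auto

lemma rot_extend_chains: "c \<in> chains C n \<Longrightarrow> frag_extend (rot C n) c \<in> chains C n"
  by (rule chains_extend) (auto intro: rot_chains)

lemma trans_extend_chains: "c \<in> chains C n \<Longrightarrow> frag_extend (transl C n m) c \<in> chains C n"
  by (rule chains_extend) (auto intro: trans_chains)

lemma rot_funpow_chains: "c \<in> chains C n \<Longrightarrow> (frag_extend (rot C n) ^^ k) c \<in> chains C n"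
  by (induction k) (auto intro: rot_extend_chains)

lemma act_word_chains: "c \<in> chains C n \<Longrightarrow> act_word C n k m c \<in> chains C n"
  by (intro rot_funpow_chains trans_extend_chains)

lemma funpow_rot_diff:
  "(frag_extend (rot C n) ^^ k) (a - b) = (frag_extend (rot C n) ^^ k) a - (frag_extend (rot C n) ^^ k) b"
  by (induction k) (simp_all add: frag_extend_diff)

lemma funpow_rot_0: "(frag_extend (rot C n) ^^ k) 0 = 0"
  by (induction k) simp_all

lemma rot_power4_chains:
  assumes "c \<in> chains C n"
  shows "(frag_extend (rot C n) ^^ 4) c = c"
proof -
  have "Poly_Mapping.keys c \<subseteq> cells C n" using assms by (simp add: chains_def)
  then show ?thesis
    by (induction c rule: frag_induction) (simp_all only: funpow_rot_diff funpow_rot_0 rot_power4)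
qed

lemma trans_rot_chains:
  "c \<in> chains C n \<Longrightarrow> frag_extend (transl C n m) (frag_extend (rot C n) c) =
     frag_extend (rot C n) (frag_extend (transl C n (tw m)) c)"
  by (rule chains_eqI[where C = C and n = n]) (auto intro: trans_rot)

text \<open>The commutation rule of the semidirect product, iterated. It explains why
  \<open>trans_cell\<close> twists the translation by \<open>tw ^^ rexp C n s\<close>.\<close>

lemma trans_funpow_rot:
  "c \<in> chains C n \<Longrightarrow> frag_extend (transl C n m) ((frag_extend (rot C n) ^^ k) c) =
     (frag_extend (rot C n) ^^ k) (frag_extend (transl C n ((tw ^^ k) m)) c)"
proof (induction k arbitrary: m)
  case (Suc k)
  then show ?case
    by (simp add: trans_rot_chains rot_funpow_chains funpow_swap1[of tw])
qed simp

lemma rot_act_word: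
  assumes "c \<in> chains C n" "k < 4"
  shows "frag_extend (rot C n) (act_word C n k m c) = act_word C n ((k + 1) mod 4) m c"
\<comment> \<open>Only the exponent 3 wraps around to 0; this is where the relation rot^4 = 1
  enters.\<close>
proof (cases "k = 3")
  case True
  have "frag_extend (rot C n) (act_word C n 3 m c) = (frag_extend (rot C n) ^^ 4) (frag_extend (transl C n m) c)"
    by (simp add: numeral_eq_Suc)
  then show ?thesis
    using True assms by (simp add: rot_power4_chains trans_extend_chains)
next
  case False
  then have "(k + 1) mod 4 = Suc k" using assms(2) by simp
  then show ?thesis by simp
qed

lemma trans_act_word:
  assumes "c \<in> chains C n"
  shows "frag_extend (transl C n m') (act_word C n k m c) = act_word C n k (m + (tw ^^ k) m') c"
proof -
  have "frag_extend (transl C n a) (frag_extend (transl C n b) c) = frag_extend (transl C n (a + b)) c" for a b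
    by (rule chains_eqI1[OF assms]) (rule trans_add)
  then show ?thesis
    by (simp add: trans_funpow_rot trans_extend_chains assms add.commute)
qed

lemma augm_rot_chains: "c \<in> chains C 0 \<Longrightarrow> augm (frag_extend (rot C 0) c) = augm c"
  unfolding augm_def by (rule chains_eqI1) (use augm_rot in \<open>auto simp: augm_def\<close>)

lemma augm_trans_chains: "c \<in> chains C 0 \<Longrightarrow> augm (frag_extend (transl C 0 m) c) = augm c"
  unfolding augm_def by (rule chains_eqI1) (use augm_trans in \<open>auto simp: augm_def\<close>)

lemma bdry_bdry_chains: "c \<in> chains C (Suc (Suc n)) \<Longrightarrow>
  frag_extend (bdry C (Suc n)) (frag_extend (bdry C (Suc (Suc n))) c) = 0"
  by (subst chains_eqI1[where k = "\<lambda>_. 0"]) (auto simp: bdry_bdry frag_extend_eq_0)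

end

text \<open>The two degrees are independent, so that boundaries (degree -1), chain maps (degree 0)
  and homotopies (degree 1) fall under one notion.\<close>

definition equivariant :: "('s, 'm, 't) gcomplex \<Rightarrow> ('q, 'm, 'u) gcomplex \<Rightarrow> nat \<Rightarrow> nat \<Rightarrow> ('s \<Rightarrow> 'q \<Rightarrow>\<^sub>0 int) \<Rightarrow> bool"
  where "equivariant C D n k f \<longleftrightarrow> (\<forall>s\<in>cells C n. f s \<in> chains D k \<and>
     frag_extend f (rot C n s) = frag_extend (rot D k) (f s) \<and>
     (\<forall>m. frag_extend f (transl C n m s) = frag_extend (transl D k m) (f s)))"

lemma equivariant_chains:
  "equivariant C D n k f \<Longrightarrow> c \<in> chains C n \<Longrightarrow> frag_extend f c \<in> chains D k"
  by (rule chains_extend) (auto simp: equivariant_def)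

lemma equivariant_rot:
  "equivariant C D n k f \<Longrightarrow> c \<in> chains C n \<Longrightarrow>
    frag_extend f (frag_extend (rot C n) c) = frag_extend (rot D k) (frag_extend f c)"
  by (rule chains_eqI) (auto simp: equivariant_def)

lemma equivariant_trans:
  "equivariant C D n k f \<Longrightarrow> c \<in> chains C n \<Longrightarrow>
    frag_extend f (frag_extend (transl C n m) c) = frag_extend (transl D k m) (frag_extend f c)"
  by (rule chains_eqI) (auto simp: equivariant_def)

lemma frag_extend_diff_fun: "frag_extend (\<lambda>s. f s - g s) c = frag_extend f c - frag_extend g c"
  by (rule frag_induction[OF subset_UNIV]) (simp_all add: frag_extend_diff)

lemma equivariant_diff:
  "equivariant C D n k f \<Longrightarrow> equivariant C D n k g \<Longrightarrow> equivariant C D n k (\<lambda>s. f s - g s)"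
  unfolding equivariant_def by (simp add: frag_extend_diff_fun frag_extend_diff chains_diff)

lemma equivariant_compose:
  assumes "resolution C tw" and f: "equivariant C D n k f" and g: "equivariant D F k l g"
  shows "equivariant C F n l (\<lambda>s. frag_extend g (f s))"
proof -
  interpret C: resolution C tw by fact
  have eq: "frag_extend (\<lambda>s. frag_extend g (f s)) c = frag_extend g (frag_extend f c)" if "c \<in> chains C n" for c
    by (rule sym, rule chains_eqI1[OF that]) simp
  show ?thesis
    unfolding equivariant_def
  proof (intro ballI conjI allI)
    fix s m assume s: "s \<in> cells C n"
    show "frag_extend g (f s) \<in> chains F l"
      using equivariant_chains[OF g] f s by (auto simp: equivariant_def)
    show "frag_extend (\<lambda>s. frag_extend g (f s)) (rot C n s) = frag_extend (rot F l) (frag_extend g (f s))"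
      using f s by (simp add: eq C.rot_chains equivariant_def equivariant_rot[OF g])
    show "frag_extend (\<lambda>s. frag_extend g (f s)) (transl C n m s) = frag_extend (transl F l m) (frag_extend g (f s))"
      using f s by (simp add: eq C.trans_chains equivariant_def equivariant_trans[OF g])
  qed
qed

lemma (in resolution) equivariant_bdry: "equivariant C C (Suc n) n (bdry C (Suc n))"
  unfolding equivariant_def by (simp add: bdry_chains bdry_rot bdry_trans)

lemma equivariant_id:
  assumes "resolution C tw" shows "equivariant C C n n frag_of"
proof -
  interpret C: resolution C tw by fact
  show ?thesis unfolding equivariant_def by (simp flip: frag_expansion)
qed


text \<open>The universal property of free modules: values on orbit representatives may be
  prescribed. The formula is forced by \<open>cell_word\<close>, and it is equivariant because
  \<open>rot_cell\<close> and \<open>trans_cell\<close> update exponent, shift and sign exactly as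
  left multiplication changes a normal form.\<close>

lemma equivariant_extend:
  assumes "resolution C tw" "resolution D tw" and v: "\<And>t. t \<in> orbs C n \<Longrightarrow> v t \<in> chains D l"
  shows "equivariant C D n l
     (\<lambda>s. frag_cmul (csgn C n s) (act_word D l (rexp C n s) (shft C n s) (v (orb C n s))))"
    (is "equivariant _ _ _ _ ?w")
proof -
  interpret C: resolution C tw by fact
  interpret D: resolution D tw by fact
  show ?thesis
    unfolding equivariant_def
  proof (intro ballI conjI allI)
    fix s m assume s: "s \<in> cells C n"
    have vs: "v (orb C n s) \<in> chains D l" by (simp add: v C.orb_orbs s)
    show "?w s \<in> chains D l"
      by (intro chains_cmul D.act_word_chains vs)
    obtain e s' where e: "e * e = 1" "s' \<in> cells C n" "rot C n s = frag_cmul e (frag_of s')" "orb C n s' = orb C n s"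
      "rexp C n s' = (rexp C n s + 1) mod 4" "shft C n s' = shft C n s" "csgn C n s' = e * csgn C n s"
      using C.rot_cell[OF s] by blast
    \<comment> \<open>The sign e enters twice, once from the rotated cell and once from its
      \<open>csgn\<close>, and e * e = 1.\<close>
    have "frag_extend ?w (rot C n s) = frag_cmul (csgn C n s)
       (act_word D l ((rexp C n s + 1) mod 4) (shft C n s) (v (orb C n s)))"
      using e(1) by (simp add: e frag_extend_cmul flip: mult.assoc)
    also have "\<dots> = frag_extend (rot D l) (?w s)"
      unfolding frag_extend_cmul by (subst D.rot_act_word[OF vs C.rexp_less[OF s]]) simp
    finally show "frag_extend ?w (rot C n s) = frag_extend (rot D l) (?w s)" .
    obtain s' where e: "s' \<in> cells C n" "transl C n m s = frag_of s'" "orb C n s' = orb C n s"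
      "rexp C n s' = rexp C n s" "shft C n s' = shft C n s + (tw ^^ rexp C n s) m" "csgn C n s' = csgn C n s"
      using C.trans_cell[OF s, of m] by blast
    have "frag_extend ?w (transl C n m s) = frag_cmul (csgn C n s)
       (act_word D l (rexp C n s) (shft C n s + (tw ^^ rexp C n s) m) (v (orb C n s)))"
      by (simp add: e)
    also have "\<dots> = frag_extend (transl D l m) (?w s)"
      unfolding frag_extend_cmul by (subst D.trans_act_word[OF vs]) simp
    finally show "frag_extend ?w (transl C n m s) = frag_extend (transl D l m) (?w s)" .
  qed
qed

lemma equivariant_act_word:
  assumes "resolution C tw" and "equivariant C D n k u" "c \<in> chains C n"
  shows "frag_extend u (act_word C n j m c) = act_word D k j m (frag_extend u c)"
proof -
  interpret C: resolution C tw by fact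
  show ?thesis
    using assms(2,3) by (induction j) (simp_all add: equivariant_rot[OF assms(2)] equivariant_trans[OF assms(2)]
        C.trans_extend_chains C.rot_funpow_chains)
qed

text \<open>The uniqueness half of the universal property: an equivariant map is determined by its
  values on the representatives.\<close>

lemma equivariant_cell:
  assumes "resolution C tw" and u: "equivariant C D n k u" and s: "s \<in> cells C n"
  shows "u s = frag_cmul (csgn C n s) (act_word D k (rexp C n s) (shft C n s) (u (lift C n (orb C n s))))"
proof -
  interpret C: resolution C tw by fact
  have "u s = frag_extend u (frag_cmul (csgn C n s)
            (act_word C n (rexp C n s) (shft C n s) (frag_of (lift C n (orb C n s)))))"
    by (subst C.cell_word[OF s, symmetric]) simp
  also have "\<dots> = frag_cmul (csgn C n s) (act_word D k (rexp C n s) (shft C n s) (u (lift C n (orb C n s))))"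
    by (subst frag_extend_cmul, subst equivariant_act_word[OF assms(1) u])
       (auto simp: C.lift_cells C.orb_orbs s)
  finally show ?thesis .
qed

text \<open>Projectivity of free modules: the equation is solved on representatives by choice, and
  the solutions are spread over the orbits. Both sides are then equivariant with the same values on
  representatives.\<close>

lemma equivariant_lift:
  assumes "resolution C tw" "resolution D tw"
    and u: "equivariant C D n k u" and g: "equivariant D D l k g"
    and sol: "\<And>s. s \<in> cells C n \<Longrightarrow> \<exists>y\<in>chains D l. frag_extend g y = u s"
  shows "\<exists>w. equivariant C D n l w \<and> (\<forall>s\<in>cells C n. frag_extend g (w s) = u s)"
proof -
  interpret C: resolution C tw by fact
  interpret D: resolution D tw by fact
  have "\<forall>t\<in>orbs C n. \<exists>y\<in>chains D l. frag_extend g y = u (lift C n t)"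
    using sol C.lift_cells by blast
  then obtain v where v: "\<And>t. t \<in> orbs C n \<Longrightarrow> v t \<in> chains D l"
      "\<And>t. t \<in> orbs C n \<Longrightarrow> frag_extend g (v t) = u (lift C n t)"
    by metis
  define w where "w s = frag_cmul (csgn C n s) (act_word D l (rexp C n s) (shft C n s) (v (orb C n s)))" for s
  have "equivariant C D n l w"
    unfolding w_def by (rule equivariant_extend[OF assms(1,2)]) (rule v)
  moreover have "frag_extend g (w s) = u s" if s: "s \<in> cells C n" for s
    unfolding w_def frag_extend_cmul
    by (subst equivariant_cell[OF assms(1) u s], subst equivariant_act_word[OF assms(2) g])
       (simp_all add: v C.orb_orbs s)
  ultimately show ?thesis by blast
qed

text \<open>In degree 0 the augmentation takes the place of the boundary, so that exactness reads
  the same in every degree (\<open>cycle_bdry\<close>, \<open>cycle_exact\<close>).\<close>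

definition cycle :: "('s, 'm, 't) gcomplex \<Rightarrow> nat \<Rightarrow> ('s \<Rightarrow>\<^sub>0 int) \<Rightarrow> bool"
  where "cycle C n c \<longleftrightarrow> (if n = 0 then augm c = 0 else frag_extend (bdry C n) c = 0)"

lemma (in resolution) cycle_bdry:
  assumes c: "c \<in> chains C (Suc n)" shows "cycle C n (frag_extend (bdry C (Suc n)) c)"
proof (cases n)
  case 0
  have "augm (frag_extend (bdry C 1) c) = frag_extend (\<lambda>_. 0) c"
    unfolding augm_def by (rule chains_eqI1) (use c 0 augm_bdry in \<open>auto simp: augm_def\<close>)
  then show ?thesis by (simp add: 0 cycle_def frag_extend_eq_0)
next
  case (Suc k)
  then show ?thesis using bdry_bdry_chains[of c k] c by (simp add: cycle_def)
qed

lemma (in resolution) cycle_exact: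
  "c \<in> chains C n \<Longrightarrow> cycle C n c \<Longrightarrow> \<exists>y\<in>chains C (Suc n). frag_extend (bdry C (Suc n)) y = c"
  using exact[of c "n - 1"] exact0[of c] by (cases n) (auto simp: cycle_def)

section \<open>The comparison theorem: equivariant chain maps exist and are unique up to
  homotopy\<close>

definition equivariant_chain_map ::
  "('s, 'm, 't) gcomplex \<Rightarrow> ('q, 'm, 'u) gcomplex \<Rightarrow> (nat \<Rightarrow> 's \<Rightarrow> 'q \<Rightarrow>\<^sub>0 int) \<Rightarrow> bool"
  where "equivariant_chain_map C D f \<longleftrightarrow> (\<forall>n. equivariant C D n n (f n)) \<and>
     (\<forall>n. \<forall>s\<in>cells C (Suc n). frag_extend (bdry D (Suc n)) (f (Suc n) s) = frag_extend (f n) (bdry C (Suc n) s)) \<and>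
     (\<forall>s\<in>cells C 0. augm (f 0 s) = frag_of ())"

lemma augm_extend:
  assumes "c \<in> chains C 0" "\<And>s. s \<in> cells C 0 \<Longrightarrow> augm (f s) = frag_of ()"
  shows "augm (frag_extend f c) = augm c"
  unfolding augm_def by (rule chains_eqI1[OF assms(1)]) (use assms(2) in \<open>simp add: augm_def\<close>)

theorem equivariant_chain_map_exists:
  assumes "resolution C tw" "resolution D tw"
  shows "\<exists>f. equivariant_chain_map C D f"
proof -
  interpret C: resolution C tw by fact
  interpret D: resolution D tw by fact
  \<comment> \<open>Carrying along that f preserves cycles makes the invariant P speak of a single
    degree, the form required by \<open>dependent_nat_choice\<close>. Compatibility with the
    boundary is the relation Q between successive degrees.\<close>
  define P where "P n f \<longleftrightarrow> equivariant C D n n f \<and> (\<forall>c\<in>chains C n. cycle C n c \<longrightarrow> cycle D n (frag_extend f c)) \<and>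
      (n = 0 \<longrightarrow> (\<forall>s\<in>cells C 0. augm (f s) = frag_of ()))" for n f
  define Q where "Q n f f' \<longleftrightarrow> (\<forall>s\<in>cells C (Suc n). frag_extend (bdry D (Suc n)) (f' s) = frag_extend f (bdry C (Suc n) s))"
    for n and f f' :: "'a \<Rightarrow> 'd \<Rightarrow>\<^sub>0 int"
  have "\<exists>f. \<forall>n. P n (f n) \<and> Q n (f n) (f (Suc n))"
  proof (rule dependent_nat_choice)
    obtain b where b: "b \<in> cells D 0" using D.nonempty by blast
    define w where "w s = frag_cmul (csgn C 0 s) (act_word D 0 (rexp C 0 s) (shft C 0 s) (frag_of b))" for s
    have w: "equivariant C D 0 0 w"
      unfolding w_def by (rule equivariant_extend[OF assms]) (simp add: b)
    have aC: "augm (act_word C 0 k m c) = augm c" if "c \<in> chains C 0" for k m c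
      using that by (induction k) (simp_all add: C.augm_rot_chains C.augm_trans_chains C.trans_extend_chains C.rot_funpow_chains)
    have aD: "augm (act_word D 0 k m c) = augm c" if "c \<in> chains D 0" for k m c
      using that by (induction k) (simp_all add: D.augm_rot_chains D.augm_trans_chains D.trans_extend_chains D.rot_funpow_chains)
    \<comment> \<open>Augmenting \<open>cell_word\<close> shows that the sign attached to a vertex
      is 1, so spreading b over the orbit with these signs preserves the augmentation.\<close>
    have "augm (w s) = frag_of ()" if s: "s \<in> cells C 0" for s
    proof -
      have "frag_of () = augm (frag_of s)" by (simp add: augm_def)
      also have "\<dots> = frag_cmul (csgn C 0 s) (augm (act_word C 0 (rexp C 0 s) (shft C 0 s) (frag_of (lift C 0 (orb C 0 s)))))"
        by (subst C.cell_word[OF s]) (simp add: augm_def frag_extend_cmul)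
      also have "\<dots> = frag_cmul (csgn C 0 s) (frag_of ())"
        by (subst aC) (auto simp: C.lift_cells C.orb_orbs s augm_def)
      also have "\<dots> = augm (w s)"
        unfolding w_def using aD[of "frag_of b"] b by (simp add: augm_def frag_extend_cmul)
      finally show ?thesis by simp
    qed
    with w have "P 0 w"
      unfolding P_def cycle_def using augm_extend[of _ C w] by simp
    then show "\<exists>x. P 0 x" by blast
  next
    fix f n assume f: "P n f"
    have "\<exists>w. equivariant C D (Suc n) (Suc n) w \<and>
       (\<forall>s\<in>cells C (Suc n). frag_extend (bdry D (Suc n)) (w s) = frag_extend f (bdry C (Suc n) s))"
    proof (rule equivariant_lift[OF assms])
      show "equivariant C D (Suc n) n (\<lambda>s. frag_extend f (bdry C (Suc n) s))"
        by (rule equivariant_compose[OF assms(1) C.equivariant_bdry]) (use f in \<open>simp add: P_def\<close>)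
      show "equivariant D D (Suc n) n (bdry D (Suc n))" by (rule D.equivariant_bdry)
      fix s assume s: "s \<in> cells C (Suc n)"
      have "cycle C n (bdry C (Suc n) s)"
        using C.cycle_bdry[of "frag_of s" n] s by simp
      then have "cycle D n (frag_extend f (bdry C (Suc n) s))"
        using f C.bdry_chains[OF s] by (simp add: P_def)
      then show "\<exists>y\<in>chains D (Suc n). frag_extend (bdry D (Suc n)) y = frag_extend f (bdry C (Suc n) s)"
        by (intro D.cycle_exact) (use f C.bdry_chains[OF s] equivariant_chains in \<open>auto simp: P_def\<close>)
    qed
    then obtain w where w: "equivariant C D (Suc n) (Suc n) w"
      and eq: "\<And>s. s \<in> cells C (Suc n) \<Longrightarrow> frag_extend (bdry D (Suc n)) (w s) = frag_extend f (bdry C (Suc n) s)"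
      by blast
    have "frag_extend (bdry D (Suc n)) (frag_extend w c) = frag_extend f (frag_extend (bdry C (Suc n)) c)"
      if "c \<in> chains C (Suc n)" for c
      by (rule chains_eqI[OF that]) (rule eq)
    then have "P (Suc n) w"
      unfolding P_def using w by (simp add: cycle_def)
    then show "\<exists>y. P (Suc n) y \<and> Q n f y"
      using eq by (auto simp: Q_def)
  qed
  then show ?thesis
    by (auto simp: P_def Q_def equivariant_chain_map_def)
qed

theorem equivariant_chain_maps_homotopic:
  assumes "resolution C tw" "resolution D tw"
    and f: "equivariant_chain_map C D f" and g: "equivariant_chain_map C D g"
  shows "\<exists>h. (\<forall>n. equivariant C D n (Suc n) (h n)) \<and>
     (\<forall>n. \<forall>s\<in>cells C (Suc n). frag_extend (bdry D (Suc (Suc n))) (h (Suc n) s) +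
        frag_extend (h n) (bdry C (Suc n) s) = f (Suc n) s - g (Suc n) s)"
proof -
  interpret C: resolution C tw by fact
  interpret D: resolution D tw by fact
  have eqf: "equivariant C D n n (f n)" and eqg: "equivariant C D n n (g n)" for n
    using f g by (auto simp: equivariant_chain_map_def)
  have fc: "frag_extend (bdry D (Suc n)) (frag_extend (f (Suc n)) c) = frag_extend (f n) (frag_extend (bdry C (Suc n)) c)"
    and gc: "frag_extend (bdry D (Suc n)) (frag_extend (g (Suc n)) c) = frag_extend (g n) (frag_extend (bdry C (Suc n)) c)"
    if "c \<in> chains C (Suc n)" for n c
    by (rule chains_eqI[OF that], use f g in \<open>simp add: equivariant_chain_map_def\<close>)+
  \<comment> \<open>On cycles the term with h after the boundary vanishes, so the homotopy relation
    restricted to cycles mentions h in one degree only. This suffices for the next step because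
    boundaries are cycles.\<close>
  define P where "P n h \<longleftrightarrow> equivariant C D n (Suc n) h \<and> (\<forall>c\<in>chains C n. cycle C n c \<longrightarrow>
      frag_extend (bdry D (Suc n)) (frag_extend h c) = frag_extend (f n) c - frag_extend (g n) c)" for n h
  define Q where "Q n h h' \<longleftrightarrow> (\<forall>s\<in>cells C (Suc n). frag_extend (bdry D (Suc (Suc n))) (h' s) + frag_extend h (bdry C (Suc n) s) =
      f (Suc n) s - g (Suc n) s)"
    for n and h h' :: "'a \<Rightarrow> 'd \<Rightarrow>\<^sub>0 int"
  have "\<exists>h. \<forall>n. P n (h n) \<and> Q n (h n) (h (Suc n))"
  proof (rule dependent_nat_choice)
    have "\<exists>w. equivariant C D 0 (Suc 0) w \<and> (\<forall>s\<in>cells C 0. frag_extend (bdry D (Suc 0)) (w s) = f 0 s - g 0 s)"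
    proof (rule equivariant_lift[OF assms(1,2) equivariant_diff[OF eqf eqg] D.equivariant_bdry])
      fix s assume s: "s \<in> cells C 0"
      have "augm (f 0 s - g 0 s) = 0"
        using f g s by (simp add: equivariant_chain_map_def augm_def frag_extend_diff)
      then show "\<exists>y\<in>chains D (Suc 0). frag_extend (bdry D (Suc 0)) y = f 0 s - g 0 s"
        by (intro D.cycle_exact) (use s eqf[of 0] eqg[of 0] in \<open>auto simp: cycle_def equivariant_def intro: chains_diff\<close>)
    qed
    then obtain w where w: "equivariant C D 0 (Suc 0) w" and eq: "\<And>s. s \<in> cells C 0 \<Longrightarrow> frag_extend (bdry D (Suc 0)) (w s) = f 0 s - g 0 s"
      by blast
    have "frag_extend (bdry D (Suc 0)) (frag_extend w c) = frag_extend (f 0) c - frag_extend (g 0) c" if "c \<in> chains C 0" for c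
      unfolding frag_extend_diff_fun[symmetric] by (rule chains_eqI1[OF that]) (rule eq)
    with w have "P 0 w" unfolding P_def by simp
    then show "\<exists>x. P 0 x" by blast
  next
    fix h n assume h: "P n h"
    \<comment> \<open>What the next homotopy has to bound. By P it is a cycle, hence a boundary in
      the acyclic target.\<close>
    let ?u = "\<lambda>s. f (Suc n) s - g (Suc n) s - frag_extend h (bdry C (Suc n) s)"
    have "\<exists>w. equivariant C D (Suc n) (Suc (Suc n)) w \<and>
       (\<forall>s\<in>cells C (Suc n). frag_extend (bdry D (Suc (Suc n))) (w s) = ?u s)"
    proof (rule equivariant_lift[OF assms(1,2) _ D.equivariant_bdry])
      show eu: "equivariant C D (Suc n) (Suc n) ?u"
        by (intro equivariant_diff eqf eqg equivariant_compose[OF assms(1) C.equivariant_bdry]) (use h in \<open>simp add: P_def\<close>)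
      fix s assume s: "s \<in> cells C (Suc n)"
      have "cycle C n (bdry C (Suc n) s)"
        using C.cycle_bdry[of "frag_of s" n] s by simp
      then have "frag_extend (bdry D (Suc n)) (frag_extend h (bdry C (Suc n) s)) =
          frag_extend (f n) (bdry C (Suc n) s) - frag_extend (g n) (bdry C (Suc n) s)"
        using h C.bdry_chains[OF s] by (simp add: P_def)
      then have "frag_extend (bdry D (Suc n)) (?u s) = 0"
        using fc[of "frag_of s" n] gc[of "frag_of s" n] s by (simp add: frag_extend_diff)
      then show "\<exists>y\<in>chains D (Suc (Suc n)). frag_extend (bdry D (Suc (Suc n))) y = ?u s"
        by (intro D.cycle_exact) (use s eu in \<open>auto simp: cycle_def equivariant_def\<close>)
    qed
    then obtain w where w: "equivariant C D (Suc n) (Suc (Suc n)) w"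
      and eq: "\<And>s. s \<in> cells C (Suc n) \<Longrightarrow> frag_extend (bdry D (Suc (Suc n))) (w s) = ?u s"
      by blast
    have hb: "frag_extend (\<lambda>s. frag_extend h (bdry C (Suc n) s)) c = frag_extend h (frag_extend (bdry C (Suc n)) c)"
      if "c \<in> chains C (Suc n)" for c
      by (rule sym, rule chains_eqI1[OF that]) simp
    have "frag_extend (bdry D (Suc (Suc n))) (frag_extend w c) = frag_extend (f (Suc n)) c - frag_extend (g (Suc n)) c
        - frag_extend h (frag_extend (bdry C (Suc n)) c)"
      if c: "c \<in> chains C (Suc n)" for c
      unfolding hb[OF c, symmetric] frag_extend_diff_fun[symmetric] by (rule chains_eqI1[OF c]) (rule eq)
    then have "P (Suc n) w"
      unfolding P_def using w by (simp add: cycle_def)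
    then show "\<exists>y. P (Suc n) y \<and> Q n h y"
      using eq by (auto simp: Q_def)
  qed
  then show ?thesis
    by (auto simp: P_def Q_def)
qed

subsection \<open>The complex of orbits\<close>

text \<open>The projection to coinvariants, written in the basis of orbits. The sign is there
  because a group element may carry a representative to minus a cell.\<close>

definition proj :: "('s, 'm, 't) gcomplex \<Rightarrow> nat \<Rightarrow> 's \<Rightarrow> 't \<Rightarrow>\<^sub>0 int"
  where "proj C n s = frag_cmul (csgn C n s) (frag_of (orb C n s))"

text \<open>The map induced on coinvariants, computed at the chosen representative;
  \<open>proj_equivariant\<close> shows that it is compatible with the projections when f is
  equivariant.\<close>

definition descend ::
  "('s, 'm, 't) gcomplex \<Rightarrow> ('q, 'm, 'u) gcomplex \<Rightarrow> nat \<Rightarrow> nat \<Rightarrow> ('s \<Rightarrow> 'q \<Rightarrow>\<^sub>0 int) \<Rightarrow> 't \<Rightarrow> 'u \<Rightarrow>\<^sub>0 int"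
  where "descend C D n k f t = frag_extend (proj D k) (f (lift C n t))"

definition orbit_bdry :: "('s, 'm, 't) gcomplex \<Rightarrow> nat \<Rightarrow> 't \<Rightarrow> 't \<Rightarrow>\<^sub>0 int"
  where "orbit_bdry C n = descend C C n (n - 1) (bdry C n)"

definition orbit_chains :: "('s, 'm, 't) gcomplex \<Rightarrow> nat \<Rightarrow> ('t \<Rightarrow>\<^sub>0 int) set"
  where "orbit_chains C n = {c. Poly_Mapping.keys c \<subseteq> orbs C n}"

lemma (in resolution) proj_act_word:
  assumes "c \<in> chains C n"
  shows "frag_extend (proj C n) (act_word C n k m c) = frag_extend (proj C n) c"
proof -
  have r: "frag_extend (proj C n) (frag_extend (rot C n) c) = frag_extend (proj C n) c" if "c \<in> chains C n" for c
  proof (rule chains_eqI1[OF that])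
    fix s assume "s \<in> cells C n"
    then obtain e s' where e: "e * e = 1" "s' \<in> cells C n" "rot C n s = frag_cmul e (frag_of s')" "orb C n s' = orb C n s"
      "rexp C n s' = (rexp C n s + 1) mod 4" "shft C n s' = shft C n s" "csgn C n s' = e * csgn C n s"
      using rot_cell by blast
    then show "frag_extend (proj C n) (rot C n s) = proj C n s"
      by (simp add: proj_def frag_extend_cmul flip: mult.assoc)
  qed
  have t: "frag_extend (proj C n) (frag_extend (transl C n m) c) = frag_extend (proj C n) c" if "c \<in> chains C n" for m c
  proof (rule chains_eqI1[OF that])
    fix s assume "s \<in> cells C n"
    then show "frag_extend (proj C n) (transl C n m s) = proj C n s"
      using trans_cell[of s n m] by (auto simp: proj_def)
  qed
  show ?thesis
    using assms by (induction k) (simp_all add: r t trans_extend_chains rot_funpow_chains)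
qed

lemma (in resolution) proj_orbit_chains:
  assumes "c \<in> chains C n" shows "frag_extend (proj C n) c \<in> orbit_chains C n"
  using keys_frag_extend[of "proj C n" c] assms orb_orbs
  by (fastforce simp: orbit_chains_def proj_def chains_def split: if_splits)

lemma proj_equivariant:
  assumes "resolution C tw" "resolution D tw" and f: "equivariant C D n k f" and c: "c \<in> chains C n"
  shows "frag_extend (proj D k) (frag_extend f c) = frag_extend (descend C D n k f) (frag_extend (proj C n) c)"
proof (rule chains_eqI[OF c])
  interpret C: resolution C tw by fact
  interpret D: resolution D tw by fact
  fix s assume s: "s \<in> cells C n"
  have "f (lift C n (orb C n s)) \<in> chains D k"
    using f C.lift_cells[OF C.orb_orbs[OF s]] by (simp add: equivariant_def)
  then show "frag_extend (proj D k) (f s) = frag_extend (descend C D n k f) (proj C n s)"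
    by (subst equivariant_cell[OF assms(1) f s]) (simp add: proj_def frag_extend_cmul descend_def D.proj_act_word)
qed

lemma descend_orbit_chains:
  assumes "resolution C tw" "resolution D tw" "equivariant C D n k f" "t \<in> orbs C n"
  shows "descend C D n k f t \<in> orbit_chains D k"
proof -
  interpret C: resolution C tw by fact
  interpret D: resolution D tw by fact
  show ?thesis
    unfolding descend_def by (rule D.proj_orbit_chains) (use assms C.lift_cells in \<open>simp add: equivariant_def\<close>)
qed

lemma descend_compose:
  assumes "resolution C tw" "resolution D tw" "resolution F tw"
    and f: "equivariant C D n k f" and g: "equivariant D F k l g" and t: "t \<in> orbs C n"
  shows "frag_extend (descend D F k l g) (descend C D n k f t) = descend C F n l (\<lambda>s. frag_extend g (f s)) t"
proof -
  interpret C: resolution C tw by fact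
  have "f (lift C n t) \<in> chains D k" using f C.lift_cells[OF t] by (simp add: equivariant_def)
  then show ?thesis
    unfolding descend_def[of C] using proj_equivariant[OF assms(2,3) g] by simp
qed

lemma (in resolution) descend_frag_of:
  "t \<in> orbs C n \<Longrightarrow> descend C C n n frag_of t = frag_of t"
  by (simp add: descend_def proj_def orb_lift csgn_lift)

lemma chain_map_descend:
  assumes "resolution C tw" "resolution D tw" "equivariant_chain_map C D f" "t \<in> orbs C (Suc n)"
  shows "frag_extend (orbit_bdry D (Suc n)) (descend C D (Suc n) (Suc n) (f (Suc n)) t) =
         frag_extend (descend C D n n (f n)) (orbit_bdry C (Suc n) t)"
proof -
  interpret C: resolution C tw by fact
  interpret D: resolution D tw by fact
  have f: "equivariant C D n n (f n)" for n using assms(3) by (simp add: equivariant_chain_map_def)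
  show ?thesis
    using assms(3) C.lift_cells[OF assms(4)]
      descend_compose[OF assms(1,2,2) f[of "Suc n"] D.equivariant_bdry[of n] assms(4)]
      descend_compose[OF assms(1,1,2) C.equivariant_bdry[of n] f[of n] assms(4)]
    by (simp add: orbit_bdry_def descend_def equivariant_chain_map_def)
qed

lemma equivariant_chain_map_compose:
  assumes "resolution C tw" "resolution D tw" "equivariant_chain_map C D f" "equivariant_chain_map D F g"
  shows "equivariant_chain_map C F (\<lambda>n s. frag_extend (g n) (f n s))"
proof -
  interpret C: resolution C tw by fact
  interpret D: resolution D tw by fact
  have f: "equivariant C D n n (f n)" and g: "equivariant D F n n (g n)" for n
    using assms(3,4) by (simp_all add: equivariant_chain_map_def)
  have gc: "frag_extend (bdry F (Suc n)) (frag_extend (g (Suc n)) c) = frag_extend (g n) (frag_extend (bdry D (Suc n)) c)"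
    if "c \<in> chains D (Suc n)" for n c
    by (rule chains_eqI[OF that]) (use assms(4) in \<open>simp add: equivariant_chain_map_def\<close>)
  have gf: "frag_extend (g n) (frag_extend (f n) c) = frag_extend (\<lambda>s. frag_extend (g n) (f n s)) c"
    if "c \<in> chains C n" for n c
    by (rule chains_eqI1[OF that]) simp
  show ?thesis
    unfolding equivariant_chain_map_def
  proof (intro conjI allI ballI)
    show "equivariant C F n n (\<lambda>s. frag_extend (g n) (f n s))" for n
      by (rule equivariant_compose[OF assms(1) f g])
    show "augm (frag_extend (g 0) (f 0 s)) = frag_of ()" if "s \<in> cells C 0" for s
      using that assms(3,4) f[of 0] by (subst augm_extend[of _ D]) (auto simp: equivariant_chain_map_def equivariant_def)
    fix n s assume s: "s \<in> cells C (Suc n)"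
    then show "frag_extend (bdry F (Suc n)) (frag_extend (g (Suc n)) (f (Suc n) s)) =
        frag_extend (\<lambda>s. frag_extend (g n) (f n s)) (bdry C (Suc n) s)"
      using f[of "Suc n"] assms(3) by (simp add: gc equivariant_def gf[symmetric] C.bdry_chains equivariant_chain_map_def)
  qed
qed

lemma equivariant_chain_map_id:
  assumes "resolution C tw" shows "equivariant_chain_map C C (\<lambda>n. frag_of)"
  unfolding equivariant_chain_map_def
  using equivariant_id[OF assms] by (simp add: augm_def flip: frag_expansion)

text \<open>Both g after f and the identity are equivariant chain maps from C to itself, hence
  homotopic. The homotopy is equivariant, so it descends to orbits together with the
  relation.\<close>

theorem orbit_chains_homotopy_inverse:
  assumes C: "resolution C tw" and D: "resolution D tw"
    and f: "equivariant_chain_map C D f" and g: "equivariant_chain_map D C g"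
  shows "\<exists>h. (\<forall>n. \<forall>t\<in>orbs C n. h n t \<in> orbit_chains C (Suc n)) \<and>
    (\<forall>n. \<forall>t\<in>orbs C (Suc n). frag_extend (orbit_bdry C (Suc (Suc n))) (h (Suc n) t) +
        frag_extend (h n) (orbit_bdry C (Suc n) t) =
        frag_extend (descend D C (Suc n) (Suc n) (g (Suc n))) (descend C D (Suc n) (Suc n) (f (Suc n)) t) - frag_of t)"
proof -
  interpret C: resolution C tw by fact
  obtain h where h: "\<And>n. equivariant C C n (Suc n) (h n)"
    and eq: "\<And>n s. s \<in> cells C (Suc n) \<Longrightarrow> frag_extend (bdry C (Suc (Suc n))) (h (Suc n) s) +
        frag_extend (h n) (bdry C (Suc n) s) = frag_extend (g (Suc n)) (f (Suc n) s) - frag_of s"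
    using equivariant_chain_maps_homotopic[OF C C equivariant_chain_map_compose[OF C D f g] equivariant_chain_map_id[OF C]]
    by blast
  have fe: "equivariant C D n n (f n)" and ge: "equivariant D C n n (g n)" for n
    using f g by (simp_all add: equivariant_chain_map_def)
  show ?thesis
  proof (intro exI[of _ "\<lambda>n. descend C C n (Suc n) (h n)"] conjI allI ballI)
    show "descend C C n (Suc n) (h n) t \<in> orbit_chains C (Suc n)" if "t \<in> orbs C n" for n t
      by (rule descend_orbit_chains[OF C C h that])
    fix n t assume t: "t \<in> orbs C (Suc n)"
    have "frag_of t = frag_extend (proj C (Suc n)) (frag_of (lift C (Suc n) t))"
      using C.descend_frag_of[OF t] by (simp add: descend_def)
    then show "frag_extend (orbit_bdry C (Suc (Suc n))) (descend C C (Suc n) (Suc (Suc n)) (h (Suc n)) t) +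
        frag_extend (descend C C n (Suc n) (h n)) (orbit_bdry C (Suc n) t) =
        frag_extend (descend D C (Suc n) (Suc n) (g (Suc n))) (descend C D (Suc n) (Suc n) (f (Suc n)) t) - frag_of t"
      using descend_compose[OF C C C h[of "Suc n"] C.equivariant_bdry[of "Suc n"] t]
        descend_compose[OF C C C C.equivariant_bdry[of n] h[of n] t]
        descend_compose[OF C D C fe ge t]
        arg_cong[OF eq[OF C.lift_cells[OF t]], of "frag_extend (proj C (Suc n))"]
      by (simp add: orbit_bdry_def descend_def frag_extend_add frag_extend_diff)
  qed
qed

section \<open>Tensor products of based complexes\<close>

definition fprod :: "('a \<Rightarrow>\<^sub>0 int) \<Rightarrow> ('b \<Rightarrow>\<^sub>0 int) \<Rightarrow> ('a \<times> 'b \<Rightarrow>\<^sub>0 int)"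
  where "fprod a b = frag_extend (\<lambda>x. frag_extend (\<lambda>y. frag_of (x, y)) b) a"

lemma fprod_of [simp]: "fprod (frag_of x) (frag_of y) = frag_of (x, y)"
  by (simp add: fprod_def)

lemma fprod_0 [simp]: "fprod 0 b = 0" "fprod a 0 = 0"
  by (simp_all add: fprod_def frag_extend_eq_0)

lemma fprod_diff_left: "fprod (a - a') b = fprod a b - fprod a' b"
  by (simp add: fprod_def frag_extend_diff)

lemma fprod_diff_right: "fprod a (b - b') = fprod a b - fprod a b'"
  by (simp add: fprod_def frag_extend_diff frag_extend_diff_fun)

lemma fprod_add_left: "fprod (a + a') b = fprod a b + fprod a' b"
  by (simp add: fprod_def frag_extend_add)

lemma fprod_minus_right: "fprod a (- b) = - fprod a b"
  using fprod_diff_right[of a 0 b] by simp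

lemma fprod_minus_left: "fprod (- a) b = - fprod a b"
  using fprod_diff_left[of 0 a b] by simp

lemma fprod_add_right: "fprod a (b + b') = fprod a b + fprod a b'"
  using fprod_diff_right[of a b "- b'"] by (simp add: fprod_minus_right)

lemma fprod_cmul_left: "fprod (frag_cmul k a) b = frag_cmul k (fprod a b)"
  by (simp add: fprod_def frag_extend_cmul)

lemma fprod_cmul_right: "fprod a (frag_cmul k b) = frag_cmul k (fprod a b)"
proof (rule frag_induction[OF subset_UNIV, where P = "\<lambda>a. fprod a (frag_cmul k b) = frag_cmul k (fprod a b)"])
  show "fprod (frag_of x) (frag_cmul k b) = frag_cmul k (fprod (frag_of x) b)" for x
    by (simp add: fprod_def frag_extend_cmul)
next
  fix c d :: "'a \<Rightarrow>\<^sub>0 int" assume "fprod c (frag_cmul k b) = frag_cmul k (fprod c b)" "fprod d (frag_cmul k b) = frag_cmul k (fprod d b)"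
  then show "fprod (c - d) (frag_cmul k b) = frag_cmul k (fprod (c - d) b)"
    using frag_cmul_distrib2[of k "fprod c b - fprod d b" "fprod d b"]
    by (simp add: fprod_diff_left algebra_simps)
qed simp

lemmas fprod_simps = fprod_diff_left fprod_diff_right fprod_add_left fprod_add_right
  fprod_minus_left fprod_minus_right fprod_cmul_left fprod_cmul_right

lemma keys_fprod: "Poly_Mapping.keys (fprod a b) \<subseteq> Poly_Mapping.keys a \<times> Poly_Mapping.keys b"
  unfolding fprod_def
  by (rule order_trans[OF keys_frag_extend]) (use keys_frag_extend in fastforce)

text \<open>A bilinear expression is determined by its values on pairs of basis elements. The sets A
  and B allow the basis to be limited to one degree, where the Koszul sign is constant; additivity
  is phrased with differences to fit \<open>frag_induction\<close>.\<close>

lemma fprod_eqI: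
  assumes "Poly_Mapping.keys a \<subseteq> A" "Poly_Mapping.keys b \<subseteq> B"
    and "\<And>x y. x \<in> A \<Longrightarrow> y \<in> B \<Longrightarrow> frag_extend f (frag_of (x, y)) = g (frag_of x) (frag_of y)"
    and g1: "\<And>a a' b. g (a - a') b = g a b - g a' b" and g2: "\<And>a b b'. g a (b - b') = g a b - g a b'"
  shows "frag_extend f (fprod a b) = g a b"
proof -
  have g0: "g 0 b = 0" "g a 0 = 0" for a b
    using g1[of 0 0 b] g2[of a 0 0] by simp_all
  have 1: "frag_extend f (fprod (frag_of x) b) = g (frag_of x) b" if "x \<in> A" for x
    using assms(2)
    by (induction b rule: frag_induction) (use assms(3)[OF that] in \<open>simp_all add: g0 g2 fprod_simps frag_extend_diff\<close>)
  show ?thesis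
    using assms(1)
    by (induction a rule: frag_induction) (simp_all add: 1 g0 g1 fprod_simps frag_extend_diff)
qed

lemma frag_cmul_diff: "frag_cmul k (a - b) = frag_cmul k a - frag_cmul k b"
  using frag_cmul_distrib2[of k "a - b" b] by (simp add: algebra_simps)

definition tensor_bdry :: "('a \<Rightarrow> nat) \<Rightarrow> ('a \<Rightarrow> 'a \<Rightarrow>\<^sub>0 int) \<Rightarrow> ('b \<Rightarrow> 'b \<Rightarrow>\<^sub>0 int) \<Rightarrow> 'a \<times> 'b \<Rightarrow> 'a \<times> 'b \<Rightarrow>\<^sub>0 int"
  where "tensor_bdry dg d d' = (\<lambda>(x, y). fprod (d x) (frag_of y) + frag_cmul ((-1) ^ dg x) (fprod (frag_of x) (d' y)))"

definition tensor_deg :: "('a \<Rightarrow> nat) \<Rightarrow> ('b \<Rightarrow> nat) \<Rightarrow> 'a \<times> 'b \<Rightarrow> nat"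
  where "tensor_deg dg dg' = (\<lambda>(x, y). dg x + dg' y)"

definition tensor_op :: "('a \<Rightarrow> 'c \<Rightarrow>\<^sub>0 int) \<Rightarrow> ('b \<Rightarrow> 'd \<Rightarrow>\<^sub>0 int) \<Rightarrow> 'a \<times> 'b \<Rightarrow> 'c \<times> 'd \<Rightarrow>\<^sub>0 int"
  where "tensor_op f g = (\<lambda>(x, y). fprod (f x) (g y))"

lemma tensor_op_fprod: "frag_extend (tensor_op f g) (fprod a b) = fprod (frag_extend f a) (frag_extend g b)"
  by (rule fprod_eqI[OF subset_UNIV subset_UNIV, where g = "\<lambda>a b. fprod (frag_extend f a) (frag_extend g b)"])
     (simp_all add: tensor_op_def frag_extend_diff fprod_simps)

lemma tensor_bdry_fprod:
  assumes "Poly_Mapping.keys a \<subseteq> {x. dg x = n}"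
  shows "frag_extend (tensor_bdry dg d d') (fprod a b) =
    fprod (frag_extend d a) b + frag_cmul ((-1) ^ n) (fprod a (frag_extend d' b))"
  by (rule fprod_eqI[OF assms subset_UNIV, where g = "\<lambda>a b. fprod (frag_extend d a) b + frag_cmul ((-1) ^ n) (fprod a (frag_extend d' b))"])
     (auto simp: tensor_bdry_def frag_extend_diff fprod_simps frag_cmul_diff)

text \<open>A contracting homotopy h onto the vertex b is carried along instead of mere exactness,
  because it passes to tensor products by an explicit formula.\<close>

definition contracted :: "'a set \<Rightarrow> ('a \<Rightarrow> nat) \<Rightarrow> ('a \<Rightarrow> 'a \<Rightarrow>\<^sub>0 int) \<Rightarrow> ('a \<Rightarrow> 'a \<Rightarrow>\<^sub>0 int) \<Rightarrow> 'a \<Rightarrow> bool"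
  where "contracted S dg d h b \<longleftrightarrow>
    (\<forall>x\<in>S. Poly_Mapping.keys (d x) \<subseteq> {y\<in>S. Suc (dg y) = dg x}) \<and>
    (\<forall>x\<in>S. frag_extend d (d x) = 0) \<and>
    (\<forall>x\<in>S. dg x = 1 \<longrightarrow> augm (d x) = 0) \<and>
    b \<in> S \<and> dg b = 0 \<and>
    (\<forall>x\<in>S. Poly_Mapping.keys (h x) \<subseteq> {y\<in>S. dg y = Suc (dg x)}) \<and>
    (\<forall>x\<in>S. frag_extend d (h x) + frag_extend h (d x) = frag_of x - (if dg x = 0 then frag_of b else 0))"

text \<open>The homotopy h (x) 1 + (b eps) (x) h' with eps the augmentation: contract the first
  factor to b, then the second factor along b. On basis elements b eps is nonzero in degree 0 only,
  whence the case distinction.\<close>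

definition tensor_htpy :: "('a \<Rightarrow> nat) \<Rightarrow> ('a \<Rightarrow> 'a \<Rightarrow>\<^sub>0 int) \<Rightarrow> 'a \<Rightarrow> ('b \<Rightarrow> 'b \<Rightarrow>\<^sub>0 int) \<Rightarrow> 'a \<times> 'b \<Rightarrow> 'a \<times> 'b \<Rightarrow>\<^sub>0 int"
  where "tensor_htpy dg h b h' = (\<lambda>(x, y). fprod (h x) (frag_of y) + (if dg x = 0 then fprod (frag_of b) (h' y) else 0))"

lemma extend_const: "frag_extend (\<lambda>_. c) a = frag_extend (\<lambda>_. c) (augm a)"
  unfolding augm_def
  by (rule frag_induction[OF subset_UNIV, where c = a]) (simp_all add: frag_extend_diff)

lemma tensor_htpy_fprod:
  assumes "Poly_Mapping.keys a \<subseteq> {x. dg x = n}"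
  shows "frag_extend (tensor_htpy dg h b h') (fprod a c) =
    fprod (frag_extend h a) c + (if n = 0 then fprod (frag_extend (\<lambda>_. frag_of b) a) (frag_extend h' c) else 0)"
  by (rule fprod_eqI[OF assms subset_UNIV, where g = "\<lambda>a c. fprod (frag_extend h a) c + (if n = 0 then fprod (frag_extend (\<lambda>_. frag_of b) a) (frag_extend h' c) else 0)"])
     (auto simp: tensor_htpy_def frag_extend_diff fprod_simps)

lemma augm_fprod: "augm (fprod a b) = frag_extend (\<lambda>_. augm b) a"
  unfolding augm_def
  by (rule fprod_eqI[OF subset_UNIV subset_UNIV, where g = "\<lambda>a b. frag_extend (\<lambda>_. frag_extend (\<lambda>_. frag_of ()) b) a"])
     (simp_all add: frag_extend_diff frag_extend_diff_fun)

theorem contracted_tensor: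
  assumes A: "contracted A dg d h b" and B: "contracted B dg' d' h' b'"
  shows "contracted (A \<times> B) (tensor_deg dg dg') (tensor_bdry dg d d') (tensor_htpy dg h b h') (b, b')"
    (is "contracted _ ?dg ?d ?h _")
proof -
  have dk: "Poly_Mapping.keys (d x) \<subseteq> {y\<in>A. Suc (dg y) = dg x}" if "x \<in> A" for x
    using A that by (simp add: contracted_def)
  have dk': "Poly_Mapping.keys (d' x) \<subseteq> {y\<in>B. Suc (dg' y) = dg' x}" if "x \<in> B" for x
    using B that by (simp add: contracted_def)
  have hk: "Poly_Mapping.keys (h x) \<subseteq> {y\<in>A. dg y = Suc (dg x)}" if "x \<in> A" for x
    using A that by (simp add: contracted_def)
  have hk': "Poly_Mapping.keys (h' x) \<subseteq> {y\<in>B. dg' y = Suc (dg' x)}" if "x \<in> B" for x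
    using B that by (simp add: contracted_def)
  have d0: "d x = 0" if "x \<in> A" "dg x = 0" for x
    using dk[OF that(1)] that(2) by (simp flip: keys_eq_empty)
  have d0': "d' x = 0" if "x \<in> B" "dg' x = 0" for x
    using dk'[OF that(1)] that(2) by (simp flip: keys_eq_empty)
  have dd: "frag_extend ?d (fprod (d x) c) = fprod (frag_extend d (d x)) c + frag_cmul ((-1) ^ (dg x - 1)) (fprod (d x) (frag_extend d' c))"
    if "x \<in> A" for x c
    by (rule tensor_bdry_fprod) (use dk[OF that] in auto)
  have dh: "frag_extend ?d (fprod (h x) c) = fprod (frag_extend d (h x)) c + frag_cmul ((-1) ^ Suc (dg x)) (fprod (h x) (frag_extend d' c))"
    if "x \<in> A" for x c
    by (rule tensor_bdry_fprod) (use hk[OF that] in auto)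
  have d1: "frag_extend ?d (fprod (frag_of x) c) = fprod (d x) c + frag_cmul ((-1) ^ dg x) (fprod (frag_of x) (frag_extend d' c))"
    for x c
    using tensor_bdry_fprod[of "frag_of x" dg "dg x"] by simp
  have h1: "frag_extend ?h (fprod (frag_of x) c) = fprod (h x) c + (if dg x = 0 then fprod (frag_of b) (frag_extend h' c) else 0)"
    for x c
    using tensor_htpy_fprod[of "frag_of x" dg "dg x" h b h' c] by simp
  \<comment> \<open>The part of the homotopy that moves the second factor sees the first one through
    its augmentation, and boundaries have augmentation 0.\<close>
  have hd: "frag_extend ?h (fprod (d x) c) = fprod (frag_extend h (d x)) c"
    if x: "x \<in> A" for x c
  proof (cases "dg x = 0")
    case True then show ?thesis using d0 x by simp
  next
    case False
    have "frag_extend (\<lambda>_. frag_of b) (d x) = 0" if "dg x = 1"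
      by (subst extend_const) (use A x that in \<open>simp add: contracted_def\<close>)
    moreover have "Poly_Mapping.keys (d x) \<subseteq> {y. dg y = dg x - 1}"
      using dk[OF x] by auto
    ultimately show ?thesis
      using tensor_htpy_fprod[of "d x" dg "dg x - 1" h b h' c] False by auto
  qed
  \<comment> \<open>The mixed terms cancel because d lowers the degree by one. For
    \<open>dg x = 0\<close> the truncated exponent does no harm, as d x = 0.\<close>
  have sg: "frag_cmul ((-1) ^ (dg x - 1)) (fprod (d x) c) + frag_cmul ((-1) ^ dg x) (fprod (d x) c) = 0"
    if "x \<in> A" for x c
  proof (cases "dg x")
    case 0 then show ?thesis using d0 that by simp
  next
    case (Suc n) then show ?thesis by (simp flip: frag_cmul_distrib)
  qed
  show ?thesis
    unfolding contracted_def
  proof (intro conjI ballI impI)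
    fix p assume "p \<in> A \<times> B"
    then obtain x y where p: "p = (x, y)" and x: "x \<in> A" and y: "y \<in> B" by auto
    have "Poly_Mapping.keys (?d (x, y)) \<subseteq> Poly_Mapping.keys (fprod (d x) (frag_of y)) \<union> Poly_Mapping.keys (fprod (frag_of x) (d' y))"
      unfolding tensor_bdry_def split by (rule order_trans[OF keys_add Un_mono[OF order_refl keys_cmul]])
    also have "\<dots> \<subseteq> Poly_Mapping.keys (d x) \<times> {y} \<union> {x} \<times> Poly_Mapping.keys (d' y)"
      using keys_fprod[of "d x" "frag_of y"] keys_fprod[of "frag_of x" "d' y"] by auto
    finally show "Poly_Mapping.keys (?d p) \<subseteq> {q\<in>A \<times> B. Suc (?dg q) = ?dg p}"
      using dk[OF x] dk'[OF y] x y by (force simp: p tensor_deg_def)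
    have "Poly_Mapping.keys (?h (x, y)) \<subseteq> Poly_Mapping.keys (h x) \<times> {y} \<union> (if dg x = 0 then {b} \<times> Poly_Mapping.keys (h' y) else {})"
      unfolding tensor_htpy_def split using keys_add[of "fprod (h x) (frag_of y)"] keys_fprod[of "h x" "frag_of y"] keys_fprod[of "frag_of b" "h' y"]
      by (auto split: if_splits)
    then show "Poly_Mapping.keys (?h p) \<subseteq> {q\<in>A \<times> B. ?dg q = Suc (?dg p)}"
      unfolding p using hk[OF x] hk'[OF y] x y A
      by (cases "dg x = 0") (fastforce simp: tensor_deg_def contracted_def)+
    have "frag_extend ?d (?d (x, y)) = fprod (frag_extend d (d x)) (frag_of y) +
        (frag_cmul ((-1) ^ (dg x - 1)) (fprod (d x) (d' y)) + frag_cmul ((-1) ^ dg x) (fprod (d x) (d' y))) +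
        frag_cmul ((-1) ^ dg x) (frag_cmul ((-1) ^ dg x) (fprod (frag_of x) (frag_extend d' (d' y))))"
      by (subst (2) tensor_bdry_def) (simp add: frag_extend_add frag_extend_cmul dd x d1 frag_cmul_distrib2 algebra_simps)
    then show "frag_extend ?d (?d p) = 0"
      using A B x y sg[OF x] by (simp add: contracted_def p)
    show "augm (?d p) = 0" if "?dg p = 1"
    proof -
      have "(dg x = 1 \<and> dg' y = 0) \<or> (dg x = 0 \<and> dg' y = 1)" using that by (auto simp: p tensor_deg_def)
      then show ?thesis
      proof
        assume *: "dg x = 1 \<and> dg' y = 0"
        have "augm (fprod (d x) (frag_of y)) = frag_extend (\<lambda>_. augm (frag_of y)) (augm (d x))"
          unfolding augm_fprod by (rule extend_const)
        also have "augm (d x) = 0" using A x * by (simp add: contracted_def)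
        finally show ?thesis using * d0'[OF y] by (simp add: p tensor_bdry_def)
      next
        assume *: "dg x = 0 \<and> dg' y = 1"
        have "augm (d' y) = 0" using B y * by (simp add: contracted_def)
        then show ?thesis using * d0[OF x] by (simp add: p tensor_bdry_def augm_fprod)
      qed
    qed
    have db: "d b = 0" by (rule d0) (use A in \<open>simp_all add: contracted_def\<close>)
    have degb: "dg b = 0" using A by (simp add: contracted_def)
    have A1: "frag_extend d (h x) + frag_extend h (d x) = frag_of x - (if dg x = 0 then frag_of b else 0)"
      using A x by (simp add: contracted_def)
    have B1: "frag_extend d' (h' y) + frag_extend h' (d' y) = frag_of y - (if dg' y = 0 then frag_of b' else 0)"
      using B y by (simp add: contracted_def)
    have L: "frag_extend ?d (?h (x, y)) = fprod (frag_extend d (h x)) (frag_of y) - frag_cmul ((-1) ^ dg x) (fprod (h x) (d' y))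
        + (if dg x = 0 then fprod (frag_of b) (frag_extend d' (h' y)) else 0)"
      by (subst tensor_htpy_def) (simp add: frag_extend_add dh x d1 db degb)
    have R: "frag_extend ?h (?d (x, y)) = fprod (frag_extend h (d x)) (frag_of y) + frag_cmul ((-1) ^ dg x) (fprod (h x) (d' y))
        + (if dg x = 0 then fprod (frag_of b) (frag_extend h' (d' y)) else 0)"
      by (subst tensor_bdry_def) (simp add: frag_extend_add frag_extend_cmul hd x h1 frag_cmul_distrib2)
    have "frag_extend ?d (?h (x, y)) + frag_extend ?h (?d (x, y)) =
       fprod (frag_extend d (h x) + frag_extend h (d x)) (frag_of y) +
       (if dg x = 0 then fprod (frag_of b) (frag_extend d' (h' y) + frag_extend h' (d' y)) else 0)"
      unfolding L R by (simp add: fprod_simps algebra_simps)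
    then show "frag_extend ?d (?h p) + frag_extend ?h (?d p) = frag_of p - (if ?dg p = 0 then frag_of (b, b') else 0)"
      unfolding A1 B1 p by (simp add: fprod_simps tensor_deg_def)
  qed (use A B in \<open>auto simp: contracted_def tensor_deg_def\<close>)
qed

definition chain_op :: "'a set \<Rightarrow> ('a \<Rightarrow> nat) \<Rightarrow> ('a \<Rightarrow> 'a \<Rightarrow>\<^sub>0 int) \<Rightarrow> ('a \<Rightarrow> 'a \<Rightarrow>\<^sub>0 int) \<Rightarrow> bool"
  where "chain_op S dg d f \<longleftrightarrow> (\<forall>x\<in>S. Poly_Mapping.keys (f x) \<subseteq> {y\<in>S. dg y = dg x} \<and>
     frag_extend d (f x) = frag_extend f (d x) \<and> (dg x = 0 \<longrightarrow> augm (f x) = frag_of ()))"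

lemma chain_op_tensor:
  assumes A: "chain_op A dg d f" and B: "chain_op B dg' d' g"
  shows "chain_op (A \<times> B) (tensor_deg dg dg') (tensor_bdry dg d d') (tensor_op f g)"
  unfolding chain_op_def
proof (intro ballI conjI impI)
  fix p assume "p \<in> A \<times> B"
  then obtain x y where p: "p = (x, y)" and x: "x \<in> A" and y: "y \<in> B" by auto
  have fk: "Poly_Mapping.keys (f x) \<subseteq> {y\<in>A. dg y = dg x}" and gk: "Poly_Mapping.keys (g y) \<subseteq> {z\<in>B. dg' z = dg' y}"
    using A B x y by (auto simp: chain_op_def)
  show "Poly_Mapping.keys (tensor_op f g p) \<subseteq> {q\<in>A \<times> B. tensor_deg dg dg' q = tensor_deg dg dg' p}"
    using keys_fprod[of "f x" "g y"] fk gk by (fastforce simp: p tensor_op_def tensor_deg_def)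
  have "frag_extend (tensor_bdry dg d d') (fprod (f x) (g y)) =
     fprod (frag_extend d (f x)) (g y) + frag_cmul ((-1) ^ dg x) (fprod (f x) (frag_extend d' (g y)))"
    by (rule tensor_bdry_fprod) (use fk in auto)
  also have "\<dots> = frag_extend (tensor_op f g) (tensor_bdry dg d d' p)"
    using A B x y by (simp add: tensor_bdry_def p frag_extend_add frag_extend_cmul tensor_op_fprod chain_op_def)
  finally show "frag_extend (tensor_bdry dg d d') (tensor_op f g p) = frag_extend (tensor_op f g) (tensor_bdry dg d d' p)"
    by (simp add: tensor_op_def p)
  show "augm (tensor_op f g p) = frag_of ()" if "tensor_deg dg dg' p = 0"
  proof -
    have *: "augm (f x) = frag_of ()" "augm (g y) = frag_of ()"
      using that A B x y by (auto simp: p tensor_deg_def chain_op_def)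
    then show ?thesis by (simp add: tensor_op_def p augm_fprod) (subst extend_const, simp)
  qed
qed

definition signed :: "('a \<Rightarrow> int \<times> 'b) \<Rightarrow> 'a \<Rightarrow> 'b \<Rightarrow>\<^sub>0 int"
  where "signed f x = frag_cmul (fst (f x)) (frag_of (snd (f x)))"

definition spair :: "('a \<Rightarrow> int \<times> 'c) \<Rightarrow> ('b \<Rightarrow> int \<times> 'd) \<Rightarrow> 'a \<times> 'b \<Rightarrow> int \<times> ('c \<times> 'd)"
  where "spair f g = (\<lambda>(x, y). (fst (f x) * fst (g y), (snd (f x), snd (g y))))"

text \<open>No Koszul sign enters because both maps preserve the degree.\<close>

lemma signed_spair: "signed (spair f g) = tensor_op (signed f) (signed g)"
  by (auto simp: fun_eq_iff signed_def spair_def tensor_op_def fprod_simps mult.commute)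

subsection \<open>The line, the plane and the six-dimensional cubical complex\<close>

text \<open>
  \<open>(z, False)\<close> is the vertex \<open>z\<close> of the line and \<open>(z, True)\<close> the edge from \<open>z\<close> to \<open>z + 1\<close>. A cell of
  the torus is determined by its \<open>bits\<close>, the coordinates in which it extends.
\<close>

type_synonym lcell = "int \<times> bool"
type_synonym pcell = "lcell \<times> lcell"
type_synonym kcell = "pcell \<times> pcell \<times> pcell"
type_synonym lattice = "(int \<times> int) \<times> (int \<times> int) \<times> (int \<times> int)"
type_synonym bits = "(bool \<times> bool) \<times> (bool \<times> bool) \<times> (bool \<times> bool)"

definition ldeg :: "lcell \<Rightarrow> nat" where "ldeg = (\<lambda>(z, b). of_bool b)"

definition lbdry :: "lcell \<Rightarrow> lcell \<Rightarrow>\<^sub>0 int"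
  where "lbdry = (\<lambda>(z, b). if b then frag_of (z + 1, False) - frag_of (z, False) else 0)"

text \<open>The oriented edge path from 0 to z. One of the two sums is always empty; the second one
  is the path towards negative z, traversed backwards.\<close>

definition lhtpy :: "lcell \<Rightarrow> lcell \<Rightarrow>\<^sub>0 int"
  where "lhtpy = (\<lambda>(z, b). if b then 0 else (\<Sum>j\<in>{0..<z}. frag_of (j, True)) - (\<Sum>j\<in>{z..<0}. frag_of (j, True)))"

lemma lhtpy_step: "lhtpy (z + 1, False) = lhtpy (z, False) + frag_of (z, True)"
proof (cases "z \<ge> 0")
  case True
  then have "{0..<z + 1} = insert z {0..<z}" by auto
  with True show ?thesis by (simp add: lhtpy_def add.commute)
next
  case False
  then have "{z..<0} = insert z {z + 1..<0}" by auto
  with False show ?thesis by (simp add: lhtpy_def)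
qed

lemma contracted_line: "contracted UNIV ldeg lbdry lhtpy (0, False)"
proof -
  have dh: "frag_extend lbdry (lhtpy (z, False)) = frag_of (z, False) - frag_of (0, False)" for z
  proof (induction z rule: int_induct[of _ 0])
    case base then show ?case by (simp add: lhtpy_def)
  next
    case (step1 i) then show ?case by (simp add: lhtpy_step frag_extend_add) (simp add: lbdry_def)
  next
    case (step2 i)
    then show ?case using lhtpy_step[of "i - 1"] by (simp add: frag_extend_add) (simp add: lbdry_def algebra_simps)
  qed
  have k: "Poly_Mapping.keys (lhtpy (z, b)) \<subseteq> {y. ldeg y = Suc (ldeg (z, b))}" for z b
  proof -
    have 1: "Poly_Mapping.keys (\<Sum>j\<in>I. frag_of (j, True)) \<subseteq> range (\<lambda>j. (j, True))" for I :: "int set"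
      by (rule order_trans[OF keys_sum]) auto
    have "Poly_Mapping.keys (lhtpy (z, False)) \<subseteq> range (\<lambda>j. (j, True))"
      unfolding lhtpy_def using order_trans[OF keys_diff Un_least[OF 1 1]] by simp
    then show ?thesis by (cases b) (auto simp: ldeg_def, simp add: lhtpy_def)
  qed
  have lk: "Poly_Mapping.keys (lbdry (z, b)) \<subseteq> {y. Suc (ldeg y) = ldeg (z, b)}" for z b
    using keys_diff[of "frag_of (z + 1, False)" "frag_of (z, False)"] by (auto simp: lbdry_def ldeg_def)
  show ?thesis
    unfolding contracted_def
  proof (intro conjI ballI impI)
    fix x :: lcell
    obtain z b where x: "x = (z, b)" by (cases x)
    show "frag_extend lbdry (lhtpy x) + frag_extend lhtpy (lbdry x) = frag_of x - (if ldeg x = 0 then frag_of (0, False) else 0)"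
    proof (cases b)
      case True
      then show ?thesis by (simp add: x lbdry_def frag_extend_diff lhtpy_step ldeg_def) (simp add: lhtpy_def)
    next
      case False
      then show ?thesis using dh by (simp add: x ldeg_def) (simp add: lbdry_def)
    qed
    show "Poly_Mapping.keys (lbdry x) \<subseteq> {y \<in> UNIV. Suc (ldeg y) = ldeg x}" using lk x by simp
    show "Poly_Mapping.keys (lhtpy x) \<subseteq> {y \<in> UNIV. ldeg y = Suc (ldeg x)}" using k x by simp
  qed (auto simp: lbdry_def frag_extend_diff ldeg_def augm_def)
qed

definition pdeg :: "pcell \<Rightarrow> nat" where "pdeg = tensor_deg ldeg ldeg"
definition pbdry :: "pcell \<Rightarrow> pcell \<Rightarrow>\<^sub>0 int" where "pbdry = tensor_bdry ldeg lbdry lbdry"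
definition phtpy :: "pcell \<Rightarrow> pcell \<Rightarrow>\<^sub>0 int" where "phtpy = tensor_htpy ldeg lhtpy (0, False) lhtpy"

lemma contracted_plane: "contracted UNIV pdeg pbdry phtpy ((0, False), (0, False))"
  using contracted_tensor[OF contracted_line contracted_line]
  by (simp add: pdeg_def pbdry_def phtpy_def)

definition kdeg :: "kcell \<Rightarrow> nat" where "kdeg = tensor_deg pdeg (tensor_deg pdeg pdeg)"
definition kbdry :: "kcell \<Rightarrow> kcell \<Rightarrow>\<^sub>0 int" where "kbdry = tensor_bdry pdeg pbdry (tensor_bdry pdeg pbdry pbdry)"

lemma contracted_cubes: "\<exists>h b. contracted UNIV kdeg kbdry h b"
  using contracted_tensor[OF contracted_plane contracted_tensor[OF contracted_plane contracted_plane]]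
  unfolding kdeg_def kbdry_def UNIV_Times_UNIV by (intro exI)

text \<open>Signed cell maps of the plane: the point reflection, the quarter turn \<open>(x, y) \<mapsto> (- y, x)\<close>
  and its inverse.\<close>

definition refl :: "pcell \<Rightarrow> int \<times> pcell"
  where "refl = (\<lambda>((z, b), (w, c)). (if b \<noteq> c then -1 else 1,
     ((if b then - z - 1 else - z, b), (if c then - w - 1 else - w, c))))"

definition turn :: "pcell \<Rightarrow> int \<times> pcell"
  where "turn = (\<lambda>((z, b), (w, c)). (if c \<and> \<not> b then -1 else 1, ((if c then - w - 1 else - w, c), (z, b))))"

definition unturn :: "pcell \<Rightarrow> int \<times> pcell"
  where "unturn = (\<lambda>((z, b), (w, c)). (if b \<and> \<not> c then -1 else 1, ((w, c), (if b then - z - 1 else - z, b))))"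

lemma pbdry_simps:
  "pbdry ((z, False), (w, False)) = 0"
  "pbdry ((z, True), (w, False)) = frag_of ((z + 1, False), (w, False)) - frag_of ((z, False), (w, False))"
  "pbdry ((z, False), (w, True)) = frag_of ((z, False), (w + 1, False)) - frag_of ((z, False), (w, False))"
  "pbdry ((z, True), (w, True)) = frag_of ((z + 1, False), (w, True)) - frag_of ((z, False), (w, True))
     - frag_of ((z, True), (w + 1, False)) + frag_of ((z, True), (w, False))"
  by (simp_all add: pbdry_def tensor_bdry_def lbdry_def ldeg_def fprod_simps)

lemma pdeg_simp: "pdeg ((z, b), (w, c)) = of_bool b + of_bool c"
  by (simp add: pdeg_def tensor_deg_def ldeg_def)

text \<open>Every coordinate in which the cell extends is reversed and contributes a factor -1. The
  edge from z to z + 1 goes to the edge that starts at - z - 1.\<close>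

lemma chain_op_refl: "chain_op UNIV pdeg pbdry (signed refl)"
  unfolding chain_op_def
proof (intro ballI conjI impI)
  fix p :: pcell
  obtain z b w c where p: "p = ((z, b), (w, c))" by (metis prod.collapse)
  show "Poly_Mapping.keys (signed refl p) \<subseteq> {y \<in> UNIV. pdeg y = pdeg p}"
    by (auto simp: p signed_def refl_def pdeg_simp)
  show "frag_extend pbdry (signed refl p) = frag_extend (signed refl) (pbdry p)"
    by (cases b; cases c) (simp_all add: p signed_def refl_def pbdry_simps frag_extend_diff frag_extend_minus frag_extend_add)
  show "augm (signed refl p) = frag_of ()" if "pdeg p = 0"
    using that by (auto simp: p signed_def refl_def pdeg_simp augm_def)
qed

text \<open>The turn sends the first axis to the second and the second to minus the first. Hence
  edges along the second axis change sign, while on a square the reversal and the exchange of the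
  two factors cancel.\<close>

lemma chain_op_turn: "chain_op UNIV pdeg pbdry (signed turn)"
  unfolding chain_op_def
proof (intro ballI conjI impI)
  fix p :: pcell
  obtain z b w c where p: "p = ((z, b), (w, c))" by (metis prod.collapse)
  show "Poly_Mapping.keys (signed turn p) \<subseteq> {y \<in> UNIV. pdeg y = pdeg p}"
    by (auto simp: p signed_def turn_def pdeg_simp)
  show "frag_extend pbdry (signed turn p) = frag_extend (signed turn) (pbdry p)"
    by (cases b; cases c) (simp_all add: p signed_def turn_def pbdry_simps frag_extend_diff frag_extend_minus frag_extend_add)
  show "augm (signed turn p) = frag_of ()" if "pdeg p = 0"
    using that by (auto simp: p signed_def turn_def pdeg_simp augm_def)
qed

definition pshift :: "int \<times> int \<Rightarrow> pcell \<Rightarrow> pcell"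
  where "pshift = (\<lambda>(m, n) ((z, b), (w, c)). ((z + m, b), (w + n, c)))"

definition kshift :: "lattice \<Rightarrow> kcell \<Rightarrow> kcell"
  where "kshift = (\<lambda>(m, n, k) (x, y, z). (pshift m x, pshift n y, pshift k z))"

lemma chain_op_pshift: "chain_op UNIV pdeg pbdry (\<lambda>x. frag_of (pshift m x))"
  unfolding chain_op_def
proof (intro ballI conjI impI)
  fix p :: pcell
  obtain z b w c where p: "p = ((z, b), (w, c))" by (metis prod.collapse)
  obtain m1 m2 where m: "m = (m1, m2)" by (cases m)
  show "Poly_Mapping.keys (frag_of (pshift m p)) \<subseteq> {y \<in> UNIV. pdeg y = pdeg p}"
    by (auto simp: p m pshift_def pdeg_simp)
  show "frag_extend pbdry (frag_of (pshift m p)) = frag_extend (\<lambda>x. frag_of (pshift m x)) (pbdry p)"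
    by (cases b; cases c) (simp_all add: p m pshift_def pbdry_simps frag_extend_diff frag_extend_minus frag_extend_add add.commute add.left_commute)
  show "augm (frag_of (pshift m p)) = frag_of ()"
    by (simp add: augm_def)
qed

text \<open>The action of \<open>tau\<close> on cubes: -1 on the first complex coordinate, i on the
  other two.\<close>

definition krot :: "kcell \<Rightarrow> int \<times> kcell" where "krot = spair refl (spair turn turn)"
definition kunrot :: "kcell \<Rightarrow> int \<times> kcell" where "kunrot = spair refl (spair unturn unturn)"

lemma chain_op_krot: "chain_op UNIV kdeg kbdry (signed krot)"
  using chain_op_tensor[OF chain_op_refl chain_op_tensor[OF chain_op_turn chain_op_turn]]
  by (simp add: krot_def signed_spair kdeg_def kbdry_def)

lemma chain_op_kshift: "chain_op UNIV kdeg kbdry (\<lambda>x. frag_of (kshift m x))"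
proof -
  obtain a b c where m: "m = (a, b, c)" by (cases m)
  have "(\<lambda>x. frag_of (kshift m x)) = tensor_op (\<lambda>x. frag_of (pshift a x)) (tensor_op (\<lambda>x. frag_of (pshift b x)) (\<lambda>x. frag_of (pshift c x)))"
    by (auto simp: fun_eq_iff tensor_op_def kshift_def m)
  then show ?thesis
    using chain_op_tensor[OF chain_op_pshift[of a] chain_op_tensor[OF chain_op_pshift[of b] chain_op_pshift[of c]]]
    by (simp add: kdeg_def kbdry_def)
qed

subsection \<open>The periodic resolution of the cyclic group of order four\<close>

definition cdeg :: "nat \<times> nat \<Rightarrow> nat" where "cdeg = snd"

text \<open>The pair (k, i) stands for t^k times the generator in degree i, where t generates Z/4.
  The boundary alternates between t - 1 and the norm 1 + t + t^2 + t^3.\<close>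

definition cbdry :: "nat \<times> nat \<Rightarrow> nat \<times> nat \<Rightarrow>\<^sub>0 int"
  where "cbdry = (\<lambda>(k, i). if i = 0 then 0
     else if odd i then frag_of ((k + 1) mod 4, i - 1) - frag_of (k, i - 1)
     else (\<Sum>j<4. frag_of (j, i - 1)))"

text \<open>In even degrees t^k goes to 1 + ... + t^(k-1), which t - 1 maps to t^k - 1. In odd
  degrees only t^3 is sent to the generator, so that the norm element is sent to 1, the term missing
  from t^k - 1.\<close>

definition chtpy :: "nat \<times> nat \<Rightarrow> nat \<times> nat \<Rightarrow>\<^sub>0 int"
  where "chtpy = (\<lambda>(k, i). if even i then (\<Sum>j<k. frag_of (j, Suc i))
     else if k = 3 then frag_of (0, Suc i) else 0)"

abbreviation ccells :: "(nat \<times> nat) set" where "ccells \<equiv> {..<4} \<times> UNIV"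

definition crot :: "nat \<times> nat \<Rightarrow> nat \<times> nat \<Rightarrow>\<^sub>0 int"
  where "crot = (\<lambda>(k, i). frag_of ((k + 1) mod 4, i))"

lemma sum_lessThan_4: "(\<Sum>j<4. f j) = f 0 + f 1 + f 2 + f (3::nat)" for f :: "nat \<Rightarrow> 'a::comm_monoid_add"
  by (simp add: numeral_eq_Suc)

lemma succ_mod4: "(0 + 1) mod 4 = Suc 0" "(Suc 0 + 1) mod 4 = 2" "(2 + 1) mod 4 = (3::nat)" "(3 + 1) mod 4 = (0::nat)"
  by simp_all

lemma cbdry_even:
  "even i \<Longrightarrow> i \<noteq> 0 \<Longrightarrow> cbdry (k, i) =
     frag_of (0, i - 1) + frag_of (Suc 0, i - 1) + frag_of (2, i - 1) + frag_of (3, i - 1)"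
  by (simp add: cbdry_def sum_lessThan_4)

lemma cbdry_odd:
  assumes "odd i"
  shows "cbdry (0, i) = frag_of (Suc 0, i - 1) - frag_of (0, i - 1)"
    "cbdry (Suc 0, i) = frag_of (2, i - 1) - frag_of (Suc 0, i - 1)"
    "cbdry (2, i) = frag_of (3, i - 1) - frag_of (2, i - 1)"
    "cbdry (3, i) = frag_of (0, i - 1) - frag_of (3, i - 1)"
proof -
  have "i \<noteq> 0" using assms by (cases i) auto
  then show "cbdry (0, i) = frag_of (Suc 0, i - 1) - frag_of (0, i - 1)"
    "cbdry (Suc 0, i) = frag_of (2, i - 1) - frag_of (Suc 0, i - 1)"
    "cbdry (2, i) = frag_of (3, i - 1) - frag_of (2, i - 1)"
    "cbdry (3, i) = frag_of (0, i - 1) - frag_of (3, i - 1)"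
    using assms by (simp_all only: cbdry_def split succ_mod4 if_False if_True not_True_eq_False not_False_eq_True)
qed

lemma crot_simps:
  "crot (0, i) = frag_of (Suc 0, i)" "crot (Suc 0, i) = frag_of (2, i)"
  "crot (2, i) = frag_of (3, i)" "crot (3, i) = frag_of (0, i)"
  by (simp_all only: crot_def split succ_mod4)

lemma chtpy_simps:
  "even i \<Longrightarrow> chtpy (0, i) = 0" "even i \<Longrightarrow> chtpy (Suc 0, i) = frag_of (0, Suc i)"
  "even i \<Longrightarrow> chtpy (2, i) = frag_of (0, Suc i) + frag_of (Suc 0, Suc i)"
  "even i \<Longrightarrow> chtpy (3, i) = frag_of (0, Suc i) + frag_of (Suc 0, Suc i) + frag_of (2, Suc i)"
  "odd i \<Longrightarrow> chtpy (0, i) = 0" "odd i \<Longrightarrow> chtpy (Suc 0, i) = 0" "odd i \<Longrightarrow> chtpy (2, i) = 0"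
  "odd i \<Longrightarrow> chtpy (3, i) = frag_of (0, Suc i)"
  by (simp_all add: chtpy_def numeral_2_eq_2 numeral_3_eq_3)

lemma contracted_cyclic: "contracted ccells cdeg cbdry chtpy (0, 0)"
  unfolding contracted_def
proof (intro conjI ballI impI)
  fix x :: "nat \<times> nat" assume "x \<in> ccells"
  then obtain k i where x: "x = (k, i)" and k: "k < 4" by auto
  have k': "k = 0 \<or> k = Suc 0 \<or> k = 2 \<or> k = 3" using k by auto
  show "Poly_Mapping.keys (cbdry x) \<subseteq> {y \<in> ccells. Suc (cdeg y) = cdeg x}"
  proof -
    have "Poly_Mapping.keys (\<Sum>j<4. frag_of (j, i - 1)) \<subseteq> {..<4::nat} \<times> {i - 1}"
      by (rule order_trans[OF keys_sum]) auto
    moreover have "Poly_Mapping.keys (frag_of ((k + 1) mod 4, i - 1) - frag_of (k, i - 1)) \<subseteq> {..<4} \<times> {i - 1}"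
      by (rule order_trans[OF keys_diff]) (use k in auto)
    ultimately show ?thesis
      by (auto simp: x cbdry_def cdeg_def)
  qed
  show "frag_extend cbdry (cbdry x) = 0"
  proof (cases "even i")
    case True
    then show ?thesis
      by (cases "i = 0") (simp_all add: x cbdry_even cbdry_odd frag_extend_add, simp add: cbdry_def)
  next
    case False
    then show ?thesis
      by (cases "i = 1") (use k' in \<open>auto simp: x cbdry_odd cbdry_even frag_extend_diff\<close>, simp_all add: cbdry_def)
  qed
  show "augm (cbdry x) = 0" if "cdeg x = 1"
    using that by (simp add: x cdeg_def cbdry_def augm_def frag_extend_diff)
  show "Poly_Mapping.keys (chtpy x) \<subseteq> {y \<in> ccells. cdeg y = Suc (cdeg x)}"
  proof -
    have "Poly_Mapping.keys (\<Sum>j<k. frag_of (j, Suc i)) \<subseteq> {..<4::nat} \<times> {Suc i}"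
      by (rule order_trans[OF keys_sum]) (use k in auto)
    then show ?thesis
      by (auto simp: x chtpy_def cdeg_def)
  qed
  show "frag_extend cbdry (chtpy x) + frag_extend chtpy (cbdry x) = frag_of x - (if cdeg x = 0 then frag_of (0, 0) else 0)"
  proof (cases "even i")
    case True
    then show ?thesis
      using k' by (cases "i = 0")
       (auto simp: x cbdry_even cbdry_odd chtpy_simps cdeg_def frag_extend_diff frag_extend_add, simp_all add: cbdry_def)
  next
    case False
    then have "i \<noteq> 0" by (cases i) auto
    with False show ?thesis
      using k' by (auto simp: x cbdry_even cbdry_odd chtpy_simps cdeg_def frag_extend_diff frag_extend_add)
  qed
qed (auto simp: cdeg_def)

lemma chain_op_crot: "chain_op ccells cdeg cbdry crot"
  unfolding chain_op_def
proof (intro ballI conjI impI)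
  fix x :: "nat \<times> nat" assume "x \<in> ccells"
  then obtain k i where x: "x = (k, i)" and k: "k < 4" by auto
  show "Poly_Mapping.keys (crot x) \<subseteq> {y \<in> ccells. cdeg y = cdeg x}"
    by (simp add: x crot_def cdeg_def)
  have k': "k = 0 \<or> k = Suc 0 \<or> k = 2 \<or> k = 3" using k by auto
  show "frag_extend cbdry (crot x) = frag_extend crot (cbdry x)"
  proof (cases "even i")
    case True
    then show ?thesis
      using k' by (cases "i = 0") (auto simp: x cbdry_even crot_simps frag_extend_add, simp_all add: cbdry_def)
  next
    case False
    then show ?thesis
      using k' by (auto simp: x cbdry_odd crot_simps frag_extend_diff)
  qed
  show "augm (crot x) = frag_of ()" by (simp add: x crot_def augm_def)
qed

lemma chain_op_frag_of: "chain_op S dg d frag_of"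
  by (auto simp: chain_op_def augm_def simp flip: frag_expansion)

section \<open>The cubical resolution\<close>

lemma contracted_homotopy:
  assumes C: "contracted S dg d h b" and c: "Poly_Mapping.keys c \<subseteq> {x\<in>S. dg x = n}"
  shows "frag_extend d (frag_extend h c) + frag_extend h (frag_extend d c) =
    c - (if n = 0 then frag_extend (\<lambda>_. frag_of b) c else 0)"
  using c
proof (induction c rule: frag_induction)
  case (one x)
  then show ?case using C by (auto simp: contracted_def)
next
  case (diff u v)
  have "frag_extend d (frag_extend h (u - v)) + frag_extend h (frag_extend d (u - v)) =
     (frag_extend d (frag_extend h u) + frag_extend h (frag_extend d u)) - (frag_extend d (frag_extend h v) + frag_extend h (frag_extend d v))"
    by (simp add: frag_extend_diff algebra_simps)
  then show ?case
    unfolding diff by (cases "n = 0") (simp_all add: frag_extend_diff)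
qed simp

section \<open>Rotating cubes back: the inverse rotation and its accumulated signs\<close>

definition kun :: "kcell \<Rightarrow> kcell" where "kun c = snd (kunrot c)"

text \<open>The sign collected while c is rotated back k times. A cell ((k, i), c) of the tensor
  product is brought to the sheet k = 0 in this way.\<close>

fun ksgn :: "nat \<Rightarrow> kcell \<Rightarrow> int" where
  "ksgn 0 c = 1"
| "ksgn (Suc k) c = fst (kunrot c) * ksgn k (kun c)"

text \<open>The inverse of the action of \<^const>\<open>tau\<close> on \<open>M\<close>.\<close>

definition untwist :: "lattice \<Rightarrow> lattice"
  where "untwist = (\<lambda>((a, b), (c, d), (e, f)). ((- a, - b), (d, - c), (f, - e)))"

definition lpair :: "pcell \<Rightarrow> int \<times> int" where "lpair = (\<lambda>((z, b), (w, c)). (z, w))"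
definition bpair :: "pcell \<Rightarrow> bool \<times> bool" where "bpair = (\<lambda>((z, b), (w, c)). (b, c))"
definition psquare :: "bool \<times> bool \<Rightarrow> pcell" where "psquare = (\<lambda>(b, c). ((0, b), (0, c)))"

definition kpos :: "kcell \<Rightarrow> lattice" where "kpos = (\<lambda>(x, y, z). (lpair x, lpair y, lpair z))"
definition kbits :: "kcell \<Rightarrow> bits" where "kbits = (\<lambda>(x, y, z). (bpair x, bpair y, bpair z))"
definition cube :: "bits \<Rightarrow> kcell" where "cube = (\<lambda>(x, y, z). (psquare x, psquare y, psquare z))"

text \<open>A quarter turn exchanges the two axes of a plane, the point reflection keeps them.
  Sending I to \<open>bsgn I\<close> times \<open>bswap I\<close> is the inverse of the generator on
  the exterior powers of M.\<close>

definition bswap :: "bits \<Rightarrow> bits"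
  where "bswap = (\<lambda>(p, (c, d), (e, f)). (p, (d, c), (f, e)))"

definition bsgn :: "bits \<Rightarrow> int"
  where "bsgn = (\<lambda>((a, b), (c, d), (e, f)). (if a \<noteq> b then -1 else 1) *
     ((if c \<and> \<not> d then -1 else 1) * (if e \<and> \<not> f then -1 else 1)))"

definition bdeg :: "bits \<Rightarrow> nat"
  where "bdeg = (\<lambda>((a, b), (c, d), (e, f)). (of_bool a + of_bool b) + ((of_bool c + of_bool d) + (of_bool e + of_bool f)))"

lemma bdeg_bswap: "bdeg (bswap I) = bdeg I"
proof -
  obtain a b c d e f where "I = ((a, b), (c, d), (e, f))" by (metis prod.collapse)
  then show ?thesis by (simp add: bdeg_def bswap_def)
qed

text \<open>The last two equations say that three inverse turns make one turn, sign included; they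
  close up the cycle of length four.\<close>

lemma plane_maps:
  "snd (unturn (snd (turn p))) = p" "snd (turn (snd (unturn p))) = p" "snd (refl (snd (refl p))) = p"
  "fst (unturn (snd (turn p))) = fst (turn p)" "fst (turn (snd (unturn p))) = fst (unturn p)" "fst (refl (snd (refl p))) = fst (refl p)"
  "fst (turn p) * fst (turn p) = 1" "fst (refl p) * fst (refl p) = 1" "fst (unturn p) * fst (unturn p) = 1"
  "snd (unturn (snd (unturn (snd (unturn p))))) = snd (turn p)"
  "fst (unturn p) * (fst (unturn (snd (unturn p))) * fst (unturn (snd (unturn (snd (unturn p)))))) = fst (turn p)"
  by (auto simp: turn_def unturn_def refl_def split: prod.splits)

lemma plane_shift:
  "unturn (pshift (m, n) p) = (fst (unturn p), pshift (n, - m) (snd (unturn p)))"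
  "refl (pshift (m, n) p) = (fst (refl p), pshift (- m, - n) (snd (refl p)))"
  "lpair (pshift a p) = lpair p + a" "bpair (pshift a p) = bpair p"
  "pshift (lpair p) (psquare (bpair p)) = p"
  "bpair (snd (unturn p)) = (snd (bpair p), fst (bpair p))" "bpair (snd (refl p)) = bpair p"
  "fst (unturn p) = (if fst (bpair p) \<and> \<not> snd (bpair p) then -1 else 1)"
  "fst (refl p) = (if fst (bpair p) \<noteq> snd (bpair p) then -1 else 1)"
  "pshift a (pshift b p) = pshift (a + b) p" "pshift 0 p = p"
  "bpair (psquare x) = x" "lpair (psquare x) = 0"
  "pdeg p = of_bool (fst (bpair p)) + of_bool (snd (bpair p))"
  by (auto simp: turn_def unturn_def refl_def pshift_def lpair_def bpair_def psquare_def zero_prod_def pdeg_simp split: prod.splits)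

lemma krot_kun:
  "kun (snd (krot c)) = c" "snd (krot (kun c)) = c"
  "fst (kunrot (snd (krot c))) = fst (krot c)" "fst (krot (kun c)) = fst (kunrot c)"
  "fst (krot c) * fst (krot c) = 1" "fst (kunrot c) * fst (kunrot c) = 1"
  "kun (kun (kun c)) = snd (krot c)"
  "fst (kunrot c) * (fst (kunrot (kun c)) * fst (kunrot (kun (kun c)))) = fst (krot c)"
proof -
  obtain x y z where c: "c = (x, y, z)" by (cases c)
  have sq: "a * a = 1 \<Longrightarrow> b * b = 1 \<Longrightarrow> (a * b) * (a * b) = (1::int)" for a b
    by (simp add: mult.assoc mult.left_commute)
  show "kun (snd (krot c)) = c" "snd (krot (kun c)) = c"
    "fst (kunrot (snd (krot c))) = fst (krot c)" "fst (krot (kun c)) = fst (kunrot c)"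
    "kun (kun (kun c)) = snd (krot c)"
    by (simp_all add: c kun_def kunrot_def krot_def spair_def plane_maps)
  show "fst (krot c) * fst (krot c) = 1" "fst (kunrot c) * fst (kunrot c) = 1"
    by (simp_all only: c kun_def kunrot_def krot_def spair_def plane_maps split fst_conv snd_conv sq)
  \<comment> \<open>In the first plane the reflection is its own inverse, so three of its signs
    leave one; in the other two planes the cube of \<open>unturn\<close> is
    \<open>turn\<close>.\<close>
  have "fst (kunrot c) * (fst (kunrot (kun c)) * fst (kunrot (kun (kun c)))) =
    (fst (refl x) * fst (refl x)) * fst (refl x) *
    ((fst (unturn y) * (fst (unturn (snd (unturn y))) * fst (unturn (snd (unturn (snd (unturn y))))))) *
     (fst (unturn z) * (fst (unturn (snd (unturn z))) * fst (unturn (snd (unturn (snd (unturn z))))))))"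
    by (simp add: c kun_def kunrot_def spair_def plane_maps(3,6) mult.assoc mult.left_commute mult.commute)
  also have "\<dots> = fst (krot c)"
    unfolding plane_maps by (simp add: c krot_def spair_def)
  finally show "fst (kunrot c) * (fst (kunrot (kun c)) * fst (kunrot (kun (kun c)))) = fst (krot c)" .
qed

lemma kshift_simps:
  "kun (kshift m c) = kshift (untwist m) (kun c)" "fst (kunrot (kshift m c)) = fst (kunrot c)"
  "kpos (kshift m c) = kpos c + m" "kbits (kshift m c) = kbits c"
  "kshift (kpos c) (cube (kbits c)) = c"
  "kbits (kun c) = bswap (kbits c)" "fst (kunrot c) = bsgn (kbits c)"
  "kshift m (kshift m' c) = kshift (m + m') c" "kshift 0 c = c"
  "kbits (cube I) = I" "kpos (cube I) = 0" "kdeg c = bdeg (kbits c)"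
proof -
  obtain x y z where c: "c = (x, y, z)" by (cases c)
  obtain m1 m2 m3 m4 m5 m6 where m: "m = ((m1, m2), (m3, m4), (m5, m6))" by (metis prod.collapse)
  obtain m1' m2' m3' where m': "m' = (m1', m2', m3')" by (metis prod.collapse)
  obtain i1 i2 i3 where I: "I = (i1, i2, i3)" by (metis prod.collapse)
  show "kun (kshift m c) = kshift (untwist m) (kun c)" "fst (kunrot (kshift m c)) = fst (kunrot c)"
    "kpos (kshift m c) = kpos c + m" "kbits (kshift m c) = kbits c"
    by (simp_all add: c m kun_def kshift_def kunrot_def spair_def untwist_def plane_shift kpos_def kbits_def)
  show "kshift (kpos c) (cube (kbits c)) = c"
    by (simp add: c kshift_def kpos_def cube_def kbits_def plane_shift)
  show "kbits (kun c) = bswap (kbits c)"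
    by (simp add: c kun_def kunrot_def spair_def kbits_def bswap_def plane_shift split: prod.splits)
  show "fst (kunrot c) = bsgn (kbits c)"
    by (simp add: c kun_def kunrot_def spair_def kbits_def bsgn_def plane_shift split: prod.splits)
  show "kshift m (kshift m' c) = kshift (m + m') c"
    by (simp add: c m m' kshift_def plane_shift split: prod.splits)
  show "kshift 0 c = c" by (simp add: c kshift_def zero_prod_def plane_shift(11)[unfolded zero_prod_def])
  show "kbits (cube I) = I" "kpos (cube I) = 0"
    by (simp_all add: I kbits_def kpos_def cube_def plane_shift zero_prod_def)
  show "kdeg c = bdeg (kbits c)"
    by (simp only: c kdeg_def tensor_deg_def plane_shift(14) kbits_def bdeg_def split_beta split fst_conv snd_conv)
qed

lemma kun_funpow_krot: "k \<noteq> 0 \<Longrightarrow> (kun ^^ k) (snd (krot c)) = (kun ^^ (k - 1)) c"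
  by (cases k) (simp_all add: krot_kun funpow_Suc_right del: funpow.simps(2))

lemma ksgn_krot: "ksgn (Suc k) (snd (krot c)) = fst (krot c) * ksgn k c"
  by (simp add: krot_kun)

lemma ksgn_kshift: "ksgn k (kshift m c) = ksgn k c"
  by (induction k arbitrary: m c) (simp_all add: kshift_simps(1,2))

lemma kun_funpow_kshift: "(kun ^^ k) (kshift m c) = kshift ((untwist ^^ k) m) ((kun ^^ k) c)"
  by (induction k) (simp_all add: kshift_simps)

type_synonym fcell = "(nat \<times> nat) \<times> kcell"

definition frot :: "fcell \<Rightarrow> int \<times> fcell"
  where "frot = (\<lambda>((k, i), c). (fst (krot c), (((k + 1) mod 4, i), snd (krot c))))"

definition fdeg :: "fcell \<Rightarrow> nat" where "fdeg = tensor_deg cdeg kdeg"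
definition fbdry :: "fcell \<Rightarrow> fcell \<Rightarrow>\<^sub>0 int" where "fbdry = tensor_bdry cdeg cbdry kbdry"

text \<open>The group acts diagonally on the tensor product. The number k tells how often a cell
  must be rotated back to reach the sheet k = 0; there a translation removes its position, and the
  cyclic degree and the bits remain as the name of the orbit.\<close>

definition cub :: "(fcell, lattice, nat \<times> bits) gcomplex"
  where "cub = \<lparr>cells = \<lambda>n. {c \<in> ccells \<times> UNIV. fdeg c = n},
    bdry = \<lambda>_. fbdry,
    rot = \<lambda>_. signed frot,
    transl = \<lambda>_ m (p, c). frag_of (p, kshift m c),
    orbs = \<lambda>n. {(i, I). i + bdeg I = n},
    lift = \<lambda>_ (i, I). ((0, i), cube I),
    orb = \<lambda>_ ((k, i), c). (i, kbits ((kun ^^ k) c)),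
    rexp = \<lambda>_ ((k, i), c). k,
    shft = \<lambda>_ ((k, i), c). kpos ((kun ^^ k) c),
    csgn = \<lambda>_ ((k, i), c). ksgn k c\<rparr>"

lemma frot_tensor: "signed frot = tensor_op crot (signed krot)"
  by (auto simp: fun_eq_iff signed_def frot_def tensor_op_def crot_def fprod_simps)

lemma ftransl_tensor: "(\<lambda>(p, c). frag_of (p, kshift m c)) = tensor_op frag_of (\<lambda>c. frag_of (kshift m c))"
  by (auto simp: fun_eq_iff tensor_op_def)

lemma chain_op_frot: "chain_op (ccells \<times> UNIV) fdeg fbdry (signed frot)"
  unfolding frot_tensor fdeg_def fbdry_def by (rule chain_op_tensor[OF chain_op_crot chain_op_krot])

lemma chain_op_ftransl: "chain_op (ccells \<times> UNIV) fdeg fbdry (\<lambda>(p, c). frag_of (p, kshift m c))"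
  unfolding ftransl_tensor fdeg_def fbdry_def by (rule chain_op_tensor[OF chain_op_frag_of chain_op_kshift])

lemma funpow_4: "(f ^^ 4) x = f (f (f (f x)))"
  by (simp add: numeral_eq_Suc)

text \<open>Supplies \<open>cell_word\<close> for the cubical complex: rotating forward again
  reproduces the sign that was collected while rotating back.\<close>

lemma frot_funpow:
  "j < 4 \<Longrightarrow> (frag_extend (signed frot) ^^ j) (frag_of ((0, i), (kun ^^ j) c)) = frag_cmul (ksgn j c) (frag_of ((j, i), c))"
proof (induction j arbitrary: c)
  case (Suc j)
  have "(frag_extend (signed frot) ^^ Suc j) (frag_of ((0, i), (kun ^^ Suc j) c)) =
     frag_extend (signed frot) (frag_cmul (ksgn j (kun c)) (frag_of ((j, i), kun c)))"
    using Suc by (simp add: funpow_swap1)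
  also have "\<dots> = frag_cmul (ksgn (Suc j) c) (frag_of ((Suc j, i), c))"
    using Suc.prems by (simp add: frag_extend_cmul signed_def frot_def krot_kun mult.commute)
  finally show ?case .
qed simp

lemma resolution_cub: "resolution cub untwist"
proof -
  obtain h0 b0 where K: "contracted UNIV kdeg kbdry h0 b0" using contracted_cubes by blast
  define h b where "h = tensor_htpy cdeg chtpy (0, 0) h0" and "b = ((0::nat, 0::nat), b0)"
  have F: "contracted (ccells \<times> UNIV) fdeg fbdry h b"
    using contracted_tensor[OF contracted_cyclic K] by (simp add: fdeg_def fbdry_def h_def b_def)
  have hc: "frag_extend h c \<in> chains cub (Suc n)" if "c \<in> chains cub n" for c n
  proof (rule chains_extend[OF that])
    fix s assume s: "s \<in> cells cub n"
    then have "s \<in> ccells \<times> UNIV" and n: "fdeg s = n" by (simp_all add: cub_def)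
    then have "Poly_Mapping.keys (h s) \<subseteq> {y \<in> ccells \<times> UNIV. fdeg y = Suc (fdeg s)}"
      using F unfolding contracted_def by blast
    then show "h s \<in> chains cub (Suc n)"
      unfolding chains_def cub_def n by simp
  qed
  have keys: "Poly_Mapping.keys c \<subseteq> {x \<in> ccells \<times> UNIV. fdeg x = n}" if "c \<in> chains cub n" for c n
    using that by (auto simp: chains_def cub_def)
  note hom = contracted_homotopy[OF F keys]
  have rel4: "(frag_extend (signed frot) ^^ 4) (frag_of s) = frag_of s" if "s \<in> ccells \<times> UNIV" for s
  proof -
    obtain k i c where s: "s = ((k, i), c)" by (metis prod.collapse)
    \<comment> \<open>Writing c as \<open>kun\<close> applied four times lets each rotation cancel
      one \<open>kun\<close>; what remains is a product of four signs.\<close>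
    define u where "u = kun (kun (kun (kun c)))"
    have u: "u = c" by (simp add: u_def krot_kun)
    have kk: "((((k + 1) mod 4 + 1) mod 4 + 1) mod 4 + 1) mod 4 = k" using that s by (simp add: mod_simps)
    have e: "frag_extend (signed frot) (frag_of ((j, i), d)) = frag_cmul (fst (krot d)) (frag_of (((j + 1) mod 4, i), snd (krot d)))" for j d
      by (simp add: signed_def frot_def)
    have e': "frag_extend (signed frot) (frag_of ((j, i), kun d)) = frag_cmul (fst (kunrot d)) (frag_of (((j + 1) mod 4, i), d))" for j d
      unfolding e by (simp only: krot_kun)
    have "(frag_extend (signed frot) ^^ 4) (frag_of ((k, i), u)) =
       frag_cmul (fst (kunrot (kun (kun (kun c)))) * (fst (kunrot (kun (kun c))) * (fst (kunrot (kun c)) * fst (kunrot c)))) (frag_of ((k, i), c))"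
      unfolding u_def by (simp only: funpow_4 e' frag_extend_cmul frag_cmul_cmul kk mult.assoc)
    also have "fst (kunrot (kun (kun (kun c)))) * (fst (kunrot (kun (kun c))) * (fst (kunrot (kun c)) * fst (kunrot c))) = 1"
    proof -
      have "fst (kunrot (kun (kun c))) * (fst (kunrot (kun c)) * fst (kunrot c)) = fst (krot c)"
        using krot_kun(8)[of c] by (simp only: ac_simps)
      moreover have "fst (kunrot (kun (kun (kun c)))) = fst (krot c)"
        by (simp only: krot_kun)
      ultimately show ?thesis by (simp only: krot_kun)
    qed
    finally show ?thesis by (simp add: s u)
  qed
  have cc: "s \<in> ccells \<times> UNIV" "fdeg s = n" if "s \<in> cells cub n" for s n
    using that by (simp_all add: cub_def)
  have rot_c: "frag_extend fbdry (signed frot s) = frag_extend (signed frot) (fbdry s)"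
     "fdeg s = 0 \<Longrightarrow> augm (signed frot s) = frag_of ()" if "s \<in> ccells \<times> UNIV" for s
    using chain_op_frot that unfolding chain_op_def by blast+
  have tr_c: "frag_extend fbdry ((\<lambda>(p, c). frag_of (p, kshift m c)) s) = frag_extend (\<lambda>(p, c). frag_of (p, kshift m c)) (fbdry s)"
     "fdeg s = 0 \<Longrightarrow> augm ((\<lambda>(p, c). frag_of (p, kshift m c)) s) = frag_of ()" if "s \<in> ccells \<times> UNIV" for s m
    using chain_op_ftransl[of m] that unfolding chain_op_def by blast+
  have F_c: "frag_extend fbdry (fbdry s) = 0" "fdeg s = 1 \<Longrightarrow> augm (fbdry s) = 0" if "s \<in> ccells \<times> UNIV" for s
    using F that unfolding contracted_def by blast+
  have cub_sel: "bdry cub n = fbdry" "rot cub n = signed frot" "transl cub n m = (\<lambda>(p, c). frag_of (p, kshift m c))" for n m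
    by (simp_all add: cub_def)
  show ?thesis
  proof
    fix s n assume s: "s \<in> cells cub (Suc n)"
    show "bdry cub (Suc n) s \<in> chains cub n"
    proof -
      have "s \<in> ccells \<times> UNIV" and n: "fdeg s = Suc n" using s by (simp_all add: cub_def)
      then have "Poly_Mapping.keys (fbdry s) \<subseteq> {y \<in> ccells \<times> UNIV. Suc (fdeg y) = fdeg s}"
        using F unfolding contracted_def by blast
      then show ?thesis
        unfolding chains_def cub_def n by simp
    qed
    show "frag_extend (bdry cub (Suc n)) (rot cub (Suc n) s) = frag_extend (rot cub n) (bdry cub (Suc n) s)"
      unfolding cub_sel by (rule rot_c(1)[OF cc(1)[OF s]])
    fix m
    show "frag_extend (bdry cub (Suc n)) (transl cub (Suc n) m s) = frag_extend (transl cub n m) (bdry cub (Suc n) s)"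
      unfolding cub_sel by (rule tr_c(1)[OF cc(1)[OF s]])
  next
    fix s n assume "s \<in> cells cub (Suc (Suc n))"
    then show "frag_extend (bdry cub (Suc n)) (bdry cub (Suc (Suc n)) s) = 0"
      unfolding cub_sel by (intro F_c cc)
  next
    fix s assume s: "s \<in> cells cub 1"
    then show "augm (bdry cub 1 s) = 0"
      unfolding cub_sel by (intro F_c cc)
  next
    fix c n assume c: "c \<in> chains cub (Suc n)" "frag_extend (bdry cub (Suc n)) c = 0"
    then have "frag_extend fbdry c = 0" by (simp add: cub_def)
    then have "frag_extend fbdry (frag_extend h c) = c" using hom[OF c(1)] by simp
    then show "\<exists>y\<in>chains cub (Suc (Suc n)). frag_extend (bdry cub (Suc (Suc n))) y = c"
      using hc[OF c(1)] by (auto simp: cub_def)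
  next
    fix c assume c: "c \<in> chains cub 0" "augm c = 0"
    have "frag_extend fbdry c = 0"
    proof (rule frag_extend_eq_0)
      fix x assume "x \<in> Poly_Mapping.keys c"
      then have x: "x \<in> ccells \<times> UNIV" "fdeg x = 0" using keys[OF c(1)] by auto
      have "Poly_Mapping.keys (fbdry x) \<subseteq> {y \<in> ccells \<times> UNIV. Suc (fdeg y) = fdeg x}"
        using F x(1) unfolding contracted_def by blast
      with x have "Poly_Mapping.keys (fbdry x) = {}" by simp
      then show "fbdry x = 0" by simp
    qed
    moreover have "frag_extend (\<lambda>_. frag_of b) c = 0" by (subst extend_const) (simp add: c)
    ultimately have "frag_extend fbdry (frag_extend h c) = c" using hom[OF c(1)] by simp
    then show "\<exists>y\<in>chains cub 1. frag_extend (bdry cub 1) y = c"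
      using hc[OF c(1)] by (auto simp: cub_def)
  next
    have "b \<in> ccells \<times> UNIV" "fdeg b = 0" using F unfolding contracted_def by blast+
    then have "b \<in> cells cub 0" by (simp add: cub_def)
    then show "cells cub 0 \<noteq> {}" by blast
  next
    fix s assume s: "s \<in> cells cub 0"
    show "augm (rot cub 0 s) = frag_of ()" unfolding cub_sel by (rule rot_c(2)[OF cc[OF s]])
    fix m show "augm (transl cub 0 m s) = frag_of ()" unfolding cub_sel by (rule tr_c(2)[OF cc[OF s]])
  next
    fix t n assume t: "t \<in> orbs cub n"
    then show "lift cub n t \<in> cells cub n"
      by (auto simp: cub_def fdeg_def tensor_deg_def cdeg_def kshift_simps)
    show "orb cub n (lift cub n t) = t" "rexp cub n (lift cub n t) = 0" "shft cub n (lift cub n t) = 0"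
      "csgn cub n (lift cub n t) = 1"
      by (cases t, simp add: cub_def kshift_simps)+
  next
    fix s n assume s: "s \<in> cells cub n"
    obtain k i c where s': "s = ((k, i), c)" by (metis prod.collapse)
    have k: "k < 4" using s by (simp add: s' cub_def)
    have bd: "bdeg (kbits ((kun ^^ j) c)) = bdeg (kbits c)" for j
      by (induction j) (simp_all add: kshift_simps(6) bdeg_bswap)
    show "orb cub n s \<in> orbs cub n"
      using s by (simp add: s' cub_def fdeg_def tensor_deg_def cdeg_def bd kshift_simps(12))
    show "rexp cub n s < 4" using k by (simp add: s' cub_def)
    show "(frag_extend (rot cub n) ^^ 4) (frag_of s) = frag_of s"
      using rel4 s by (simp add: cub_def)
    show "transl cub n 0 s = frag_of s" by (simp add: cub_def s' kshift_simps)
    show "frag_extend (transl cub n m) (transl cub n m' s) = transl cub n (m + m') s" for m m'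
      by (simp add: cub_def s' kshift_simps)
    show "frag_extend (transl cub n m) (rot cub n s) = frag_extend (rot cub n) (transl cub n (untwist m) s)" for m
    proof -
      have 1: "snd (krot (kshift (untwist m) c)) = kshift m (snd (krot c))"
      proof -
        have "kun (kshift m (snd (krot c))) = kshift (untwist m) c" by (simp add: kshift_simps krot_kun)
        then show ?thesis by (metis krot_kun(2))
      qed
      have 2: "fst (krot (kshift (untwist m) c)) = fst (krot c)"
        by (metis 1 krot_kun(3) kshift_simps(2))
      show ?thesis by (simp add: cub_def s' signed_def frot_def frag_extend_cmul 1 2)
    qed
    have sgn1: "ksgn j d * ksgn j d = 1" for j d
    proof (induction j arbitrary: d)
      case (Suc j)
      have "ksgn (Suc j) d * ksgn (Suc j) d = (fst (kunrot d) * fst (kunrot d)) * (ksgn j (kun d) * ksgn j (kun d))"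
        by (simp add: ac_simps)
      then show ?case by (simp only: Suc krot_kun)
    qed simp
    show "frag_of s = frag_cmul (csgn cub n s)
            (act_word cub n (rexp cub n s) (shft cub n s) (frag_of (lift cub n (orb cub n s))))"
      using frot_funpow[OF k, of i c] by (simp add: cub_def s' kshift_simps sgn1)
    show "\<exists>e s'. e * e = 1 \<and> s' \<in> cells cub n \<and>
          rot cub n s = frag_cmul e (frag_of s') \<and> orb cub n s' = orb cub n s \<and>
          rexp cub n s' = (rexp cub n s + 1) mod 4 \<and> shft cub n s' = shft cub n s \<and>
          csgn cub n s' = e * csgn cub n s"
    proof (intro exI conjI)
      show "fst (krot c) * fst (krot c) = 1" by (rule krot_kun)
      have deg: "kdeg (snd (krot c)) = kdeg c"
        unfolding kshift_simps using bd[of 3] by (simp add: numeral_eq_Suc krot_kun)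
      show "(((k + 1) mod 4, i), snd (krot c)) \<in> cells cub n"
        using s by (simp add: cub_def s' fdeg_def tensor_deg_def cdeg_def deg)
      show "rot cub n s = frag_cmul (fst (krot c)) (frag_of (((k + 1) mod 4, i), snd (krot c)))"
        by (simp add: cub_def s' signed_def frot_def)
      have 1: "(kun ^^ ((k + 1) mod 4)) (snd (krot c)) = (kun ^^ k) c"
      proof (cases "k = 3")
        case True then show ?thesis by (simp add: numeral_eq_Suc krot_kun)
      next
        case False
        then have "(k + 1) mod 4 = Suc k" using k by simp
        then show ?thesis by (simp only: kun_funpow_krot[of "Suc k" c]) simp
      qed
      \<comment> \<open>For k = 3 the new exponent is 0, with sign 1. The three signs of the inverse
        rotations multiply to the sign of \<open>krot c\<close>, whose square is 1.\<close>
      have 2: "ksgn ((k + 1) mod 4) (snd (krot c)) = fst (krot c) * ksgn k c"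
      proof (cases "k = 3")
        case True
        then have "ksgn k c = fst (krot c)" using krot_kun(8)[of c] by (simp add: numeral_eq_Suc)
        then show ?thesis using True by (simp add: krot_kun)
      next
        case False
        then have "(k + 1) mod 4 = Suc k" using k by simp
        then show ?thesis by (simp only: ksgn_krot)
      qed
      show "orb cub n (((k + 1) mod 4, i), snd (krot c)) = orb cub n s"
        "shft cub n (((k + 1) mod 4, i), snd (krot c)) = shft cub n s"
        "rexp cub n (((k + 1) mod 4, i), snd (krot c)) = (rexp cub n s + 1) mod 4"
        "csgn cub n (((k + 1) mod 4, i), snd (krot c)) = fst (krot c) * csgn cub n s"
        using 1 2 by (simp_all add: cub_def s')
    qed
    show "\<exists>s'. s' \<in> cells cub n \<and>
          transl cub n m s = frag_of s' \<and> orb cub n s' = orb cub n s \<and>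
          rexp cub n s' = rexp cub n s \<and> shft cub n s' = shft cub n s + (untwist ^^ rexp cub n s) m \<and>
          csgn cub n s' = csgn cub n s" for m
      by (rule exI[of _ "((k, i), kshift m c)"])
         (use s in \<open>simp add: cub_def s' fdeg_def tensor_deg_def cdeg_def kun_funpow_kshift ksgn_kshift kshift_simps\<close>)
  qed
qed

subsection \<open>Its complex of orbits\<close>

lemma tensor_bdry_killed:
  assumes "frag_extend f (d x) = 0" "frag_extend g (d' y) = 0"
  shows "frag_extend (tensor_op f g) (tensor_bdry dg d d' (x, y)) = 0"
  by (simp add: tensor_bdry_def frag_extend_add frag_extend_cmul tensor_op_fprod assms)

text \<open>Opposite faces of a cube have the same bits and opposite signs.\<close>

lemma kbits_kbdry: "frag_extend (\<lambda>c. frag_of (kbits c)) (kbdry c) = 0"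
proof -
  have l: "frag_extend (\<lambda>c. frag_of (snd c)) (lbdry c) = 0" for c
    by (simp add: lbdry_def frag_extend_diff split: prod.splits)
  have p: "frag_extend (\<lambda>c. frag_of (bpair c)) (pbdry c) = 0" for c
  proof -
    have "(\<lambda>c. frag_of (bpair c)) = tensor_op (\<lambda>c. frag_of (snd c)) (\<lambda>c. frag_of (snd c))"
      by (auto simp: fun_eq_iff tensor_op_def bpair_def)
    then show ?thesis unfolding pbdry_def by (cases c) (simp only: tensor_bdry_killed l)
  qed
  have "(\<lambda>c. frag_of (kbits c)) = tensor_op (\<lambda>c. frag_of (bpair c)) (tensor_op (\<lambda>c. frag_of (bpair c)) (\<lambda>c. frag_of (bpair c)))"
    by (auto simp: fun_eq_iff tensor_op_def kbits_def)
  then show ?thesis unfolding kbdry_def by (cases c) (simp only: tensor_bdry_killed p)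
qed

lemma bswap_bswap [simp]: "bswap (bswap I) = I"
  by (auto simp: bswap_def split: prod.splits)

text \<open>The boundary of the cube dies, so the cyclic boundary remains, the sheet k contributing
  k signed swaps. As the swap has order two, two of them amount to the scalar
  \<open>bsgn I * bsgn (bswap I)\<close>, which is 1 or -1.\<close>

lemma orbit_bdry_cub:
  "orbit_bdry cub n (0, I) = 0"
  "odd i \<Longrightarrow> orbit_bdry cub n (i, I) = frag_cmul (bsgn I) (frag_of (i - 1, bswap I)) - frag_of (i - 1, I)"
  "even i \<Longrightarrow> i \<noteq> 0 \<Longrightarrow> orbit_bdry cub n (i, I) =
     frag_of (i - 1, I) + frag_cmul (bsgn I) (frag_of (i - 1, bswap I)) +
     frag_cmul (bsgn I * bsgn (bswap I)) (frag_of (i - 1, I)) +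
     frag_cmul (bsgn I * bsgn (bswap I) * bsgn I) (frag_of (i - 1, bswap I))"
proof -
  have proj: "proj cub j ((k, l), c) = frag_cmul (ksgn k c) (frag_of (l, kbits ((kun ^^ k) c)))" for j k l c
    by (simp add: proj_def cub_def)
  \<comment> \<open>All faces of the cube stay in the sheet k = 0, where no rotation intervenes and
    \<open>proj\<close> reads off the bits.\<close>
  have ker: "frag_extend (proj cub j) (fprod (frag_of (0, l)) (kbdry c)) = 0" for j l c
  proof -
    have "frag_extend (proj cub j) (fprod (frag_of (0, l)) x) = fprod (frag_extend (\<lambda>p. frag_of (snd p)) (frag_of (0::nat, l))) (frag_extend (\<lambda>c. frag_of (kbits c)) x)" for x
      by (rule fprod_eqI[of _ "{(0, l)}" _ UNIV, where g = "\<lambda>a b. fprod (frag_extend (\<lambda>p :: nat \<times> nat. frag_of (snd p)) a) (frag_extend (\<lambda>c. frag_of (kbits c)) b)"])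
         (simp_all add: proj frag_extend_diff fprod_simps)
    then show ?thesis by (simp only: kbits_kbdry fprod_0)
  qed
  have ob: "orbit_bdry cub n (i, I) = frag_extend (proj cub (n - 1)) (fprod (cbdry (0, i)) (frag_of (cube I)))" for i I
  proof -
    have "bdry cub n = fbdry" "lift cub n (i, I) = ((0, i), cube I)"
      by (simp_all add: cub_def)
    then show ?thesis
      unfolding orbit_bdry_def descend_def
      by (simp add: fbdry_def tensor_bdry_def frag_extend_add frag_extend_cmul ker)
  qed
  have sg: "ksgn (Suc 0) (cube I) = bsgn I" "ksgn 2 (cube I) = bsgn I * bsgn (bswap I)"
     "ksgn 3 (cube I) = bsgn I * bsgn (bswap I) * bsgn I" for I
    by (simp_all add: numeral_eq_Suc kshift_simps)
  have kb: "kbits (kun (cube I)) = bswap I" "kbits ((kun ^^ 2) (cube I)) = I" "kbits ((kun ^^ 3) (cube I)) = bswap I" for I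
    by (simp_all add: numeral_eq_Suc kshift_simps)
  show "orbit_bdry cub n (0, I) = 0"
    unfolding ob by (simp add: cbdry_def)
  show "orbit_bdry cub n (i, I) = frag_cmul (bsgn I) (frag_of (i - 1, bswap I)) - frag_of (i - 1, I)" if "odd i"
    unfolding ob using that by (simp add: cbdry_odd fprod_simps frag_extend_diff proj sg[simplified] kb kshift_simps(10) del: ksgn.simps(2))
       (simp add: kshift_simps)
  show "orbit_bdry cub n (i, I) =
     frag_of (i - 1, I) + frag_cmul (bsgn I) (frag_of (i - 1, bswap I)) +
     frag_cmul (bsgn I * bsgn (bswap I)) (frag_of (i - 1, I)) +
     frag_cmul (bsgn I * bsgn (bswap I) * bsgn I) (frag_of (i - 1, bswap I))" if "even i" "i \<noteq> 0"
    unfolding ob using that by (simp add: cbdry_even fprod_simps frag_extend_add proj sg kb kshift_simps(10) del: ksgn.simps(2))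
qed

section \<open>Lifting singular simplices through a free quotient\<close>

text \<open>G merely indexes maps; the group structure enters through \<open>orbits\<close>. The
  group can thus be given by normal forms (k, m) without writing down its multiplication. The
  condition \<open>even\<close> is even covering: no translate of U other than U itself meets
  U.\<close>

locale free_quotient =
  fixes X :: "'x topology" and B :: "'b topology" and p :: "'x \<Rightarrow> 'b"
    and G :: "'g set" and act :: "'g \<Rightarrow> 'x \<Rightarrow> 'x" and e :: 'g
  assumes quot: "quotient_map X B p"
    and act_cont: "g \<in> G \<Longrightarrow> continuous_map X X (act g)"
    and act_open: "g \<in> G \<Longrightarrow> openin X U \<Longrightarrow> openin X (act g ` U)"
    and orbits: "x \<in> topspace X \<Longrightarrow> y \<in> topspace X \<Longrightarrow> p x = p y \<longleftrightarrow> (\<exists>g\<in>G. y = act g x)"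
    and even: "x \<in> topspace X \<Longrightarrow> \<exists>U. openin X U \<and> x \<in> U \<and> (\<forall>g\<in>G. \<forall>y\<in>U. act g y \<in> U \<longrightarrow> g = e)"
    and e_in: "e \<in> G"
    and act_e: "x \<in> topspace X \<Longrightarrow> act e x = x"
begin

lemma act_in: "g \<in> G \<Longrightarrow> x \<in> topspace X \<Longrightarrow> act g x \<in> topspace X"
  using act_cont by (auto simp: continuous_map_def)

lemma p_act: "g \<in> G \<Longrightarrow> x \<in> topspace X \<Longrightarrow> p (act g x) = p x"
  using orbits[of x "act g x"] act_in by auto

lemma p_cont: "continuous_map X B p"
  by (rule quotient_imp_continuous_map[OF quot])

lemma open_p:
  assumes "openin X U" shows "openin B (p ` U)"
proof -
  have U: "U \<subseteq> topspace X" by (rule openin_subset[OF assms])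
  have "{x \<in> topspace X. p x \<in> p ` U} = (\<Union>g\<in>G. act g ` U)"
    using U orbits act_in p_act by (auto simp: image_iff) (metis orbits subsetD)+
  moreover have "openin X (\<Union>g\<in>G. act g ` U)"
    by (rule openin_Union) (use act_open assms in auto)
  moreover have "p ` U \<subseteq> topspace B"
    using U quot by (auto simp: quotient_map_def)
  moreover have "openin X {x \<in> topspace X. p x \<in> p ` U} = openin B (p ` U)"
    using quot calculation(3) unfolding quotient_map_def by blast
  ultimately show ?thesis by simp
qed

lemma even_inj:
  assumes "openin X U" "\<forall>g\<in>G. \<forall>y\<in>U. act g y \<in> U \<longrightarrow> g = e" "x \<in> U" "y \<in> U" "p x = p y"
  shows "x = y"
proof -
  have "U \<subseteq> topspace X" by (rule openin_subset[OF assms(1)])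
  then obtain g where g: "g \<in> G" "y = act g x" using orbits[of x y] assms(3-5) by auto
  then have "g = e" using assms(2-4) by blast
  then show ?thesis using g assms(3) act_e \<open>U \<subseteq> topspace X\<close> by auto
qed

text \<open>Where the lifts agree they agree nearby, since p is injective on an evenly covered U.
  Where they differ, k is the translate of h by some g other than e, and nearby values of h in U and
  of k in the translate of U cannot coincide. The set of agreement is thus open and closed.\<close>

lemma lifts_unique:
  assumes T: "connected_space T" and h: "continuous_map T X h" and k: "continuous_map T X k"
    and pe: "\<And>t. t \<in> topspace T \<Longrightarrow> p (h t) = p (k t)"
    and t0: "t0 \<in> topspace T" "h t0 = k t0" and t: "t \<in> topspace T"
  shows "h t = k t"
proof -
  let ?E = "{t \<in> topspace T. h t = k t}"
  have in_X: "h s \<in> topspace X" "k s \<in> topspace X" if "s \<in> topspace T" for s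
    using h k that by (auto simp: continuous_map_def)
  have "openin T ?E"
  proof (subst openin_subopen, intro ballI)
    fix s assume s: "s \<in> ?E"
    then obtain U where U: "openin X U" "h s \<in> U" "\<forall>g\<in>G. \<forall>y\<in>U. act g y \<in> U \<longrightarrow> g = e"
      using even[of "h s"] in_X by auto
    have "openin T ({r \<in> topspace T. h r \<in> U} \<inter> {r \<in> topspace T. k r \<in> U})"
      by (intro openin_Int openin_continuous_map_preimage[OF h] openin_continuous_map_preimage[OF k] U)
    moreover have "{r \<in> topspace T. h r \<in> U} \<inter> {r \<in> topspace T. k r \<in> U} \<subseteq> ?E"
      using even_inj[OF U(1,3)] pe by auto
    ultimately show "\<exists>V. openin T V \<and> s \<in> V \<and> V \<subseteq> ?E"
      using s U(2) by (intro exI[of _ "{r \<in> topspace T. h r \<in> U} \<inter> {r \<in> topspace T. k r \<in> U}"]) auto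
  qed
  moreover have "openin T (topspace T - ?E)"
  proof (subst openin_subopen, intro ballI)
    fix s assume s: "s \<in> topspace T - ?E"
    then obtain U where U: "openin X U" "h s \<in> U" "\<forall>g\<in>G. \<forall>y\<in>U. act g y \<in> U \<longrightarrow> g = e"
      using even[of "h s"] in_X by auto
    obtain g where g: "g \<in> G" "k s = act g (h s)"
      using orbits[of "h s" "k s"] in_X pe s by auto
    have ne: "g \<noteq> e" using g s act_e in_X by auto
    let ?V = "{r \<in> topspace T. h r \<in> U} \<inter> {r \<in> topspace T. k r \<in> act g ` U}"
    have "openin T ?V"
      by (intro openin_Int openin_continuous_map_preimage[OF h] openin_continuous_map_preimage[OF k] U act_open g)
    moreover have "?V \<subseteq> topspace T - ?E"
    proof
      fix r assume r: "r \<in> ?V"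
      then obtain u where u: "u \<in> U" "k r = act g u" by auto
      have "h r \<noteq> k r" using U(3) g(1) ne u r by auto
      then show "r \<in> topspace T - ?E" using r by auto
    qed
    ultimately show "\<exists>V. openin T V \<and> s \<in> V \<and> V \<subseteq> topspace T - ?E"
      using s U(2) g by (intro exI[of _ ?V]) auto
  qed
  then have "closedin T ?E" by (simp add: closedin_def)
  ultimately have "?E = {} \<or> ?E = topspace T"
    using T unfolding connected_space_clopen_in by blast
  then show ?thesis using t0 t by blast
qed

definition liftable :: "'t topology \<Rightarrow> ('t \<Rightarrow> 'b) \<Rightarrow> 't set \<Rightarrow> bool"
  where "liftable T f S \<longleftrightarrow> (\<exists>h. continuous_map (subtopology T S) X h \<and> (\<forall>t\<in>topspace T \<inter> S. p (h t) = f t))"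

lemma liftable_mono: "liftable T f S \<Longrightarrow> S' \<subseteq> S \<Longrightarrow> liftable T f S'"
  unfolding liftable_def by (meson Int_iff continuous_map_from_subtopology_mono subsetD)

lemma locally_liftable:
  assumes f: "continuous_map T B f" and t: "t \<in> topspace T"
  shows "\<exists>N. openin T N \<and> t \<in> N \<and> liftable T f N"
proof -
  have "f t \<in> topspace B" using f t by (auto simp: continuous_map_def)
  then have "f t \<in> p ` topspace X" using quot by (simp add: quotient_map_def)
  then obtain x where x: "x \<in> topspace X" "p x = f t" by auto
  obtain U where U: "openin X U" "x \<in> U" "\<forall>g\<in>G. \<forall>y\<in>U. act g y \<in> U \<longrightarrow> g = e"
    using even[OF x(1)] by auto
  let ?N = "{s \<in> topspace T. f s \<in> p ` U}"
  have N: "openin T ?N" by (rule openin_continuous_map_preimage[OF f open_p[OF U(1)]])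
  define h where "h s = (SOME y. y \<in> U \<and> p y = f s)" for s
  have h: "h s \<in> U \<and> p (h s) = f s" if "s \<in> ?N" for s
    unfolding h_def by (rule someI_ex) (use that in auto)
  have "continuous_map (subtopology T ?N) X h"
    unfolding continuous_map_def
  proof (intro conjI allI impI)
    show "h \<in> topspace (subtopology T ?N) \<rightarrow> topspace X"
      using h openin_subset[OF U(1)] by auto
    fix V assume V: "openin X V"
    \<comment> \<open>Since p is injective on U, the map h is f followed by the inverse of p on U;
      it is continuous because p is open.\<close>
    have "{s \<in> topspace (subtopology T ?N). h s \<in> V} = {s \<in> topspace T. f s \<in> p ` (U \<inter> V)}"
    proof (intro equalityI subsetI)
      fix s assume "s \<in> {s \<in> topspace T. f s \<in> p ` (U \<inter> V)}"
      then obtain y where y: "s \<in> topspace T" "f s = p y" "y \<in> U" "y \<in> V" by auto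
      then have "s \<in> ?N" by auto
      then have "h s = y" using h even_inj[OF U(1,3)] y by metis
      then show "s \<in> {s \<in> topspace (subtopology T ?N). h s \<in> V}" using y \<open>s \<in> ?N\<close> by auto
    next
      fix s assume "s \<in> {s \<in> topspace (subtopology T ?N). h s \<in> V}"
      then have s: "s \<in> ?N" "h s \<in> V" by auto
      then show "s \<in> {s \<in> topspace T. f s \<in> p ` (U \<inter> V)}"
        using h[OF s(1)] by (auto intro!: image_eqI[of _ _ "h s"])
    qed
    moreover have "openin T {s \<in> topspace T. f s \<in> p ` (U \<inter> V)}"
      by (intro openin_continuous_map_preimage[OF f] open_p openin_Int U V)
    moreover have "{s \<in> topspace T. f s \<in> p ` (U \<inter> V)} \<subseteq> ?N" by auto
    ultimately show "openin (subtopology T ?N) {s \<in> topspace (subtopology T ?N). h s \<in> V}"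
      by (simp add: openin_open_subtopology[OF N])
  qed
  then have "liftable T f ?N" unfolding liftable_def using h by auto
  moreover have "t \<in> ?N" using t x(2) U(2) by (auto intro: image_eqI[of _ _ x])
  ultimately show ?thesis using N by blast
qed

text \<open>At one point of the common slice the two lifts differ by some g. Correcting the second
  lift by g makes them agree there, hence on the whole connected slice by
  \<open>lifts_unique\<close>.\<close>

lemma liftable_glue:
  assumes c: "continuous_map T euclideanreal c"
    and 1: "liftable T f (S \<inter> {t. c t \<le> r})" and 2: "liftable T f (S \<inter> {t. r \<le> c t})"
    and conn: "connectedin T (topspace T \<inter> S \<inter> {t. c t = r})"
  shows "liftable T f S"
proof -
  obtain h where h: "continuous_map (subtopology T (S \<inter> {t. c t \<le> r})) X h"
      "\<And>t. t \<in> topspace T \<Longrightarrow> t \<in> S \<Longrightarrow> c t \<le> r \<Longrightarrow> p (h t) = f t"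
    using 1 unfolding liftable_def by auto
  obtain k where k: "continuous_map (subtopology T (S \<inter> {t. r \<le> c t})) X k"
      "\<And>t. t \<in> topspace T \<Longrightarrow> t \<in> S \<Longrightarrow> r \<le> c t \<Longrightarrow> p (k t) = f t"
    using 2 unfolding liftable_def by auto
  let ?M = "topspace T \<inter> S \<inter> {t. c t = r}"
  have "\<exists>k'. continuous_map (subtopology T (S \<inter> {t. r \<le> c t})) X k' \<and>
     (\<forall>t\<in>topspace T \<inter> S. r \<le> c t \<longrightarrow> p (k' t) = f t) \<and> (\<forall>t\<in>?M. h t = k' t)"
  proof (cases "?M = {}")
    case True
    then show ?thesis using k by blast
  next
    case False
    then obtain t0 where t0: "t0 \<in> ?M" by auto
    have hin: "h t \<in> topspace X" if "t \<in> topspace T" "t \<in> S" "c t \<le> r" for t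
      using h(1) that by (auto simp: continuous_map_def)
    have kin: "k t \<in> topspace X" if "t \<in> topspace T" "t \<in> S" "r \<le> c t" for t
      using k(1) that by (auto simp: continuous_map_def)
    obtain g where g: "g \<in> G" "h t0 = act g (k t0)"
      using orbits[of "k t0" "h t0"] hin kin h(2) k(2) t0 by auto
    have k': "continuous_map (subtopology T (S \<inter> {t. r \<le> c t})) X (\<lambda>t. act g (k t))"
      using continuous_map_compose[OF k(1) act_cont[OF g(1)]] by (simp add: o_def)
    moreover have "\<forall>t\<in>topspace T \<inter> S. r \<le> c t \<longrightarrow> p (act g (k t)) = f t"
      using k(2) kin p_act[OF g(1)] by auto
    moreover have "h t = act g (k t)" if t: "t \<in> ?M" for t
    proof (rule lifts_unique[where T = "subtopology T ?M" and h = h and k = "\<lambda>t. act g (k t)" and ?t0.0 = t0])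
      show "connected_space (subtopology T ?M)" using conn by (simp add: connectedin_def)
      show "continuous_map (subtopology T ?M) X h"
        by (rule continuous_map_from_subtopology_mono[OF h(1)]) auto
      show "continuous_map (subtopology T ?M) X (\<lambda>t. act g (k t))"
        by (rule continuous_map_from_subtopology_mono[OF k']) auto
      show "p (h s) = p (act g (k s))" if "s \<in> topspace (subtopology T ?M)" for s
        using that h(2) k(2) kin p_act[OF g(1)] by auto
    qed (use t t0 g in auto)
    ultimately show ?thesis by blast
  qed
  then obtain k' where k': "continuous_map (subtopology T (S \<inter> {t. r \<le> c t})) X k'"
     "\<And>t. t \<in> topspace T \<Longrightarrow> t \<in> S \<Longrightarrow> r \<le> c t \<Longrightarrow> p (k' t) = f t" "\<And>t. t \<in> ?M \<Longrightarrow> h t = k' t"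
    by auto
  have "continuous_map (subtopology T S) X (\<lambda>t. if c t \<le> r then h t else k' t)"
  proof (rule continuous_map_cases_le)
    show "continuous_map (subtopology T S) euclideanreal c" by (rule continuous_map_from_subtopology[OF c])
    show "continuous_map (subtopology (subtopology T S) {x \<in> topspace (subtopology T S). c x \<le> r}) X h"
      unfolding subtopology_subtopology by (rule continuous_map_from_subtopology_mono[OF h(1)]) auto
    show "continuous_map (subtopology (subtopology T S) {x \<in> topspace (subtopology T S). r \<le> c x}) X k'"
      unfolding subtopology_subtopology by (rule continuous_map_from_subtopology_mono[OF k'(1)]) auto
  qed (use k'(3) in auto)
  then show ?thesis unfolding liftable_def using h(2) k'(2) by (intro exI[of _ "\<lambda>t. if c t \<le> r then h t else k' t"]) auto
qed

end

section \<open>Convex subsets of the standard simplex and lifting over it\<close>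

abbreviation "PT \<equiv> powertop_real (UNIV :: nat set)"

definition fconvex :: "(nat \<Rightarrow> real) set \<Rightarrow> bool"
  where "fconvex S \<longleftrightarrow> (\<forall>x\<in>S. \<forall>y\<in>S. \<forall>u\<in>{0..1}. (\<lambda>i. (1 - u) * x i + u * y i) \<in> S)"

lemma connectedin_fconvex:
  assumes "fconvex S" shows "connectedin PT S"
proof -
  define g where "g \<equiv> \<lambda>x y::nat\<Rightarrow>real. \<lambda>u i. (1 - u) * x i + u * y i"
  have "continuous_map (subtopology euclideanreal {0..1}) PT (g x y)" for x y
    unfolding g_def continuous_map_componentwise by (force intro: continuous_intros)
  moreover have "g x y \<in> {0..1} \<rightarrow> S" "g x y 0 = x" "g x y 1 = y" if "x \<in> S" "y \<in> S" for x y
    using that assms by (auto simp: fconvex_def g_def)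
  ultimately have "path_connectedin PT S"
    unfolding path_connectedin_def path_connected_space_def pathin_def
    by (metis continuous_map_in_subtopology euclidean_product_topology top_greatest topspace_euclidean topspace_euclidean_subtopology)
  then show ?thesis by (rule path_connectedin_imp_connectedin)
qed

lemma fconvex_le: "fconvex S \<Longrightarrow> fconvex (S \<inter> {x. x k \<le> r})"
  unfolding fconvex_def by (auto simp: convex_bound_le)

lemma fconvex_ge: "fconvex S \<Longrightarrow> fconvex (S \<inter> {x. r \<le> x k})"
proof -
  have "r \<le> (1 - u) * a + u * b" if "r \<le> a" "r \<le> b" "0 \<le> u" "u \<le> 1" for a b u :: real
    using convex_bound_le[of "-a" "-r" "-b" "1 - u" u] that by simp
  then show "fconvex S \<Longrightarrow> fconvex (S \<inter> {x. r \<le> x k})"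
    unfolding fconvex_def by auto
qed

lemma fconvex_eq: "fconvex S \<Longrightarrow> fconvex (S \<inter> {x. x k = r})"
  unfolding fconvex_def by (auto simp: algebra_simps)

lemma fconvex_simplex: "fconvex (standard_simplex n)"
  unfolding fconvex_def using convex_standard_simplex by auto

context free_quotient
begin

text \<open>A Lebesgue number, expressed by coordinates since \<^typ>\<open>nat \<Rightarrow> real\<close> carries no metric here.\<close>

lemma small_sets_liftable:
  assumes f: "continuous_map (subtopology PT (standard_simplex n)) B f"
  shows "\<exists>d>0. \<forall>S\<subseteq>standard_simplex n. (\<forall>x\<in>S. \<forall>y\<in>S. \<forall>i\<le>n. \<bar>x i - y i\<bar> \<le> d) \<longrightarrow>
     liftable (subtopology PT (standard_simplex n)) f S"
proof -
  let ?T = "subtopology PT (standard_simplex n)"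
  define box where "box t r = {x::nat\<Rightarrow>real. \<forall>i\<le>n. \<bar>x i - t i\<bar> < r}" for t r
  \<comment> \<open>The box over which f lifts is twice as large as the one used for covering: a set
    of width at most d that meets a small box stays inside the large one.\<close>
  have "\<exists>r>0. liftable ?T f (standard_simplex n \<inter> box t (2 * r))" if t: "t \<in> standard_simplex n" for t
  proof -
    obtain N where N: "openin ?T N" "t \<in> N" "liftable ?T f N"
      using locally_liftable[OF f, of t] t by auto
    obtain N' where N': "openin PT N'" "N = N' \<inter> standard_simplex n"
      using N(1) by (auto simp: openin_subtopology)
    obtain U where U: "\<forall>i. open (U i)" "t \<in> Pi\<^sub>E UNIV U" "Pi\<^sub>E UNIV U \<subseteq> N'"
      using N'(1) N(2) unfolding openin_product_topology_alt N'(2) by force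
    have "\<exists>r>0. \<forall>y. \<bar>y - t i\<bar> < r \<longrightarrow> y \<in> U i" for i
    proof -
      have "open (U i)" "t i \<in> U i" using U(1,2) by (auto simp: PiE_def)
      then show ?thesis by (simp add: open_dist dist_real_def)
    qed
    then obtain r where r: "\<And>i. r i > 0" "\<And>i y. \<bar>y - t i\<bar> < r i \<Longrightarrow> y \<in> U i" by metis
    define q where "q = Min (r ` {..n}) / 2"
    have q: "0 < q" "\<And>i. i \<le> n \<Longrightarrow> 2 * q \<le> r i" using r(1) by (auto simp: q_def)
    have "standard_simplex n \<inter> box t (2 * q) \<subseteq> N"
    proof
      fix x assume x: "x \<in> standard_simplex n \<inter> box t (2 * q)"
      have "x i \<in> U i" for i
      proof (cases "i \<le> n")
        case True
        then show ?thesis using x q(2)[OF True] r(2)[of "x i" i] by (auto simp: box_def)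
      next
        case False
        \<comment> \<open>Beyond n all coordinates vanish on the simplex, so the boxes constrain
          only the coordinates up to n.\<close>
        then have "x i = t i" using x t by (auto simp: standard_simplex_def)
        then show ?thesis using U(2) by auto
      qed
      then show "x \<in> N" using U(3) x N'(2) by auto
    qed
    then show ?thesis using q(1) liftable_mono[OF N(3)] by blast
  qed
  then obtain r where r: "\<And>t. t \<in> standard_simplex n \<Longrightarrow> r t > 0"
    "\<And>t. t \<in> standard_simplex n \<Longrightarrow> liftable ?T f (standard_simplex n \<inter> box t (2 * r t))"
    by metis
  have ob: "openin PT (box t q)" for t q
  proof -
    have "box t q = (\<Inter>i\<le>n. {x \<in> topspace PT. x i \<in> {t i - q<..<t i + q}})"
      by (auto simp: box_def abs_less_iff) (force simp: abs_less_iff)+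
    moreover have "openin PT (\<Inter>i\<le>n. {x \<in> topspace PT. x i \<in> {t i - q<..<t i + q}})"
      by (intro openin_INT2 openin_continuous_map_preimage[OF continuous_map_product_projection]) auto
    ultimately show ?thesis by simp
  qed
  let ?U = "(\<lambda>t. box t (r t)) ` standard_simplex n"
  have "x \<in> \<Union>?U" if x: "x \<in> standard_simplex n" for x
    using r(1)[OF x] x by (intro UnionI[of "box x (r x)"]) (auto simp: box_def)
  then have cov: "standard_simplex n \<subseteq> \<Union>?U" by blast
  have "\<forall>U\<in>?U. openin PT U" using ob by blast
  then obtain F where F: "finite F" "F \<subseteq> ?U" "standard_simplex n \<subseteq> \<Union>F"
    using compactin_standard_simplex[of n] cov unfolding compactin_def by meson
  obtain K where K: "finite K" "K \<subseteq> standard_simplex n" "F = (\<lambda>t. box t (r t)) ` K"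
    using finite_subset_image[OF F(1,2)] by blast
  have "K \<noteq> {}" using F(3) K(3) nonempty_standard_simplex[of n] by auto
  define d where "d = Min (r ` K)"
  have d: "0 < d" "\<And>t. t \<in> K \<Longrightarrow> d \<le> r t" using K r(1) \<open>K \<noteq> {}\<close> by (auto simp: d_def)
  have "liftable ?T f S" if S: "S \<subseteq> standard_simplex n" "\<forall>x\<in>S. \<forall>y\<in>S. \<forall>i\<le>n. \<bar>x i - y i\<bar> \<le> d" for S
  proof (cases "S = {}")
    case True
    then show ?thesis by (simp add: liftable_def)
  next
    case False
    then obtain z where z: "z \<in> S" by auto
    then obtain t where t: "t \<in> K" "z \<in> box t (r t)" using F(3) K(3) S(1) by auto
    have "S \<subseteq> standard_simplex n \<inter> box t (2 * r t)"
    proof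
      fix x assume x: "x \<in> S"
      have "\<bar>x i - t i\<bar> < 2 * r t" if i: "i \<le> n" for i
      proof -
        have "\<bar>x i - z i\<bar> \<le> d" using S(2) x z i by auto
        moreover have "\<bar>z i - t i\<bar> < r t" using t(2) i by (simp add: box_def)
        ultimately show ?thesis using d(2)[OF t(1)] by linarith
      qed
      then show "x \<in> standard_simplex n \<inter> box t (2 * r t)" using x S(1) by (auto simp: box_def)
    qed
    then show ?thesis using r(2) K(2) t(1) liftable_mono by blast
  qed
  then show ?thesis using d(1) by blast
qed

text \<open>
  Convex pieces that are small in the coordinates \<open>\<ge> k\<close> lift: cut them into slabs along the
  coordinate \<open>k\<close>. Adjacent slabs meet in a convex, hence connected set, so their lifts can be glued.
\<close>

lemma simplex_liftable:
  assumes f: "continuous_map (subtopology PT (standard_simplex n)) B f"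
  shows "liftable (subtopology PT (standard_simplex n)) f (standard_simplex n)"
proof -
  let ?T = "subtopology PT (standard_simplex n)"
  obtain d where d: "d > 0" and small: "\<And>S. S \<subseteq> standard_simplex n \<Longrightarrow>
      (\<forall>x\<in>S. \<forall>y\<in>S. \<forall>i\<le>n. \<bar>x i - y i\<bar> \<le> d) \<Longrightarrow> liftable ?T f S"
    using small_sets_liftable[OF f] by blast
  \<comment> \<open>At k = 0 all coordinates are small; at k = Suc n the smallness condition is
    vacuous. Each step of the induction gives up the bound on one coordinate.\<close>
  have "\<forall>S\<subseteq>standard_simplex n. fconvex S \<longrightarrow> (\<forall>x\<in>S. \<forall>y\<in>S. \<forall>i\<le>n. k \<le> i \<longrightarrow> \<bar>x i - y i\<bar> \<le> d) \<longrightarrow> liftable ?T f S" for k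
  proof (induction k)
    case 0
    then show ?case using small by simp
  next
    case (Suc k)
    show ?case
    proof (intro allI impI)
      fix S assume S: "S \<subseteq> standard_simplex n" "fconvex S" "\<forall>x\<in>S. \<forall>y\<in>S. \<forall>i\<le>n. Suc k \<le> i \<longrightarrow> \<bar>x i - y i\<bar> \<le> d"
      have step: "liftable ?T f S'" if "S' \<subseteq> S" "fconvex S'" "\<forall>x\<in>S'. \<forall>y\<in>S'. \<bar>x k - y k\<bar> \<le> d" for S'
      proof -
        have "\<forall>x\<in>S'. \<forall>y\<in>S'. \<forall>i\<le>n. k \<le> i \<longrightarrow> \<bar>x i - y i\<bar> \<le> d"
        proof (intro ballI allI impI)
          fix x y i assume *: "x \<in> S'" "y \<in> S'" "i \<le> n" "k \<le> i"
          then have "i = k \<or> Suc k \<le> i" by auto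
          then show "\<bar>x i - y i\<bar> \<le> d" using that S(3) * by blast
        qed
        moreover have "S' \<subseteq> standard_simplex n" using that S(1) by auto
        ultimately show ?thesis using Suc.IH that(2) by blast
      qed
      have x01: "0 \<le> x k \<and> x k \<le> 1" if "x \<in> S" for x
        using S(1) that by (auto simp: standard_simplex_def)
      \<comment> \<open>Slabs of width d are added one at a time; as the coordinates lie in [0, 1],
        finitely many of them exhaust S.\<close>
      have le: "liftable ?T f (S \<inter> {x. x k \<le> real m * d})" for m
      proof (induction m)
        case 0
        show ?case
          by (rule step) (use S x01 d in \<open>auto intro: fconvex_le dest!: x01\<close>)
      next
        case (Suc m)
        let ?S = "S \<inter> {x. x k \<le> real (Suc m) * d}"
        have cv: "fconvex ?S" by (intro fconvex_le S)
        show ?case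
        proof (rule liftable_glue[where c = "\<lambda>x. x k" and r = "real m * d"])
          show "continuous_map ?T euclideanreal (\<lambda>x. x k)"
            by (intro continuous_map_from_subtopology continuous_map_product_projection) auto
          show "liftable ?T f (?S \<inter> {x. x k \<le> real m * d})"
            by (rule liftable_mono[OF Suc]) auto
          show "liftable ?T f (?S \<inter> {x. real m * d \<le> x k})"
            by (rule step) (use cv in \<open>auto intro: fconvex_ge simp: algebra_simps\<close>)
          have "topspace ?T \<inter> ?S \<inter> {x. x k = real m * d} = ?S \<inter> {x. x k = real m * d}"
            using S(1) by auto
          then show "connectedin ?T (topspace ?T \<inter> ?S \<inter> {x. x k = real m * d})"
            using connectedin_fconvex[OF fconvex_eq[OF cv]] S(1) by (auto simp: connectedin_subtopology)
        qed
      qed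
      obtain m where "1 / d < real m" using reals_Archimedean2 by blast
      then have "1 < real m * d" using d by (simp add: field_simps)
      then have "S \<subseteq> S \<inter> {x. x k \<le> real m * d}" using x01 by force
      then show "liftable ?T f S" using liftable_mono[OF le[of m]] by blast
    qed
  qed
  from this[of "Suc n"] show ?thesis
    using fconvex_simplex[of n] by auto
qed

lemma singular_simplex_lifts:
  assumes "singular_simplex n B s"
  shows "\<exists>s'. singular_simplex n X s' \<and> simplex_map n p s' = s"
proof -
  have s: "continuous_map (subtopology PT (standard_simplex n)) B s" "s \<in> extensional (standard_simplex n)"
    using assms by (auto simp: singular_simplex_def)
  obtain h where h: "continuous_map (subtopology PT (standard_simplex n)) X h" "\<And>t. t \<in> standard_simplex n \<Longrightarrow> p (h t) = s t"
    using simplex_liftable[OF s(1)] by (auto simp: liftable_def subtopology_subtopology)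
  have "singular_simplex n X (restrict h (standard_simplex n))"
    unfolding singular_simplex_def
    using continuous_map_eq[OF h(1), of "restrict h (standard_simplex n)"] by simp
  moreover have "simplex_map n p (restrict h (standard_simplex n)) = s"
    using h(2) s(2) by (auto simp: simplex_map_def fun_eq_iff extensional_def)
  ultimately show ?thesis by blast
qed

text \<open>The element that matches the two simplices at one point matches them everywhere, because
  the standard simplex is connected.\<close>

lemma singular_simplex_orbit:
  assumes s: "singular_simplex n X s" and r: "singular_simplex n X r" and eq: "simplex_map n p s = simplex_map n p r"
  shows "\<exists>g\<in>G. r = simplex_map n (act g) s"
proof -
  obtain v where v: "v \<in> standard_simplex n" using nonempty_standard_simplex[of n] by auto
  have in_X: "s t \<in> topspace X" "r t \<in> topspace X" if "t \<in> standard_simplex n" for t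
    using s r that by (auto simp: singular_simplex_def continuous_map_def)
  have pe: "p (s t) = p (r t)" if "t \<in> standard_simplex n" for t
    using fun_cong[OF eq, of t] that by (simp add: simplex_map_def)
  obtain g where g: "g \<in> G" "r v = act g (s v)"
    using orbits[of "s v" "r v"] in_X v pe by auto
  have "act g (s t) = r t" if "t \<in> standard_simplex n" for t
  proof (rule lifts_unique[where T = "subtopology PT (standard_simplex n)" and h = "\<lambda>t. act g (s t)" and k = r and ?t0.0 = v])
    show "connected_space (subtopology PT (standard_simplex n))"
      using connectedin_standard_simplex[of n] by (simp add: connectedin_def)
    show "continuous_map (subtopology PT (standard_simplex n)) X (\<lambda>t. act g (s t))"
      using continuous_map_compose[OF _ act_cont[OF g(1)], of _ s] s by (simp add: singular_simplex_def o_def)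
    show "continuous_map (subtopology PT (standard_simplex n)) X r"
      using r by (simp add: singular_simplex_def)
  qed (use that v g pe p_act in_X in auto)
  then have "r = simplex_map n (act g) s"
    using r by (auto simp: simplex_map_def singular_simplex_def fun_eq_iff extensional_def)
  then show ?thesis using g by blast
qed

end

section \<open>The universal cover of the Borel construction\<close>

lemma (in group_action) orbit_eq_iff:
  assumes "x \<in> E" "y \<in> E"
  shows "orbit G \<phi> x = orbit G \<phi> y \<longleftrightarrow> (\<exists>g\<in>carrier G. y = \<phi> g x)"
proof
  assume "orbit G \<phi> x = orbit G \<phi> y"
  then have "y \<in> orbit G \<phi> x" using orbit_refl[OF assms(2)] by simp
  then show "\<exists>g\<in>carrier G. y = \<phi> g x" by (auto simp: orbit_def)
next
  assume "\<exists>g\<in>carrier G. y = \<phi> g x"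
  then have "y \<in> orbit G \<phi> x" by (auto simp: orbit_def)
  moreover have "z \<in> E" if "z \<in> orbit G \<phi> w" "w \<in> E" for z w
    using that element_image by (auto simp: orbit_def)
  ultimately show "orbit G \<phi> x = orbit G \<phi> y"
    using orbit_trans orbit_sym assms by (meson equalityI subsetI)
qed

section \<open>The lattice M and its cosets\<close>

definition lattice_point :: "lattice \<Rightarrow> complex ^ 3"
  where "lattice_point = (\<lambda>((a, b), (c, d), (e, f)).
    vector [Complex (of_int a) (of_int b), Complex (of_int c) (of_int d), Complex (of_int e) (of_int f)])"

lemma lattice_point_component:
  "lattice_point ((a, b), (c, d), (e, f)) $ 1 = Complex (of_int a) (of_int b)"
  "lattice_point ((a, b), (c, d), (e, f)) $ 2 = Complex (of_int c) (of_int d)"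
  "lattice_point ((a, b), (c, d), (e, f)) $ 3 = Complex (of_int e) (of_int f)"
  by (simp_all add: lattice_point_def)

lemma lattice_point_add: "lattice_point (m + n) = lattice_point m + lattice_point n"
proof -
  obtain a b c d e f where m: "m = ((a, b), (c, d), (e, f))" by (metis prod.collapse)
  obtain a' b' c' d' e' f' where n: "n = ((a', b'), (c', d'), (e', f'))" by (metis prod.collapse)
  show ?thesis
    by (simp add: m n vec_eq_iff forall_3 lattice_point_component complex_eq_iff)
qed

lemma lattice_point_0 [simp]: "lattice_point 0 = 0"
  using lattice_point_add[of 0 0] by simp

lemma inj_lattice_point: "lattice_point m = lattice_point n \<longleftrightarrow> m = n"
proof -
  obtain a b c d e f where m: "m = ((a, b), (c, d), (e, f))" by (metis prod.collapse)
  obtain a' b' c' d' e' f' where n: "n = ((a', b'), (c', d'), (e', f'))" by (metis prod.collapse)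
  show ?thesis
    by (auto simp: m n vec_eq_iff forall_3 lattice_point_component complex_eq_iff)
qed

lemma range_lattice_point: "range lattice_point = lattice_M"
proof
  show "range lattice_point \<subseteq> lattice_M"
    by (auto simp: lattice_M_def forall_3 lattice_point_component)
  show "lattice_M \<subseteq> range lattice_point"
  proof
    fix z assume "z \<in> lattice_M"
    then obtain a b c d e f where "Re (z $ 1) = of_int a" "Im (z $ 1) = of_int b" "Re (z $ 2) = of_int c"
       "Im (z $ 2) = of_int d" "Re (z $ 3) = of_int e" "Im (z $ 3) = of_int f"
      unfolding lattice_M_def by (auto simp: forall_3 elim!: Ints_cases)
    then have "z = lattice_point ((a, b), (c, d), (e, f))"
      by (simp add: vec_eq_iff forall_3 lattice_point_component complex_eq_iff)
    then show "z \<in> range lattice_point" by blast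
  qed
qed

lemma tau_untwist: "tau (lattice_point (untwist m)) = lattice_point m"
proof -
  obtain a b c d e f where m: "m = ((a, b), (c, d), (e, f))" by (metis prod.collapse)
  show ?thesis
    by (simp add: m untwist_def vec_eq_iff forall_3 lattice_point_component tau_component complex_eq_iff)
qed

text \<open>A nonzero lattice vector has a nonzero integer coordinate. The bound 1 is the origin of
  the radius 1/2 in \<open>even_cover\<close>.\<close>

lemma lattice_point_small:
  assumes "norm (lattice_point m) < 1" shows "m = 0"
proof -
  obtain a b c d e f where m: "m = ((a, b), (c, d), (e, f))" by (metis prod.collapse)
  have n: "cmod (lattice_point m $ i) < 1" for i
    using assms Finite_Cartesian_Product.norm_nth_le[of "lattice_point m" i] by linarith
  have z: "j = 0 \<and> k = 0" if "cmod (Complex (of_int j) (of_int k)) < 1" for j k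
  proof -
    have "\<bar>real_of_int j\<bar> < 1" "\<bar>real_of_int k\<bar> < 1"
      using abs_Re_le_cmod[of "Complex (of_int j) (of_int k)"] abs_Im_le_cmod[of "Complex (of_int j) (of_int k)"] that
      by auto
    then show ?thesis by linarith
  qed
  show ?thesis
    using z[of a b] z[of c d] z[of e f] n[of 1] n[of 2] n[of 3]
    by (simp add: m lattice_point_component zero_prod_def)
qed

abbreviation "coset \<equiv> orbit lattice_M_group (+)"

lemma coset_eq_iff: "coset z = coset w \<longleftrightarrow> (\<exists>m. w = z + lattice_point m)"
proof -
  have neg: "- l \<in> lattice_M" if "l \<in> lattice_M" for l
    using that by (simp add: lattice_M_def)
  have add: "l + l' \<in> lattice_M" if "l \<in> lattice_M" "l' \<in> lattice_M" for l l'
    using that by (simp add: lattice_M_def)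
  have "coset z = coset w \<longleftrightarrow> w - z \<in> lattice_M"
  proof
    assume "coset z = coset w"
    moreover have "w \<in> coset w" unfolding torus6_coset by (auto simp: lattice_M_def intro: exI[of _ 0])
    ultimately have "w \<in> coset z" by simp
    then show "w - z \<in> lattice_M" unfolding torus6_coset by auto
  next
    assume wz: "w - z \<in> lattice_M"
    have "l + z = (l - (w - z)) + w" "l + w = (l + (w - z)) + z" for l by simp_all
    moreover have "l - (w - z) \<in> lattice_M" "l + (w - z) \<in> lattice_M" if "l \<in> lattice_M" for l
      using add[OF that neg[OF wz]] add[OF that wz] by (simp_all only: diff_conv_add_uminus)
    ultimately show "coset z = coset w" unfolding torus6_coset by blast
  qed
  also have "\<dots> \<longleftrightarrow> (\<exists>m. w = z + lattice_point m)"
  proof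
    assume "w - z \<in> lattice_M"
    then obtain m where "w - z = lattice_point m" unfolding range_lattice_point[symmetric] by auto
    then show "\<exists>m. w = z + lattice_point m" by (intro exI[of _ m]) (simp add: algebra_simps)
  next
    assume "\<exists>m. w = z + lattice_point m"
    then show "w - z \<in> lattice_M" unfolding range_lattice_point[symmetric] by auto
  qed
  finally show ?thesis .
qed

lemma open_coset: "open W \<Longrightarrow> openin torus6 (coset ` W)"
  unfolding torus6_def openin_orbit_space
proof
  show "coset ` W \<subseteq> orbits lattice_M_group (topspace euclidean) (+)" by (auto simp: orbits_def)
  assume W: "open W"
  have "{z \<in> topspace euclidean. coset z \<in> coset ` W} = (\<Union>m. (\<lambda>z. z + lattice_point m) ` W)"
  proof (intro equalityI subsetI)
    fix z assume "z \<in> {z \<in> topspace euclidean. coset z \<in> coset ` W}"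
    then obtain w where w: "w \<in> W" "coset w = coset z" by auto
    then obtain m where "z = w + lattice_point m" unfolding coset_eq_iff by auto
    then show "z \<in> (\<Union>m. (\<lambda>z. z + lattice_point m) ` W)" using w(1) by blast
  next
    fix z assume "z \<in> (\<Union>m. (\<lambda>z. z + lattice_point m) ` W)"
    then obtain m w where w: "w \<in> W" "z = w + lattice_point m" by blast
    then have "coset w = coset z" unfolding coset_eq_iff by blast
    then show "z \<in> {z \<in> topspace euclidean. coset z \<in> coset ` W}"
      using w by (auto intro!: image_eqI[of _ _ w])
  qed
  moreover have "open ((\<lambda>z. z + lattice_point m) ` W)" for m
    using open_translation[OF W, of "lattice_point m"] by (simp add: add.commute)
  ultimately show "openin euclidean {z \<in> topspace euclidean. coset z \<in> coset ` W}"
    by (simp add: open_UN)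
qed

lemma quotient_coset: "quotient_map euclidean torus6 coset"
  unfolding torus6_def by (rule quotient_map_orbit)

lemma tau_funpow_inj: "(tau ^^ k) z = (tau ^^ k) w \<Longrightarrow> z = w"
proof (induction k)
  case (Suc k)
  have "tau a = tau b \<Longrightarrow> a = b" for a b
    by (simp add: vec_eq_iff forall_3 tau_component)
  then show ?case using Suc by auto
qed simp

section \<open>The action of the semidirect product of M and Z/4 on E x C^3\<close>

locale borel_cover =
  fixes E :: "'e topology" and \<epsilon> :: "int \<Rightarrow> 'e \<Rightarrow> 'e"
  assumes EG: "is_EG (integer_mod_group 4) E \<epsilon>"
begin

abbreviation "X \<equiv> prod_topology E (euclidean :: (complex ^ 3) topology)"
abbreviation "Z4 \<equiv> integer_mod_group 4"
abbreviation "B \<equiv> borel_construction Z4 E \<epsilon> torus6 torus6_action"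
abbreviation "diag \<equiv> diagonal_action (topspace E) \<epsilon> (topspace torus6) torus6_action"

definition rotX :: "'e \<times> (complex ^ 3) \<Rightarrow> 'e \<times> (complex ^ 3)"
  where "rotX = (\<lambda>(e, z). (\<epsilon> 1 e, tau z))"

definition trX :: "lattice \<Rightarrow> 'e \<times> (complex ^ 3) \<Rightarrow> 'e \<times> (complex ^ 3)"
  where "trX m = (\<lambda>(e, z). (e, z + lattice_point m))"

text \<open>The normal form of \<open>act_word\<close>, now acting on points.\<close>

definition actX :: "nat \<times> lattice \<Rightarrow> 'e \<times> (complex ^ 3) \<Rightarrow> 'e \<times> (complex ^ 3)"
  where "actX = (\<lambda>(k, m) x. (rotX ^^ k) (trX m x))"

definition pr :: "'e \<times> (complex ^ 3) \<Rightarrow> ('e \<times> (complex ^ 3) set) set"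
  where "pr = (\<lambda>(e, z). orbit Z4 diag (e, coset z))"

lemma EG_facts:
  "Hausdorff_space E" "topspace E \<noteq> {}" "contractible_space E" "group_action Z4 (topspace E) \<epsilon>"
  "\<And>g. g \<in> carrier Z4 \<Longrightarrow> continuous_map E E (\<epsilon> g)"
  "\<And>x. x \<in> topspace E \<Longrightarrow> stabilizer Z4 \<epsilon> x = {0}"
  using EG by (auto simp: is_EG_def continuous_group_action_def)

lemma Z4_mem: "k < 4 \<Longrightarrow> int k \<in> carrier Z4"
  by (simp add: carrier_integer_mod_group)

sublocale eps: group_action Z4 "topspace E" \<epsilon>
  by (rule EG_facts)

lemma eps_in: "g \<in> carrier Z4 \<Longrightarrow> e \<in> topspace E \<Longrightarrow> \<epsilon> g e \<in> topspace E"
  using eps.element_image by blast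

lemma eps_0: "e \<in> topspace E \<Longrightarrow> \<epsilon> 0 e = e"
  using fun_cong[OF eps.id_eq_one, of e] by simp

lemma eps_add: "e \<in> topspace E \<Longrightarrow> g \<in> carrier Z4 \<Longrightarrow> h \<in> carrier Z4 \<Longrightarrow> \<epsilon> g (\<epsilon> h e) = \<epsilon> ((g + h) mod 4) e"
  using eps.composition_rule[of e g h] by simp

lemma eps_free:
  assumes "e \<in> topspace E" "g \<in> carrier Z4" "h \<in> carrier Z4" "\<epsilon> g e = \<epsilon> h e"
  shows "g = h"
proof -
  have i: "(- h) mod 4 \<in> carrier Z4" by (simp add: carrier_integer_mod_group)
  have "\<epsilon> (((- h) mod 4 + g) mod 4) e = \<epsilon> (((- h) mod 4 + h) mod 4) e"
    using eps_add[OF assms(1) i] assms by metis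
  then have "\<epsilon> ((g - h) mod 4) e = e" using assms(1) by (simp add: mod_simps eps_0)
  moreover have "(g - h) mod 4 \<in> carrier Z4" by (simp add: carrier_integer_mod_group)
  ultimately have "(g - h) mod 4 \<in> stabilizer Z4 \<epsilon> e" by (simp add: stabilizer_def)
  then have "(g - h) mod 4 = 0" using EG_facts(6)[OF assms(1)] by simp
  then show ?thesis using assms(2,3) by (auto simp: carrier_integer_mod_group) presburger
qed

lemma rotX_funpow:
  assumes "e \<in> topspace E" "k < 4"
  shows "(rotX ^^ k) (e, z) = (\<epsilon> (int k) e, (tau ^^ k) z)"
  using assms(2)
proof (induction k)
  case 0 then show ?case using assms(1) by (simp add: eps_0)
next
  case (Suc k)
  have "\<epsilon> 1 (\<epsilon> (int k) e) = \<epsilon> (int (Suc k)) e"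
    using eps_add[OF assms(1), of 1 "int k"] Suc.prems by (simp add: carrier_integer_mod_group)
  then show ?case using Suc by (simp add: rotX_def)
qed

lemma actX_simp:
  assumes "e \<in> topspace E" "k < 4"
  shows "actX (k, m) (e, z) = (\<epsilon> (int k) e, (tau ^^ k) (z + lattice_point m))"
  using rotX_funpow[OF assms] by (simp add: actX_def trX_def)

lemma rotX_4: "x \<in> topspace X \<Longrightarrow> rotX (rotX (rotX (rotX x))) = x"
proof -
  assume "x \<in> topspace X"
  then obtain e z where x: "x = (e, z)" "e \<in> topspace E" by auto
  have "rotX (rotX (rotX (rotX x))) = rotX ((rotX ^^ 3) x)" by (simp add: numeral_eq_Suc)
  also have "\<dots> = (\<epsilon> 1 (\<epsilon> 3 e), (tau ^^ 4) z)"
    using rotX_funpow[OF x(2), of 3 z] by (simp add: x rotX_def numeral_eq_Suc)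
  also have "\<dots> = x" using eps_add[OF x(2), of 1 3] x by (simp add: eps_0 carrier_integer_mod_group tau_power4)
  finally show ?thesis .
qed

lemma rotX_cont: "continuous_map X X rotX"
proof -
  have "continuous_map E E (\<epsilon> 1)" by (rule EG_facts) (simp add: carrier_integer_mod_group)
  moreover have "continuous_map euclidean euclidean tau"
    using continuous_on_tau_funpow[of 1] by simp
  ultimately show ?thesis unfolding rotX_def continuous_map_prod_top by blast
qed

lemma trX_cont: "continuous_map X X (trX m)"
  unfolding trX_def continuous_map_prod_top by (auto intro!: continuous_intros)

lemma rotX_open: "openin X U \<Longrightarrow> openin X (rotX ` U)"
proof -
  have "homeomorphic_maps X X rotX (rotX \<circ> rotX \<circ> rotX)"
    unfolding homeomorphic_maps_def
    using rotX_4 rotX_cont continuous_map_compose[OF continuous_map_compose[OF rotX_cont rotX_cont] rotX_cont]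
    by (simp add: comp_assoc)
  then have "homeomorphic_map X X rotX" by (simp add: homeomorphic_maps_map)
  then have "open_map X X rotX" by (rule homeomorphic_imp_open_map)
  then show "openin X U \<Longrightarrow> openin X (rotX ` U)" by (simp add: open_map_def)
qed

lemma trX_trX: "trX m (trX n x) = trX (m + n) x"
  by (cases x) (simp add: trX_def lattice_point_add add.commute add.left_commute)

lemma trX_0: "trX 0 x = x"
  by (cases x) (simp add: trX_def)

lemma trX_open: "openin X U \<Longrightarrow> openin X (trX m ` U)"
proof -
  have "homeomorphic_maps X X (trX m) (trX (- m))"
    unfolding homeomorphic_maps_def by (simp add: trX_cont trX_trX trX_0)
  then have "homeomorphic_map X X (trX m)" by (simp add: homeomorphic_maps_map)
  then have "open_map X X (trX m)" by (rule homeomorphic_imp_open_map)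
  then show "openin X U \<Longrightarrow> openin X (trX m ` U)" by (simp add: open_map_def)
qed

lemma trX_rotX: "trX m (rotX x) = rotX (trX (untwist m) x)"
  by (cases x) (simp add: trX_def rotX_def tau_add tau_untwist)

lemma actX_cont: "continuous_map X X (actX g)"
proof -
  obtain k m where g: "g = (k, m)" by (cases g)
  have "continuous_map X X (rotX ^^ k)"
  proof (induction k)
    case (Suc k)
    show ?case using continuous_map_compose[OF Suc rotX_cont] by (simp only: funpow.simps(2))
  qed simp
  from continuous_map_compose[OF trX_cont this] show ?thesis by (simp add: g actX_def o_def)
qed

lemma actX_open: "openin X U \<Longrightarrow> openin X (actX g ` U)"
proof -
  assume U: "openin X U"
  obtain k m where g: "g = (k, m)" by (cases g)
  have "openin X ((rotX ^^ k) ` trX m ` U)"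
  proof (induction k)
    case 0 then show ?case using trX_open[OF U] by simp
  next
    case (Suc k)
    show ?case using rotX_open[OF Suc] by (simp add: image_comp comp_assoc)
  qed
  then show ?thesis by (simp add: g actX_def image_image)
qed

lemma diag_action: "continuous_group_action Z4 (prod_topology E torus6) diag"
proof (rule continuous_group_actionI)
  interpret t: group_action Z4 "topspace torus6" torus6_action
    using continuous_group_action_torus6 by (simp add: continuous_group_action_def)
  fix g assume g: "g \<in> carrier Z4"
  have "continuous_map (prod_topology E torus6) (prod_topology E torus6) (\<lambda>(x, y). (\<epsilon> g x, torus6_action g y))"
    unfolding continuous_map_prod_top
    using EG_facts(5)[OF g] continuous_group_action_torus6 g by (simp add: continuous_group_action_def)
  then show "continuous_map (prod_topology E torus6) (prod_topology E torus6) (diag g)"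
    by (rule continuous_map_eq) (auto simp: diagonal_action_def)
  show "diag g \<in> extensional (topspace (prod_topology E torus6))" by (simp add: diagonal_action_def)
next
  interpret t: group_action Z4 "topspace torus6" torus6_action
    using continuous_group_action_torus6 by (simp add: continuous_group_action_def)
  fix x assume x: "x \<in> topspace (prod_topology E torus6)"
  obtain d C where dC: "x = (d, C)" "d \<in> topspace E" "C \<in> topspace torus6" using x by auto
  show "diag \<one>\<^bsub>Z4\<^esub> x = x"
    using dC eps_0 fun_cong[OF t.id_eq_one, of C] by (simp add: diagonal_action_def)
  fix g h assume gh: "g \<in> carrier Z4" "h \<in> carrier Z4"
  show "diag (g \<otimes>\<^bsub>Z4\<^esub> h) x = diag g (diag h x)"
    using eps.composition_rule[OF dC(2) gh] t.composition_rule[OF dC(3) gh] eps_in[OF gh(2) dC(2)]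
      t.element_image[OF gh(2) dC(3) refl] dC
    by (simp add: diagonal_action_def)
qed simp

lemma coset_in: "coset z \<in> topspace torus6"
  by (simp add: topspace_torus6)

lemma pr_eq_iff:
  assumes "x \<in> topspace X" "y \<in> topspace X"
  shows "pr x = pr y \<longleftrightarrow> (\<exists>g\<in>{..<4} \<times> UNIV. y = actX g x)"
proof -
  obtain e z where x: "x = (e, z)" "e \<in> topspace E" using assms by auto
  obtain d w where y: "y = (d, w)" "d \<in> topspace E" using assms by auto
  interpret D: group_action Z4 "topspace (prod_topology E torus6)" diag
    using diag_action by (simp add: continuous_group_action_def)
  have "pr x = pr y \<longleftrightarrow> (\<exists>g\<in>carrier Z4. (d, coset w) = diag g (e, coset z))"
    unfolding x y pr_def split by (rule D.orbit_eq_iff) (use x y coset_in in auto)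
  also have "\<dots> \<longleftrightarrow> (\<exists>k<4. (d, coset w) = diag (int k) (e, coset z))"
  proof -
    have "carrier Z4 = int ` {..<4}"
      by (auto simp: carrier_integer_mod_group image_int_atLeastLessThan[of 0 4, simplified, symmetric] lessThan_atLeast0 intro!: image_eqI[of _ int "nat _"])
    then show ?thesis by auto
  qed
  also have "\<dots> \<longleftrightarrow> (\<exists>k<4. \<exists>m. (d, w) = actX (k, m) (e, z))"
  proof (intro ex_cong1 conj_cong refl)
    fix k :: nat assume k: "k < 4"
    \<comment> \<open>Translations by M before and after a power of \<open>tau\<close> reach the
      same points, because that power maps M onto itself; \<open>untwist\<close> supplies the
      preimages.\<close>
    have tl: "(\<exists>m. w = (tau ^^ k) z + lattice_point m) \<longleftrightarrow> (\<exists>m. w = (tau ^^ k) (z + lattice_point m))"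
    proof -
      have "lattice_point m = (tau ^^ k) (lattice_point ((untwist ^^ k) m))" for m
      proof (induction k arbitrary: m)
        case (Suc k)
        have "(tau ^^ Suc k) (lattice_point ((untwist ^^ Suc k) m)) = tau ((tau ^^ k) (lattice_point ((untwist ^^ k) (untwist m))))"
          by (simp add: funpow_swap1)
        then show ?case by (simp add: Suc[symmetric] tau_untwist)
      qed simp
      moreover have "(tau ^^ k) (lattice_point m) \<in> range lattice_point" for m
        using tau_funpow_lattice_M[of "lattice_point m" k] unfolding range_lattice_point[symmetric] by auto
      ultimately show ?thesis unfolding tau_funpow_add by (metis rangeE)
    qed
    show "(d, coset w) = diag (int k) (e, coset z) \<longleftrightarrow> (\<exists>m. (d, w) = actX (k, m) (e, z))"
    proof -
      have "(d, coset w) = diag (int k) (e, coset z) \<longleftrightarrow> d = \<epsilon> (int k) e \<and> coset ((tau ^^ k) z) = coset w"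
        using x coset_in by (auto simp: diagonal_action_def torus6_action_coset)
      also have "\<dots> \<longleftrightarrow> (\<exists>m. (d, w) = actX (k, m) (e, z))"
        unfolding coset_eq_iff tl actX_simp[OF x(2) k] by blast
      finally show ?thesis .
    qed
  qed
  also have "\<dots> \<longleftrightarrow> (\<exists>g\<in>{..<4} \<times> UNIV. y = actX g x)"
    unfolding x y by blast
  finally show ?thesis .
qed

lemma quotient_pr: "quotient_map X B pr"
proof -
  let ?f = "\<lambda>(e :: 'e, z :: complex ^ 3). (e, coset z)"
  \<comment> \<open>The product of a quotient map with an identity need not be a quotient map; here
    openness of the coset map secures it.\<close>
  have "quotient_map X (prod_topology E torus6) ?f"
  proof (rule continuous_open_imp_quotient_map)
    show "continuous_map X (prod_topology E torus6) ?f"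
      unfolding continuous_map_prod_top using quotient_imp_continuous_map[OF quotient_coset] by auto
    show "?f ` topspace X = topspace (prod_topology E torus6)"
      by (auto simp: topspace_torus6)
    show "open_map X (prod_topology E torus6) ?f"
      unfolding open_map_def openin_prod_topology_alt[of E torus6]
    proof (intro allI impI)
      fix U e C assume U: "openin X U" and "(e, C) \<in> ?f ` U"
      then obtain z where z: "(e, z) \<in> U" "C = coset z" by auto
      obtain V W where VW: "openin E V" "open W" "e \<in> V" "z \<in> W" "V \<times> W \<subseteq> U"
        using U z(1) unfolding openin_prod_topology_alt by force
      have "V \<times> coset ` W \<subseteq> ?f ` U"
      proof
        fix y assume "y \<in> V \<times> coset ` W"
        then obtain v w where "y = (v, coset w)" "v \<in> V" "w \<in> W" by auto
        then show "y \<in> ?f ` U" using VW(5) by (intro image_eqI[of _ _ "(v, w)"]) auto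
      qed
      then show "\<exists>V W. openin E V \<and> openin torus6 W \<and> e \<in> V \<and> C \<in> W \<and> V \<times> W \<subseteq> ?f ` U"
        using VW z open_coset by (intro exI[of _ V] exI[of _ "coset ` W"]) auto
    qed
  qed
  moreover have "quotient_map (prod_topology E torus6) B (orbit Z4 diag)"
    unfolding borel_construction_def by (rule quotient_map_orbit)
  ultimately have "quotient_map X B (orbit Z4 diag \<circ> ?f)" by (rule quotient_map_compose)
  moreover have "orbit Z4 diag \<circ> ?f = pr" by (auto simp: pr_def fun_eq_iff)
  ultimately show ?thesis by simp
qed

lemma even_cover:
  assumes "x \<in> topspace X"
  shows "\<exists>U. openin X U \<and> x \<in> U \<and> (\<forall>g\<in>{..<4} \<times> UNIV. \<forall>y\<in>U. actX g y \<in> U \<longrightarrow> g = (0, 0))"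
proof -
  obtain e z where x: "x = (e, z)" "e \<in> topspace E" using assms by auto
  \<comment> \<open>The Hausdorff property separates e from its image under k and yields a
    neighbourhood of e that k moves off itself. Intersecting over k = 1, 2, 3 excludes the
    nontrivial rotations; the ball of radius 1/2 below excludes the nontrivial translations.\<close>
  have "\<exists>V. openin E V \<and> e \<in> V \<and> (\<forall>d\<in>V. \<epsilon> (int k) d \<notin> V)" if k: "k \<in> {1..<4}" for k
  proof -
    have kc: "int k \<in> carrier Z4" using k by (simp add: carrier_integer_mod_group)
    have "\<epsilon> (int k) e \<noteq> \<epsilon> 0 e" using eps_free[OF x(2) kc, of 0] k by auto
    then have "\<epsilon> (int k) e \<noteq> e" using eps_0 x by simp
    then obtain P Q where PQ: "openin E P" "openin E Q" "e \<in> P" "\<epsilon> (int k) e \<in> Q" "disjnt P Q"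
      using EG_facts(1) x(2) eps_in[OF kc x(2)] unfolding Hausdorff_space_def by metis
    have "openin E (P \<inter> {d \<in> topspace E. \<epsilon> (int k) d \<in> Q})"
      by (intro openin_Int PQ openin_continuous_map_preimage[OF EG_facts(5)[OF kc]])
    then show ?thesis using PQ x(2) by (intro exI[of _ "P \<inter> {d \<in> topspace E. \<epsilon> (int k) d \<in> Q}"]) (auto simp: disjnt_iff)
  qed
  then obtain V where V: "\<And>k. k \<in> {1..<4} \<Longrightarrow> openin E (V k)" "\<And>k. k \<in> {1..<4} \<Longrightarrow> e \<in> V k"
     "\<And>k d. k \<in> {1..<4} \<Longrightarrow> d \<in> V k \<Longrightarrow> \<epsilon> (int k) d \<notin> V k" by metis
  define V0 where "V0 = (\<Inter>k\<in>{1..<4::nat}. V k)"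
  have V0: "openin E V0" "e \<in> V0" "V0 \<subseteq> topspace E"
    unfolding V0_def using V(1,2) openin_subset[OF V(1)[of 1]] by (auto intro!: openin_INT2 V(1)) 
  let ?U = "V0 \<times> ball z (1/2)"
  have "openin X ?U" using V0(1) by (simp add: openin_prod_Times_iff)
  moreover have "x \<in> ?U" using V0(2) x by simp
  moreover have "\<forall>g\<in>{..<4} \<times> UNIV. \<forall>y\<in>?U. actX g y \<in> ?U \<longrightarrow> g = (0, 0)"
  proof (intro ballI impI)
    fix g y assume g: "g \<in> {..<4} \<times> UNIV" and y: "y \<in> ?U" and gy: "actX g y \<in> ?U"
    obtain k m where km: "g = (k, m)" "k < 4" using g by auto
    obtain d w where y': "y = (d, w)" "d \<in> V0" "w \<in> ball z (1/2)" using y by auto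
    have d: "d \<in> topspace E" using y' V0 by auto
    have act: "actX g y = (\<epsilon> (int k) d, (tau ^^ k) (w + lattice_point m))"
      using actX_simp[OF d km(2)] by (simp add: km y')
    have "k = 0"
    proof (rule ccontr)
      assume "k \<noteq> 0"
      then have "k \<in> {1..<4}" using km by auto
      then show False using V(3)[of k d] y'(2) gy act by (auto simp: V0_def)
    qed
    then have w': "w + lattice_point m \<in> ball z (1/2)" using gy act by simp
    have "norm (lattice_point m) = dist w (w + lattice_point m)" by (simp add: dist_norm)
    also have "\<dots> \<le> dist w z + dist z (w + lattice_point m)" by (rule dist_triangle)
    also have "\<dots> < 1" using w' y'(3) by (simp add: dist_commute)
    finally have "m = 0" by (rule lattice_point_small)
    then show "g = (0, 0)" using km \<open>k = 0\<close> by simp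
  qed
  ultimately show ?thesis by (intro exI[of _ ?U] conjI)
qed

sublocale cover: free_quotient X B pr "{..<4} \<times> UNIV" actX "(0, 0)"
proof
  show "actX (0, 0) x = x" for x by (simp add: actX_def trX_0)
  show "openin X (actX g ` U)" if "openin X U" for g U by (rule actX_open[OF that])
qed (simp_all only: quotient_pr actX_cont even_cover pr_eq_iff, simp_all)

text \<open>Freeness of the action: both components of a normal form can be recovered. It gives the
  uniqueness of \<open>simplex_elt\<close>.\<close>

lemma actX_inj:
  assumes "x \<in> topspace X" "g \<in> {..<4} \<times> UNIV" "h \<in> {..<4} \<times> UNIV" "actX g x = actX h x"
  shows "g = h"
proof -
  obtain e z where x: "x = (e, z)" "e \<in> topspace E" using assms by auto
  obtain k m where g: "g = (k, m)" "k < 4" using assms(2) by auto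
  obtain l n where h: "h = (l, n)" "l < 4" using assms(3) by auto
  have eq: "\<epsilon> (int k) e = \<epsilon> (int l) e" "(tau ^^ k) (z + lattice_point m) = (tau ^^ l) (z + lattice_point n)"
    using assms(4) by (simp_all add: x g h actX_simp)
  have kl: "k = l" using eps_free[OF x(2) Z4_mem[OF g(2)] Z4_mem[OF h(2)] eq(1)] by simp
  then have "z + lattice_point m = z + lattice_point n" using eq(2) tau_funpow_inj by blast
  then show ?thesis using kl by (simp add: g h inj_lattice_point)
qed

end

section \<open>The singular resolution\<close>

lemma chain_boundary_extend:
  "frag_extend (\<lambda>s. chain_boundary n (frag_of s)) c = chain_boundary n c"
  by (rule frag_induction[OF subset_UNIV, where c = c]) (simp_all add: frag_extend_diff chain_boundary_diff)

lemma chain_map_extend: "frag_extend (\<lambda>s. frag_of (simplex_map n g s)) c = chain_map n g c"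
  by (simp add: chain_map_def o_def)

text \<open>The identity is homotopic to a constant map, so c is homologous to its image under that
  map. In positive degree this image is a cycle in a one-point space, hence a boundary; in degree 0
  it is a multiple of one simplex, the factor being the augmentation of c.\<close>

lemma contractible_cycle_is_boundary:
  assumes X: "contractible_space X" and ne: "topspace X \<noteq> {}" and c: "singular_chain n X c"
    and cyc: "chain_boundary n c = 0" "n = 0 \<Longrightarrow> augm c = 0"
  shows "\<exists>y. singular_chain (Suc n) X y \<and> chain_boundary (Suc n) y = c"
proof -
  have "X \<noteq> trivial_topology" using ne by auto
  then obtain a where a: "a \<in> topspace X" "homotopic_with (\<lambda>x. True) X X id (\<lambda>x. a)"
    using X unfolding contractible_space by blast
  have hom: "homotopic_with (\<lambda>h. h \<in> {} \<rightarrow> {}) X X id (\<lambda>x. a)"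
    using a(2) by (rule homotopic_with_mono) auto
  have rc: "singular_relcycle n X {} c" using c cyc by (simp add: singular_cycle)
  have "homologous_rel n X {} (chain_map n id c) (chain_map n (\<lambda>x. a) c)"
    by (rule homotopic_imp_homologous_rel_chain_maps[OF hom rc])
  then have h: "singular_relboundary n X {} (c - chain_map n (\<lambda>x. a) c)"
    by (simp add: homologous_rel_def chain_map_ident[OF c])
  have "singular_relboundary n X {} (chain_map n (\<lambda>x. a) c)"
  proof (cases "n = 0")
    case True
    have "chain_map n (\<lambda>x. a) c = frag_extend (\<lambda>_. frag_of (restrict (\<lambda>x. a) (standard_simplex n))) c"
      unfolding chain_map_def by (simp add: simplex_map_def o_def)
    also have "\<dots> = 0" by (subst extend_const) (simp add: cyc(2)[OF True])
    finally show ?thesis by simp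
  next
    case False
    have "continuous_map X (subtopology X {a}) (\<lambda>x. a)" using a(1) by (auto simp: continuous_map_in_subtopology)
    then have "singular_relcycle n (subtopology X {a}) {} (chain_map n (\<lambda>x. a) c)"
      by (intro singular_relcycle_chain_map[OF rc]) auto
    then have "singular_relboundary n (subtopology X {a}) {} (chain_map n (\<lambda>x. a) c)"
      using singular_boundary_eq_cycle_singleton[of "subtopology X {a}" a n] a(1) False by (simp add: Int_absorb1)
    then have "singular_relboundary n (subtopology X (topspace X)) {} (chain_map n (\<lambda>x. a) c)"
      by (rule singular_boundary_mono[rotated]) (use a(1) in auto)
    then show ?thesis by simp
  qed
  from singular_relboundary_add[OF h this] have "singular_relboundary n X {} c" by simp
  then show ?thesis by (simp add: singular_boundary)
qed

context borel_cover
begin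

abbreviation "G \<equiv> {..<4::nat} \<times> (UNIV :: lattice set)"

definition lift_simplex :: "nat \<Rightarrow> ((nat \<Rightarrow> real) \<Rightarrow> ('e \<times> (complex ^ 3) set) set) \<Rightarrow> (nat \<Rightarrow> real) \<Rightarrow> 'e \<times> (complex ^ 3)"
  where "lift_simplex n t = (SOME s. singular_simplex n X s \<and> simplex_map n pr s = t)"

text \<open>The group element that carries the chosen lift of the projected simplex to s. It exists
  by \<open>singular_simplex_orbit\<close> and is unique by freeness.\<close>

definition simplex_elt :: "nat \<Rightarrow> ((nat \<Rightarrow> real) \<Rightarrow> 'e \<times> (complex ^ 3)) \<Rightarrow> nat \<times> lattice"
  where "simplex_elt n s = (SOME g. g \<in> G \<and> s = simplex_map n (actX g) (lift_simplex n (simplex_map n pr s)))"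

lemma lift_simplex:
  assumes "singular_simplex n B t"
  shows "singular_simplex n X (lift_simplex n t)" "simplex_map n pr (lift_simplex n t) = t"
  using someI_ex[OF cover.singular_simplex_lifts[OF assms]] by (simp_all add: lift_simplex_def)

lemma pr_simplex: "singular_simplex n X s \<Longrightarrow> singular_simplex n B (simplex_map n pr s)"
  by (rule singular_simplex_simplex_map[OF _ cover.p_cont])

lemma simplex_elt:
  assumes s: "singular_simplex n X s"
  shows "simplex_elt n s \<in> G" "s = simplex_map n (actX (simplex_elt n s)) (lift_simplex n (simplex_map n pr s))"
proof -
  note l = lift_simplex[OF pr_simplex[OF s]]
  have "\<exists>g. g \<in> G \<and> s = simplex_map n (actX g) (lift_simplex n (simplex_map n pr s))"
    using cover.singular_simplex_orbit[OF l(1) s l(2)] by blast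
  then have "simplex_elt n s \<in> G \<and> s = simplex_map n (actX (simplex_elt n s)) (lift_simplex n (simplex_map n pr s))"
    unfolding simplex_elt_def by (rule someI_ex)
  then show "simplex_elt n s \<in> G" "s = simplex_map n (actX (simplex_elt n s)) (lift_simplex n (simplex_map n pr s))"
    by blast+
qed

lemma simplex_elt_unique:
  assumes s: "singular_simplex n X s" and g: "g \<in> G"
    and eq: "s = simplex_map n (actX g) (lift_simplex n (simplex_map n pr s))"
  shows "simplex_elt n s = g"
proof -
  obtain v where v: "v \<in> standard_simplex n" using nonempty_standard_simplex[of n] by auto
  let ?l = "lift_simplex n (simplex_map n pr s)"
  have "?l v \<in> topspace X"
    using lift_simplex(1)[OF pr_simplex[OF s]] v by (auto simp: singular_simplex_def continuous_map_def)
  moreover have "s v = actX g (?l v)"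
    using fun_cong[OF eq, of v] v by (simp add: simplex_map_def)
  moreover have "s v = actX (simplex_elt n s) (?l v)"
    using fun_cong[OF simplex_elt(2)[OF s], of v] v by (simp add: simplex_map_def)
  ultimately show ?thesis using actX_inj[OF _ simplex_elt(1)[OF s] g] by metis
qed

lemma actX_rot:
  assumes "x \<in> topspace X" "k < 4"
  shows "rotX (actX (k, m) x) = actX ((k + 1) mod 4, m) x"
proof (cases "k = 3")
  case True
  have "trX m x \<in> topspace X" using trX_cont[of m] assms(1) unfolding continuous_map_def by blast
  then show ?thesis using rotX_4 by (simp add: True actX_def numeral_eq_Suc)
next
  case False
  then have "(k + 1) mod 4 = Suc k" using assms(2) by simp
  then show ?thesis by (simp add: actX_def)
qed

lemma actX_tr: "trX m' (actX (k, m) x) = actX (k, m + (untwist ^^ k) m') x"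
proof -
  have "trX m' ((rotX ^^ k) y) = (rotX ^^ k) (trX ((untwist ^^ k) m') y)" for y
    by (induction k arbitrary: m') (simp_all add: trX_rotX funpow_swap1[of untwist])
  then show ?thesis by (simp add: actX_def trX_trX add.commute)
qed

lemma pr_rotX: "x \<in> topspace X \<Longrightarrow> pr (rotX x) = pr x"
  using cover.p_act[of "(1, 0)" x] by (simp add: actX_def trX_0)

lemma pr_trX: "x \<in> topspace X \<Longrightarrow> pr (trX m x) = pr x"
  using cover.p_act[of "(0, m)" x] by (simp add: actX_def)

text \<open>Unique lifting makes the simplices of X a free set over the group, with the simplices of
  B as its orbits. No simplex goes to minus a simplex, so all signs are 1.\<close>

definition sing :: "((nat \<Rightarrow> real) \<Rightarrow> 'e \<times> (complex ^ 3), lattice, (nat \<Rightarrow> real) \<Rightarrow> ('e \<times> (complex ^ 3) set) set) gcomplex"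
  where "sing = \<lparr>cells = \<lambda>n. singular_simplex_set n X,
    bdry = \<lambda>n s. chain_boundary n (frag_of s),
    rot = \<lambda>n s. frag_of (simplex_map n rotX s),
    transl = \<lambda>n m s. frag_of (simplex_map n (trX m) s),
    orbs = \<lambda>n. singular_simplex_set n B,
    lift = lift_simplex,
    orb = \<lambda>n s. simplex_map n pr s,
    rexp = \<lambda>n s. fst (simplex_elt n s),
    shft = \<lambda>n s. snd (simplex_elt n s),
    csgn = \<lambda>n s. 1\<rparr>"

lemma sing_sel:
  "cells sing n = singular_simplex_set n X" "bdry sing n = (\<lambda>s. chain_boundary n (frag_of s))"
  "rot sing n = (\<lambda>s. frag_of (simplex_map n rotX s))" "transl sing n m = (\<lambda>s. frag_of (simplex_map n (trX m) s))"
  "orbs sing n = singular_simplex_set n B" "lift sing n t = lift_simplex n t" "orb sing n s = simplex_map n pr s"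
  "rexp sing n s = fst (simplex_elt n s)" "shft sing n s = snd (simplex_elt n s)" "csgn sing n s = 1"
  by (simp_all add: sing_def)

lemma chains_sing: "c \<in> chains sing n \<longleftrightarrow> singular_chain n X c"
  by (simp add: chains_def sing_sel singular_chain_def)

lemma contractible_X: "contractible_space X"
  using EG_facts(3) contractible_space_top_of_set[of "UNIV :: (complex ^ 3) set"]
  by (simp add: contractible_space_prod_topology)

lemma nonempty_X: "topspace X \<noteq> {}"
  using EG_facts(2) by simp

lemma resolution_sing: "resolution sing untwist"
proof
  fix s n assume "s \<in> cells sing (Suc n)"
  then have c: "singular_chain (Suc n) X (frag_of s)" by (simp add: sing_sel singular_chain_of)
  show "bdry sing (Suc n) s \<in> chains sing n"
    using singular_chain_boundary[OF c] by (simp add: chains_sing sing_sel)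
  show "frag_extend (bdry sing (Suc n)) (rot sing (Suc n) s) = frag_extend (rot sing n) (bdry sing (Suc n) s)"
    using chain_boundary_chain_map[OF c, of rotX] by (simp add: sing_sel chain_map_extend)
  show "frag_extend (bdry sing (Suc n)) (transl sing (Suc n) m s) = frag_extend (transl sing n m) (bdry sing (Suc n) s)" for m
    using chain_boundary_chain_map[OF c, of "trX m"] by (simp add: sing_sel chain_map_extend)
next
  fix s n assume "s \<in> cells sing (Suc (Suc n))"
  then have c: "singular_chain (Suc (Suc n)) X (frag_of s)" by (simp add: sing_sel singular_chain_of)
  show "frag_extend (bdry sing (Suc n)) (bdry sing (Suc (Suc n)) s) = 0"
    using chain_boundary_boundary_alt[OF c] by (simp add: sing_sel chain_boundary_extend)
next
  fix s assume "s \<in> cells sing 1"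
  show "augm (bdry sing 1 s) = 0"
    by (simp add: sing_sel chain_boundary_of augm_def frag_extend_diff frag_extend_add frag_extend_minus)
next
  fix c n assume c: "c \<in> chains sing (Suc n)" "frag_extend (bdry sing (Suc n)) c = 0"
  have "chain_boundary (Suc n) c = 0" using c(2) unfolding sing_sel by (simp only: chain_boundary_extend)
  then have "\<exists>y. singular_chain (Suc (Suc n)) X y \<and> chain_boundary (Suc (Suc n)) y = c"
    using contractible_cycle_is_boundary[OF contractible_X nonempty_X] c by (simp add: chains_sing)
  then show "\<exists>y\<in>chains sing (Suc (Suc n)). frag_extend (bdry sing (Suc (Suc n))) y = c"
    unfolding sing_sel by (simp only: chain_boundary_extend chains_sing Bex_def)
next
  fix c assume c: "c \<in> chains sing 0" "augm c = 0"
  have "\<exists>y. singular_chain (Suc 0) X y \<and> chain_boundary (Suc 0) y = c"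
    by (rule contractible_cycle_is_boundary[OF contractible_X nonempty_X])
       (use c in \<open>simp_all add: chains_sing chain_boundary_def\<close>)
  then show "\<exists>y\<in>chains sing 1. frag_extend (bdry sing 1) y = c"
    unfolding sing_sel by (simp only: chain_boundary_extend chains_sing Bex_def One_nat_def)
next
  obtain x where "x \<in> topspace X" using nonempty_X by blast
  then have "singular_simplex 0 X (restrict (\<lambda>_. x) (standard_simplex 0))"
    unfolding singular_simplex_def by (auto intro: continuous_map_eq[where f = "\<lambda>_. x"])
  then show "cells sing 0 \<noteq> {}" by (auto simp: sing_sel)
next
  fix s assume "s \<in> cells sing 0"
  show "augm (rot sing 0 s) = frag_of ()" by (simp add: sing_sel augm_def)
  show "augm (transl sing 0 m s) = frag_of ()" for m by (simp add: sing_sel augm_def)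
next
  fix t n assume "t \<in> orbs sing n"
  then have t: "singular_simplex n B t" by (simp add: sing_sel)
  note l = lift_simplex[OF t]
  show "lift sing n t \<in> cells sing n" "orb sing n (lift sing n t) = t" "csgn sing n (lift sing n t) = 1"
    using l by (simp_all add: sing_sel)
  \<comment> \<open>The chosen lift is its own representative, so uniqueness forces the trivial
    element.\<close>
  have "simplex_elt n (lift_simplex n t) = (0, 0)"
  proof (rule simplex_elt_unique[OF l(1)])
    show "lift_simplex n t = simplex_map n (actX (0, 0)) (lift_simplex n (simplex_map n pr (lift_simplex n t)))"
      unfolding l(2) by (rule sym, rule simplex_map_id_gen[OF l(1)]) (simp add: actX_def trX_0)
  qed simp
  then show "rexp sing n (lift sing n t) = 0" "shft sing n (lift sing n t) = 0"
    by (simp_all add: sing_sel)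
next
  fix s n assume "s \<in> cells sing n"
  then have s: "singular_simplex n X s" by (simp add: sing_sel)
  note l = lift_simplex[OF pr_simplex[OF s]]
  obtain k m where km: "simplex_elt n s = (k, m)" "k < 4" using simplex_elt(1)[OF s] by auto
  have s_eq: "s = simplex_map n (actX (k, m)) (lift_simplex n (simplex_map n pr s))"
    using simplex_elt(2)[OF s] by (simp add: km)
  show "orb sing n s \<in> orbs sing n" using pr_simplex[OF s] by (simp add: sing_sel)
  show "rexp sing n s < 4" using km by (simp add: sing_sel)
  have word: "(frag_extend (rot sing n) ^^ j) (frag_of r) = frag_of (((simplex_map n rotX) ^^ j) r)" for j r
    by (induction j) (simp_all add: sing_sel)
  have pow: "((simplex_map n rotX) ^^ j) (simplex_map n f r) = simplex_map n ((rotX ^^ j) \<circ> f) r" for j f r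
  proof (induction j)
    case (Suc j)
    then show ?case by simp (simp add: simplex_map_def fun_eq_iff)
  qed simp
  have self: "simplex_map n (\<lambda>x. x) s = s" by (rule simplex_map_id_gen[OF s]) simp
  show "(frag_extend (rot sing n) ^^ 4) (frag_of s) = frag_of s"
    unfolding word using pow[of 4 "\<lambda>x. x" s] simplex_map_id_gen[OF s, of "rotX ^^ 4 \<circ> (\<lambda>x. x)"] rotX_4
    by (simp add: self funpow_4)
  show "transl sing n 0 s = frag_of s"
    using simplex_map_id_gen[OF s, of "trX 0"] by (simp add: sing_sel trX_0)
  show "frag_extend (transl sing n m) (transl sing n m' s) = transl sing n (m + m') s" for m m'
    by (simp add: sing_sel simplex_map_def trX_trX frag_of_eq fun_eq_iff)
  show "frag_extend (transl sing n m) (rot sing n s) = frag_extend (rot sing n) (transl sing n (untwist m) s)" for m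
    by (simp add: sing_sel simplex_map_def trX_rotX frag_of_eq fun_eq_iff)
  show "frag_of s = frag_cmul (csgn sing n s)
            (act_word sing n (rexp sing n s) (shft sing n s) (frag_of (lift sing n (orb sing n s))))"
  proof -
    have "act_word sing n k m (frag_of (lift_simplex n (simplex_map n pr s))) =
       frag_of (simplex_map n ((rotX ^^ k) \<circ> trX m) (lift_simplex n (simplex_map n pr s)))"
      by (simp add: word pow sing_sel(4))
    also have "(rotX ^^ k) \<circ> trX m = actX (k, m)" by (auto simp: actX_def)
    finally show ?thesis using s_eq by (simp add: sing_sel(6-10) km)
  qed
  have sub: "simplex_map n g (simplex_map n (actX (k, m)) r) = simplex_map n (\<lambda>x. g (actX (k, m) x)) r" for g r
    by (simp add: simplex_map_def fun_eq_iff)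
  show "\<exists>e s'. e * e = 1 \<and> s' \<in> cells sing n \<and>
          rot sing n s = frag_cmul e (frag_of s') \<and> orb sing n s' = orb sing n s \<and>
          rexp sing n s' = (rexp sing n s + 1) mod 4 \<and> shft sing n s' = shft sing n s \<and>
          csgn sing n s' = e * csgn sing n s"
  proof -
    let ?s = "simplex_map n rotX s"
    have s': "singular_simplex n X ?s" by (rule singular_simplex_simplex_map[OF s rotX_cont])
    have o: "simplex_map n pr ?s = simplex_map n pr s"
    proof -
      have "simplex_map n pr ?s = simplex_map n (\<lambda>x. pr (rotX x)) s" by (simp add: simplex_map_def fun_eq_iff)
      also have "\<dots> = simplex_map n pr s" by (rule simplex_map_eq[OF s]) (rule pr_rotX)
      finally show ?thesis .
    qed
    have "simplex_elt n ?s = ((k + 1) mod 4, m)"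
    proof (rule simplex_elt_unique[OF s'])
      show "?s = simplex_map n (actX ((k + 1) mod 4, m)) (lift_simplex n (simplex_map n pr ?s))"
        unfolding o by (subst s_eq, subst sub, rule simplex_map_eq[OF l(1)]) (rule actX_rot[OF _ km(2)])
    qed simp
    then show ?thesis
      by (intro exI[of _ 1] exI[of _ ?s]) (simp add: sing_sel s' o km)
  qed
  show "\<exists>s'. s' \<in> cells sing n \<and>
          transl sing n m' s = frag_of s' \<and> orb sing n s' = orb sing n s \<and>
          rexp sing n s' = rexp sing n s \<and> shft sing n s' = shft sing n s + (untwist ^^ rexp sing n s) m' \<and>
          csgn sing n s' = csgn sing n s" for m'
  proof -
    let ?s = "simplex_map n (trX m') s"
    have s': "singular_simplex n X ?s" by (rule singular_simplex_simplex_map[OF s trX_cont])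
    have o: "simplex_map n pr ?s = simplex_map n pr s"
    proof -
      have "simplex_map n pr ?s = simplex_map n (\<lambda>x. pr (trX m' x)) s" by (simp add: simplex_map_def fun_eq_iff)
      also have "\<dots> = simplex_map n pr s" by (rule simplex_map_eq[OF s]) (rule pr_trX)
      finally show ?thesis .
    qed
    have "simplex_elt n ?s = (k, m + (untwist ^^ k) m')"
    proof (rule simplex_elt_unique[OF s'])
      show "?s = simplex_map n (actX (k, m + (untwist ^^ k) m')) (lift_simplex n (simplex_map n pr ?s))"
        unfolding o by (subst s_eq, subst sub, rule simplex_map_eq[OF l(1)]) (rule actX_tr)
    qed (simp add: km(2))
    then show ?thesis
      by (intro exI[of _ ?s]) (simp add: sing_sel s' o km)
  qed
qed

text \<open>The projection commutes with boundaries, so in positive degrees the boundary on orbits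
  is the singular one of B.\<close>

lemma orbit_bdry_sing:
  assumes "singular_simplex (Suc n) B t"
  shows "orbit_bdry sing (Suc n) t = chain_boundary (Suc n) (frag_of t)"
proof -
  note l = lift_simplex[OF assms]
  have "proj sing n = (\<lambda>s. frag_of (simplex_map n pr s))"
    by (simp add: proj_def sing_sel fun_eq_iff)
  then have "orbit_bdry sing (Suc n) t = chain_map n pr (chain_boundary (Suc n) (frag_of (lift_simplex (Suc n) t)))"
    by (simp add: orbit_bdry_def descend_def sing_sel chain_map_extend)
  also have "\<dots> = chain_boundary (Suc n) (frag_of t)"
    using chain_boundary_chain_map[of "Suc n" X "frag_of (lift_simplex (Suc n) t)" pr] l by (simp add: singular_chain_of)
  finally show ?thesis .
qed

lemma orbit_chains_sing: "c \<in> orbit_chains sing n \<longleftrightarrow> singular_chain n B c"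
  by (simp add: orbit_chains_def sing_sel singular_chain_def)

end

text \<open>The cells \<open>(i, I)\<close> of degree \<open>n\<close> of the finite complex computing the homology of the Borel
  construction: \<open>I\<close> indexes the cells of the torus, \<open>i\<close> those of the periodic resolution.\<close>

definition fcells :: "nat \<Rightarrow> (nat \<times> bits) set"
  where "fcells n = {(i, I). i + bdeg I = n}"

text \<open>The orbit boundary of \<open>cub\<close> in closed form: t - 1 in odd and the norm in
  even positive cyclic degree, with t acting by the signed swap.\<close>

definition fdiff :: "nat \<times> bits \<Rightarrow> nat \<times> bits \<Rightarrow>\<^sub>0 int"
  where "fdiff = (\<lambda>(i, I).
     if i = 0 then 0
     else if odd i then frag_cmul (bsgn I) (frag_of (i - 1, bswap I)) - frag_of (i - 1, I)
     else frag_of (i - 1, I) + frag_cmul (bsgn I) (frag_of (i - 1, bswap I)) +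
       frag_cmul (bsgn I * bsgn (bswap I)) (frag_of (i - 1, I)) +
       frag_cmul (bsgn I * bsgn (bswap I) * bsgn I) (frag_of (i - 1, bswap I)))"

text \<open>Comparison maps between the two resolutions in both directions, with their homotopies,
  pushed down to orbits. The facts are phrased for single simplices and cells, so that all that
  follows deals with maps on basis elements.\<close>

theorem (in borel_cover) finite_model:
  obtains f g h k where
    "\<And>n t. singular_simplex n B t \<Longrightarrow> Poly_Mapping.keys (f n t) \<subseteq> fcells n"
    "\<And>n c. c \<in> fcells n \<Longrightarrow> singular_chain n B (g n c)"
    "\<And>n t. singular_simplex n B t \<Longrightarrow> singular_chain (Suc n) B (h n t)"
    "\<And>n c. c \<in> fcells n \<Longrightarrow> Poly_Mapping.keys (k n c) \<subseteq> fcells (Suc n)"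
    "\<And>n t. singular_simplex (Suc n) B t \<Longrightarrow>
       frag_extend fdiff (f (Suc n) t) = frag_extend (f n) (chain_boundary (Suc n) (frag_of t))"
    "\<And>n c. c \<in> fcells (Suc n) \<Longrightarrow>
       chain_boundary (Suc n) (g (Suc n) c) = frag_extend (g n) (fdiff c)"
    "\<And>n t. singular_simplex (Suc n) B t \<Longrightarrow>
       chain_boundary (Suc (Suc n)) (h (Suc n) t) + frag_extend (h n) (chain_boundary (Suc n) (frag_of t)) =
       frag_extend (g (Suc n)) (f (Suc n) t) - frag_of t"
    "\<And>n c. c \<in> fcells (Suc n) \<Longrightarrow>
       frag_extend fdiff (k (Suc n) c) + frag_extend (k n) (fdiff c) =
       frag_extend (f (Suc n)) (g (Suc n) c) - frag_of c"
proof -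
  note S = resolution_sing and C = resolution_cub
  obtain f where f: "equivariant_chain_map sing cub f" using equivariant_chain_map_exists[OF S C] by blast
  obtain g where g: "equivariant_chain_map cub sing g" using equivariant_chain_map_exists[OF C S] by blast
  let ?f = "\<lambda>n. descend sing cub n n (f n)" and ?g = "\<lambda>n. descend cub sing n n (g n)"
  have fe: "equivariant sing cub n n (f n)" and ge: "equivariant cub sing n n (g n)" for n
    using f g by (simp_all add: equivariant_chain_map_def)
  have orbs: "orbs cub n = fcells n" for n by (simp add: cub_def fcells_def)
  have oc: "c \<in> orbit_chains cub n \<longleftrightarrow> Poly_Mapping.keys c \<subseteq> fcells n" for c n
    by (simp add: orbit_chains_def orbs)
  have obc: "orbit_bdry cub n = fdiff" for n
  proof
    fix c :: "nat \<times> bits"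
    obtain i I where "c = (i, I)" by (metis prod.collapse)
    then show "orbit_bdry cub n c = fdiff c"
      by (simp add: fdiff_def orbit_bdry_cub)
  qed
  have obs: "frag_extend (orbit_bdry sing (Suc n)) c = chain_boundary (Suc n) c" if "singular_chain (Suc n) B c" for n c
  proof -
    have "frag_extend (orbit_bdry sing (Suc n)) c = frag_extend (\<lambda>t. chain_boundary (Suc n) (frag_of t)) c"
      by (rule frag_extend_eq) (use that in \<open>auto simp: singular_chain_def intro!: orbit_bdry_sing\<close>)
    then show ?thesis by (simp only: chain_boundary_extend)
  qed
  have so: "t \<in> orbs sing n \<longleftrightarrow> singular_simplex n B t" for t n by (simp add: sing_sel)
  obtain h where h: "\<And>n t. t \<in> orbs sing n \<Longrightarrow> h n t \<in> orbit_chains sing (Suc n)"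
     "\<And>n t. t \<in> orbs sing (Suc n) \<Longrightarrow> frag_extend (orbit_bdry sing (Suc (Suc n))) (h (Suc n) t) +
        frag_extend (h n) (orbit_bdry sing (Suc n) t) = frag_extend (?g (Suc n)) (?f (Suc n) t) - frag_of t"
    using orbit_chains_homotopy_inverse[OF S C f g] by metis
  obtain k where k: "\<And>n t. t \<in> orbs cub n \<Longrightarrow> k n t \<in> orbit_chains cub (Suc n)"
     "\<And>n t. t \<in> orbs cub (Suc n) \<Longrightarrow> frag_extend (orbit_bdry cub (Suc (Suc n))) (k (Suc n) t) +
        frag_extend (k n) (orbit_bdry cub (Suc n) t) = frag_extend (?f (Suc n)) (?g (Suc n) t) - frag_of t"
    using orbit_chains_homotopy_inverse[OF C S g f] by metis
  have gB: "singular_chain n B (?g n c)" if "c \<in> fcells n" for n c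
    using descend_orbit_chains[OF C S ge] that orbs by (simp add: orbit_chains_sing)
  have hB: "singular_chain (Suc n) B (h n t)" if "singular_simplex n B t" for n t
    using h(1) that so by (simp add: orbit_chains_sing)
  show thesis
  proof (rule that[of ?f ?g h k])
    show "Poly_Mapping.keys (?f n t) \<subseteq> fcells n" if "singular_simplex n B t" for n t
      using descend_orbit_chains[OF S C fe] that so oc by blast
    show "frag_extend fdiff (?f (Suc n) t) = frag_extend (?f n) (chain_boundary (Suc n) (frag_of t))"
      if t: "singular_simplex (Suc n) B t" for n t
      using chain_map_descend[OF S C f, of t n] t so by (simp add: obc orbit_bdry_sing)
    show "chain_boundary (Suc n) (?g (Suc n) c) = frag_extend (?g n) (fdiff c)" if c: "c \<in> fcells (Suc n)" for n c
      using chain_map_descend[OF C S g, of c n] c orbs by (simp add: obc obs gB)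
    show "chain_boundary (Suc (Suc n)) (h (Suc n) t) + frag_extend (h n) (chain_boundary (Suc n) (frag_of t)) =
       frag_extend (?g (Suc n)) (?f (Suc n) t) - frag_of t" if t: "singular_simplex (Suc n) B t" for n t
      using h(2)[of t n] t so by (simp add: obs hB orbit_bdry_sing)
    show "frag_extend fdiff (k (Suc n) c) + frag_extend (k n) (fdiff c) =
       frag_extend (?f (Suc n)) (?g (Suc n) c) - frag_of c" if c: "c \<in> fcells (Suc n)" for n c
      using k(2)[of c n] c orbs by (simp add: obc)
    show "Poly_Mapping.keys (k n c) \<subseteq> fcells (Suc n)" if "c \<in> fcells n" for n c
      using k(1) that orbs oc by blast
  qed (use gB hB in auto)
qed

section \<open>Cohomology from the finite model\<close>

lemma frag_hom_diff:
  assumes "group A" "F \<in> hom (free_Abelian_group S) A" "Poly_Mapping.keys x \<subseteq> S" "Poly_Mapping.keys y \<subseteq> S"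
  shows "F (x - y) = F x \<otimes>\<^bsub>A\<^esub> inv\<^bsub>A\<^esub> F y"
proof -
  interpret h: group_hom "free_Abelian_group S" A F
    using assms by (simp add: group_hom_def group_hom_axioms_def)
  have "F (x - y) = F (x \<otimes>\<^bsub>free_Abelian_group S\<^esub> inv\<^bsub>free_Abelian_group S\<^esub> y)"
    using assms by simp
  also have "\<dots> = F x \<otimes>\<^bsub>A\<^esub> F (inv\<^bsub>free_Abelian_group S\<^esub> y)"
    using assms by (intro h.hom_mult h.G.inv_closed) auto
  also have "F (inv\<^bsub>free_Abelian_group S\<^esub> y) = inv\<^bsub>A\<^esub> F y"
    using assms by (intro h.hom_inv) auto
  finally show ?thesis .
qed

lemma frag_hom_add:
  assumes "F \<in> hom (free_Abelian_group S) A" "Poly_Mapping.keys x \<subseteq> S" "Poly_Mapping.keys y \<subseteq> S"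
  shows "F (x + y) = F x \<otimes>\<^bsub>A\<^esub> F y"
  using hom_mult[OF assms(1), of x y] assms by simp

lemma frag_hom_closed:
  "F \<in> hom (free_Abelian_group S) A \<Longrightarrow> Poly_Mapping.keys x \<subseteq> S \<Longrightarrow> F x \<in> carrier A"
  using hom_in_carrier[of F "free_Abelian_group S" A x] by simp

lemma frag_hom_zero:
  assumes "group A" "F \<in> hom (free_Abelian_group S) A" shows "F 0 = \<one>\<^bsub>A\<^esub>"
  using hom_one[OF assms(2) _ assms(1)] by simp

lemma frag_hom_eq:
  assumes A: "group A" and F: "F \<in> hom (free_Abelian_group S) A" "F' \<in> hom (free_Abelian_group S) A"
    and eq: "\<And>s. s \<in> S \<Longrightarrow> F (frag_of s) = F' (frag_of s)" and c: "Poly_Mapping.keys c \<subseteq> S"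
  shows "F c = F' c"
proof (rule free_Abelian_group_induct[OF c, of "\<lambda>c. F c = F' c"])
  show "F 0 = F' 0" using F by (simp add: frag_hom_zero[OF A])
  show "F (x - y) = F' (x - y)"
    if "Poly_Mapping.keys x \<subseteq> S" "Poly_Mapping.keys y \<subseteq> S" "F x = F' x" "F y = F' y" for x y
    using that F by (simp add: frag_hom_diff[OF A])
qed (rule eq)

lemma keys_extend_subset:
  "Poly_Mapping.keys c \<subseteq> S \<Longrightarrow> (\<And>s. s \<in> S \<Longrightarrow> Poly_Mapping.keys (f s) \<subseteq> T) \<Longrightarrow> Poly_Mapping.keys (frag_extend f c) \<subseteq> T"
  using keys_frag_extend[of f c] by fastforce

lemma frag_hom_extend:
  assumes F: "F \<in> hom (free_Abelian_group T) A" and f: "\<And>s. s \<in> S \<Longrightarrow> Poly_Mapping.keys (f s) \<subseteq> T"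
  shows "(\<lambda>c. F (frag_extend f c)) \<in> hom (free_Abelian_group S) A"
proof (rule homI)
  fix x y assume "x \<in> carrier (free_Abelian_group S)" "y \<in> carrier (free_Abelian_group S)"
  then have "Poly_Mapping.keys (frag_extend f x) \<subseteq> T" "Poly_Mapping.keys (frag_extend f y) \<subseteq> T"
    using keys_extend_subset[of _ S f T] f by auto
  then show "F (frag_extend f (x \<otimes>\<^bsub>free_Abelian_group S\<^esub> y)) = F (frag_extend f x) \<otimes>\<^bsub>A\<^esub> F (frag_extend f y)"
    using frag_hom_add[OF F] by (simp add: frag_extend_add)
next
  fix x assume "x \<in> carrier (free_Abelian_group S)"
  then show "F (frag_extend f x) \<in> carrier A"
    using keys_extend_subset[of x S f T] f frag_hom_closed[OF F] by auto
qed

lemma hom_mult_inv: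
  assumes "comm_group A" "group K" "F \<in> hom K A" "F' \<in> hom K A"
  shows "(\<lambda>c. F c \<otimes>\<^bsub>A\<^esub> F' c) \<in> hom K A" "(\<lambda>c. inv\<^bsub>A\<^esub> F c) \<in> hom K A"
proof -
  interpret A: comm_group A by fact
  have cl: "F x \<in> carrier A" "F' x \<in> carrier A" if "x \<in> carrier K" for x
    using assms(3,4) that by (auto simp: hom_in_carrier)
  show "(\<lambda>c. F c \<otimes>\<^bsub>A\<^esub> F' c) \<in> hom K A"
    by (rule homI) (use cl hom_mult[OF assms(3)] hom_mult[OF assms(4)] in \<open>simp_all add: A.m_ac\<close>)
  show "(\<lambda>c. inv\<^bsub>A\<^esub> F c) \<in> hom K A"
    by (rule homI) (use cl hom_mult[OF assms(3)] in \<open>simp_all add: A.inv_mult\<close>)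
qed

lemma hom_restrict: "group K \<Longrightarrow> F \<in> hom K A \<Longrightarrow> restrict F (carrier K) \<in> hom K A"
  by (rule homI) (auto simp: hom_mult hom_in_carrier group.is_monoid monoid.m_closed)

lemma hom_one_const: "group A \<Longrightarrow> (\<lambda>_. \<one>\<^bsub>A\<^esub>) \<in> hom K A"
  by (rule homI) (simp_all add: group.is_monoid)

lemma group_hom_group:
  assumes A: "comm_group A" and K: "group K"
  shows "group (hom_group K A)"
proof (rule groupI)
  interpret A: comm_group A by fact
  interpret K: group K by fact
  have cl: "f x \<in> carrier A" if "f \<in> carrier (hom_group K A)" "x \<in> carrier K" for f x
    using that by (auto simp: hom_group_def hom_in_carrier)
  show "f \<otimes>\<^bsub>hom_group K A\<^esub> g \<in> carrier (hom_group K A)"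
    if "f \<in> carrier (hom_group K A)" "g \<in> carrier (hom_group K A)" for f g
    using hom_restrict[OF K hom_mult_inv(1)[OF A K, of f g]] that by (auto simp: hom_group_def)
  show "\<one>\<^bsub>hom_group K A\<^esub> \<in> carrier (hom_group K A)"
    using hom_restrict[OF K hom_one_const[OF A.group_axioms]] by (auto simp: hom_group_def)
  show "f \<otimes>\<^bsub>hom_group K A\<^esub> g \<otimes>\<^bsub>hom_group K A\<^esub> h = f \<otimes>\<^bsub>hom_group K A\<^esub> (g \<otimes>\<^bsub>hom_group K A\<^esub> h)"
    if "f \<in> carrier (hom_group K A)" "g \<in> carrier (hom_group K A)" "h \<in> carrier (hom_group K A)" for f g h
    using cl[OF that(1)] cl[OF that(2)] cl[OF that(3)] by (auto simp: hom_group_def A.m_assoc fun_eq_iff restrict_def)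
  show "\<one>\<^bsub>hom_group K A\<^esub> \<otimes>\<^bsub>hom_group K A\<^esub> f = f" if f: "f \<in> carrier (hom_group K A)" for f
    using cl[OF f] f by (auto simp: hom_group_def fun_eq_iff restrict_def extensional_def)
  show "\<exists>g\<in>carrier (hom_group K A). g \<otimes>\<^bsub>hom_group K A\<^esub> f = \<one>\<^bsub>hom_group K A\<^esub>"
    if f: "f \<in> carrier (hom_group K A)" for f
  proof (rule bexI[of _ "restrict (\<lambda>c. inv\<^bsub>A\<^esub> f c) (carrier K)"])
    show "restrict (\<lambda>c. inv\<^bsub>A\<^esub> f c) (carrier K) \<otimes>\<^bsub>hom_group K A\<^esub> f = \<one>\<^bsub>hom_group K A\<^esub>"
      using cl[OF f] by (auto simp: hom_group_def fun_eq_iff)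
    show "restrict (\<lambda>c. inv\<^bsub>A\<^esub> f c) (carrier K) \<in> carrier (hom_group K A)"
      using hom_restrict[OF K hom_mult_inv(2)[OF A K, of f]] f by (auto simp: hom_group_def)
  qed
qed

definition finite_cocycle :: "('a, 'z) monoid_scheme \<Rightarrow> nat \<Rightarrow> ((nat \<times> bits \<Rightarrow>\<^sub>0 int) \<Rightarrow> 'a) \<Rightarrow> bool"
  where "finite_cocycle A n F \<longleftrightarrow> F \<in> hom (free_Abelian_group (fcells n)) A \<and> (\<forall>c\<in>fcells (Suc n). F (fdiff c) = \<one>\<^bsub>A\<^esub>)"

lemma fdiff_keys: "c \<in> fcells (Suc n) \<Longrightarrow> Poly_Mapping.keys (fdiff c) \<subseteq> fcells n"
proof -
  assume "c \<in> fcells (Suc n)"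
  then obtain i I where c: "c = (i, I)" "i + bdeg I = Suc n" by (auto simp: fcells_def)
  have 1: "Poly_Mapping.keys (frag_cmul k (frag_of (i - 1, J))) \<subseteq> fcells n" if "i \<noteq> 0" "bdeg J = bdeg I" for k J
    using that c keys_cmul[of k "frag_of (i - 1, J)"] by (auto simp: fcells_def)
  have 2: "Poly_Mapping.keys (x + y) \<subseteq> fcells n" "Poly_Mapping.keys (x - y) \<subseteq> fcells n"
    if "Poly_Mapping.keys x \<subseteq> fcells n" "Poly_Mapping.keys y \<subseteq> fcells n" for x y :: "nat \<times> bits \<Rightarrow>\<^sub>0 int"
    using that keys_add[of x y] keys_diff[of x y] by auto
  have 3: "Poly_Mapping.keys (frag_of (i - 1, I)) \<subseteq> fcells n" if "i \<noteq> 0"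
    using 1[OF that, of I 1] by simp
  show ?thesis
  proof (cases "i = 0")
    case True then show ?thesis by (simp add: c(1) fdiff_def)
  next
    case False
    note k = 1[OF False refl] 1[OF False bdeg_bswap] 3[OF False]
    show ?thesis
      unfolding c(1) fdiff_def split if_not_P[OF False] by (cases "odd i") (simp_all only: if_True if_False not_False_eq_True not_True_eq_False 2 k)
  qed
qed

text \<open>\<Theta> reads an element of H off the values of a cocycle on cells. The hypotheses say
  that it is multiplicative, onto, and trivial exactly on coboundaries, so it identifies the
  cohomology of the finite complex with H. Pulling singular cocycles back along g and applying
  \<Theta> transports this to the Borel construction.\<close>

theorem (in borel_cover) cohomology_iso:
  fixes A :: "('a, 'z) monoid_scheme" and H :: "('h, 'y) monoid_scheme" and \<Theta> :: "(nat \<times> bits \<Rightarrow> 'a) \<Rightarrow> 'h"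
  assumes A: "comm_group A" and H: "group H"
    and closed: "\<And>F. finite_cocycle A (Suc m) F \<Longrightarrow> \<Theta> (\<lambda>c. F (frag_of c)) \<in> carrier H"
    and mult: "\<And>F F'. finite_cocycle A (Suc m) F \<Longrightarrow> finite_cocycle A (Suc m) F' \<Longrightarrow>
       \<Theta> (\<lambda>c. F (frag_of c) \<otimes>\<^bsub>A\<^esub> F' (frag_of c)) = \<Theta> (\<lambda>c. F (frag_of c)) \<otimes>\<^bsub>H\<^esub> \<Theta> (\<lambda>c. F' (frag_of c))"
    and ext: "\<And>v w. (\<And>c. c \<in> fcells (Suc m) \<Longrightarrow> v c = w c) \<Longrightarrow> \<Theta> v = \<Theta> w"
    and surj: "\<And>y. y \<in> carrier H \<Longrightarrow> \<exists>F. finite_cocycle A (Suc m) F \<and> \<Theta> (\<lambda>c. F (frag_of c)) = y"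
    and ker: "\<And>F. finite_cocycle A (Suc m) F \<Longrightarrow> \<Theta> (\<lambda>c. F (frag_of c)) = \<one>\<^bsub>H\<^esub> \<longleftrightarrow>
       (\<exists>F'\<in>hom (free_Abelian_group (fcells m)) A. \<forall>c\<in>fcells (Suc m). F (frag_of c) = F' (fdiff c))"
  shows "singular_cohomology (Suc m) B A \<cong> H"
proof -
  interpret A: comm_group A by fact
  interpret H: group H by fact
  show ?thesis
  proof (rule finite_model)
  fix f g h k assume
    f: "\<And>n t. singular_simplex n B t \<Longrightarrow> Poly_Mapping.keys (f n t) \<subseteq> fcells n" and
    g: "\<And>n c. c \<in> fcells n \<Longrightarrow> singular_chain n B (g n c)" and
    h: "\<And>n t. singular_simplex n B t \<Longrightarrow> singular_chain (Suc n) B (h n t)" and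
    k: "\<And>n c. c \<in> fcells n \<Longrightarrow> Poly_Mapping.keys (k n c) \<subseteq> fcells (Suc n)" and
    fd: "\<And>n t. singular_simplex (Suc n) B t \<Longrightarrow>
       frag_extend fdiff (f (Suc n) t) = frag_extend (f n) (chain_boundary (Suc n) (frag_of t))" and
    gd: "\<And>n c. c \<in> fcells (Suc n) \<Longrightarrow>
       chain_boundary (Suc n) (g (Suc n) c) = frag_extend (g n) (fdiff c)" and
    hd: "\<And>n t. singular_simplex (Suc n) B t \<Longrightarrow>
       chain_boundary (Suc (Suc n)) (h (Suc n) t) + frag_extend (h n) (chain_boundary (Suc n) (frag_of t)) =
       frag_extend (g (Suc n)) (f (Suc n) t) - frag_of t" and
    kd: "\<And>n c. c \<in> fcells (Suc n) \<Longrightarrow>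
       frag_extend fdiff (k (Suc n) c) + frag_extend (k n) (fdiff c) =
       frag_extend (f (Suc n)) (g (Suc n) c) - frag_of c"
  let ?n = "Suc m"
  define CG where "CG n = chain_group n B" for n
  have CG: "CG n = free_Abelian_group (singular_simplex_set n B)" for n
    by (simp add: CG_def chain_group_def)
  have sc: "singular_chain n B c \<longleftrightarrow> Poly_Mapping.keys c \<subseteq> singular_simplex_set n B" for n c
    by (simp add: singular_chain_def)
  have Ag: "group A" by (rule A.group_axioms)
  let ?K = "(cochain_group ?n B A)\<lparr>carrier := cocycles ?n B A\<rparr>"
  have coch: "cochain_group n B A = hom_group (CG n) A" for n
    by (simp add: cochain_group_def CG_def)
  have grp: "group (hom_group (CG n) A)" for n
    by (rule group_hom_group[OF A]) (simp add: CG)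
  have cocyc: "u \<in> cocycles ?n B A \<longleftrightarrow> u \<in> hom (CG ?n) A \<and> u \<in> extensional (carrier (CG ?n)) \<and>
     (\<forall>c. singular_chain (Suc ?n) B c \<longrightarrow> u (chain_boundary (Suc ?n) c) = \<one>\<^bsub>A\<^esub>)" for u
    by (auto simp: cocycles_def coch hom_group_def cochain_coboundary_def CG_def fun_eq_iff restrict_def)
  have bd: "singular_chain n B (chain_boundary (Suc n) c)" if "singular_chain (Suc n) B c" for n c
    using singular_chain_boundary[OF that] by simp
  have sub: "subgroup (cocycles ?n B A) (cochain_group ?n B A)"
  proof -
    interpret hg: group "hom_group (CG ?n) A" by (rule grp)
    have inside: "chain_boundary (Suc ?n) c \<in> carrier (CG ?n)" if "singular_chain (Suc ?n) B c" for c
      using bd[OF that] by (simp add: CG_def)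
    have C: "u \<in> cocycles ?n B A \<longleftrightarrow> u \<in> carrier (hom_group (CG ?n) A) \<and>
       (\<forall>c. singular_chain (Suc ?n) B c \<longrightarrow> u (chain_boundary (Suc ?n) c) = \<one>\<^bsub>A\<^esub>)" for u
      unfolding cocyc by (auto simp: hom_group_def)
    show ?thesis
      unfolding coch
    proof (rule hg.subgroupI)
      show "cocycles ?n B A \<subseteq> carrier (hom_group (CG ?n) A)" using C by blast
      have "\<one>\<^bsub>hom_group (CG ?n) A\<^esub> \<in> cocycles ?n B A"
        unfolding C using hg.one_closed inside by (auto simp: hom_group_def)
      then show "cocycles ?n B A \<noteq> {}" by blast
      fix u assume u: "u \<in> cocycles ?n B A"
      have uc: "u \<in> carrier (hom_group (CG ?n) A)" using u C by blast
      have "inv\<^bsub>hom_group (CG ?n) A\<^esub> u \<in> carrier (hom_group (CG ?n) A)" using uc by simp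
      moreover have "(inv\<^bsub>hom_group (CG ?n) A\<^esub> u) (chain_boundary (Suc ?n) c) = \<one>\<^bsub>A\<^esub>" if c: "singular_chain (Suc ?n) B c" for c
      proof -
        have "(inv\<^bsub>hom_group (CG ?n) A\<^esub> u \<otimes>\<^bsub>hom_group (CG ?n) A\<^esub> u) (chain_boundary (Suc ?n) c) = \<one>\<^bsub>A\<^esub>"
          using hg.l_inv[OF uc] inside[OF c] by (simp add: hom_group_def)
        moreover have "(inv\<^bsub>hom_group (CG ?n) A\<^esub> u) (chain_boundary (Suc ?n) c) \<in> carrier A"
          using \<open>inv\<^bsub>hom_group (CG ?n) A\<^esub> u \<in> carrier (hom_group (CG ?n) A)\<close> inside[OF c]
          by (auto simp: hom_group_def hom_in_carrier)
        moreover have "u (chain_boundary (Suc ?n) c) = \<one>\<^bsub>A\<^esub>" using u c by (simp add: C)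
        ultimately show ?thesis
          using inside[OF c] by (simp add: hom_group_def)
      qed
      ultimately show "inv\<^bsub>hom_group (CG ?n) A\<^esub> u \<in> cocycles ?n B A" unfolding C by blast
    next
      fix u v assume u: "u \<in> cocycles ?n B A" and v: "v \<in> cocycles ?n B A"
      have "u \<otimes>\<^bsub>hom_group (CG ?n) A\<^esub> v \<in> carrier (hom_group (CG ?n) A)" using u v C by auto
      moreover have "(u \<otimes>\<^bsub>hom_group (CG ?n) A\<^esub> v) (chain_boundary (Suc ?n) c) = \<one>\<^bsub>A\<^esub>" if c: "singular_chain (Suc ?n) B c" for c
        using u v c inside[OF c] by (simp add: C) (simp add: hom_group_def)
      ultimately show "u \<otimes>\<^bsub>hom_group (CG ?n) A\<^esub> v \<in> cocycles ?n B A" unfolding C by blast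
    qed
  qed
  have gK: "group ?K"
    using group.subgroup_imp_group[OF _ sub] grp by (simp add: coch)
  define pull where "pull u = (\<lambda>x. u (frag_extend (g ?n) x))" for u :: "_ \<Rightarrow> 'a"
  have pull: "finite_cocycle A ?n (pull u)" if u: "u \<in> cocycles ?n B A" for u
    unfolding finite_cocycle_def
  proof
    show "pull u \<in> hom (free_Abelian_group (fcells ?n)) A"
      unfolding pull_def by (rule frag_hom_extend[where T = "singular_simplex_set ?n B"])
         (use u g cocyc in \<open>auto simp: CG sc\<close>)
    show "\<forall>c\<in>fcells (Suc ?n). pull u (fdiff c) = \<one>\<^bsub>A\<^esub>"
      using u g by (simp add: pull_def gd[symmetric] cocyc)
  qed
  have pull_of: "pull u (frag_of c) = u (g ?n c)" for u c by (simp add: pull_def)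
  define \<Phi> where "\<Phi> u = \<Theta> (\<lambda>c. pull u (frag_of c))" for u
  have g_in: "g ?n c \<in> carrier (CG ?n)" if "c \<in> fcells ?n" for c
    using g[OF that] by (simp add: CG_def)
  have hom\<Phi>: "\<Phi> \<in> hom ?K H"
  proof (rule homI)
    fix u assume "u \<in> carrier ?K"
    then show "\<Phi> u \<in> carrier H" unfolding \<Phi>_def by (intro closed pull) simp
  next
    fix u v assume uv: "u \<in> carrier ?K" "v \<in> carrier ?K"
    have "\<Phi> (u \<otimes>\<^bsub>?K\<^esub> v) = \<Theta> (\<lambda>c. pull u (frag_of c) \<otimes>\<^bsub>A\<^esub> pull v (frag_of c))"
      unfolding \<Phi>_def by (rule ext) (simp add: pull_of coch hom_group_def g_in)
    also have "\<dots> = \<Phi> u \<otimes>\<^bsub>H\<^esub> \<Phi> v"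
      unfolding \<Phi>_def by (rule mult) (use uv pull in auto)
    finally show "\<Phi> (u \<otimes>\<^bsub>?K\<^esub> v) = \<Phi> u \<otimes>\<^bsub>H\<^esub> \<Phi> v" .
  qed
  interpret P: group_hom ?K H \<Phi>
    using gK H hom\<Phi> by (simp add: group_hom_def group_hom_axioms_def)
  have onto: "\<Phi> ` carrier ?K = carrier H"
  proof
    show "\<Phi> ` carrier ?K \<subseteq> carrier H" using hom\<Phi> by (auto simp: hom_in_carrier)
    show "carrier H \<subseteq> \<Phi> ` carrier ?K"
    proof
      fix y assume "y \<in> carrier H"
      then obtain F where F: "finite_cocycle A ?n F" "\<Theta> (\<lambda>c. F (frag_of c)) = y" using surj by blast
      have Fh: "F \<in> hom (free_Abelian_group (fcells ?n)) A" using F(1) by (simp add: finite_cocycle_def)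
      have Fd: "F (frag_extend fdiff x) = \<one>\<^bsub>A\<^esub>" if "Poly_Mapping.keys x \<subseteq> fcells (Suc ?n)" for x
      proof (rule frag_hom_eq[OF Ag _ hom_one_const[OF Ag] _ that])
        show "(\<lambda>c. F (frag_extend fdiff c)) \<in> hom (free_Abelian_group (fcells (Suc ?n))) A"
          by (rule frag_hom_extend[OF Fh fdiff_keys])
        show "F (frag_extend fdiff (frag_of s)) = \<one>\<^bsub>A\<^esub>" if "s \<in> fcells (Suc ?n)" for s
          using F(1) that by (simp add: finite_cocycle_def)
      qed
      \<comment> \<open>The candidate preimage is F after f. Its pullback, F after f after g,
        differs from F by F on k after the boundary, as F is trivial on boundaries. This difference
        is \<open>F2\<close> below, a coboundary.\<close>
      define u where "u = restrict (\<lambda>c. F (frag_extend (f ?n) c)) (carrier (CG ?n))"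
      have "(\<lambda>c. F (frag_extend (f ?n) c)) \<in> hom (CG ?n) A"
        unfolding CG by (rule frag_hom_extend[OF Fh]) (use f in auto)
      then have uh: "u \<in> hom (CG ?n) A" unfolding u_def by (rule hom_restrict[rotated]) (simp add: CG)
      have fdc: "frag_extend fdiff (frag_extend (f (Suc ?n)) c) = frag_extend (f ?n) (chain_boundary (Suc ?n) c)"
        if "singular_chain (Suc ?n) B c" for c
        using that unfolding sc
        by (induction c rule: frag_induction) (simp_all add: fd frag_extend_diff chain_boundary_diff)
      have u: "u \<in> cocycles ?n B A"
        unfolding cocyc
      proof (intro conjI allI impI uh)
        fix c assume c: "singular_chain (Suc ?n) B c"
        have "Poly_Mapping.keys (frag_extend (f (Suc ?n)) c) \<subseteq> fcells (Suc ?n)"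
          by (rule keys_extend_subset[OF c[unfolded sc]]) (use f in auto)
        then show "u (chain_boundary (Suc ?n) c) = \<one>\<^bsub>A\<^esub>"
          using bd[OF c] Fd by (simp add: u_def CG_def fdc[OF c, symmetric])
      qed (simp add: u_def)
      have wh: "(\<lambda>x. F (frag_extend (k m) x)) \<in> hom (free_Abelian_group (fcells m)) A"
        by (rule frag_hom_extend[OF Fh k])
      define F2 where "F2 = (\<lambda>x. F (frag_extend (k m) (frag_extend fdiff x)))"
      have F2h: "F2 \<in> hom (free_Abelian_group (fcells ?n)) A"
        unfolding F2_def by (rule frag_hom_extend[OF wh fdiff_keys])
      have dd: "F2 (fdiff c) = \<one>\<^bsub>A\<^esub>" if c: "c \<in> fcells (Suc ?n)" for c
      proof -
        let ?d = "fdiff c"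
        have dk: "Poly_Mapping.keys ?d \<subseteq> fcells ?n" by (rule fdiff_keys[OF c])
        have eq: "frag_extend fdiff (frag_extend (k ?n) x) + frag_extend (k m) (frag_extend fdiff x) =
            frag_extend (f ?n) (frag_extend (g ?n) x) - x" if "Poly_Mapping.keys x \<subseteq> fcells ?n" for x
          using that
        proof (induction x rule: frag_induction)
          case (diff a b)
          show ?case
            by (simp only: frag_extend_diff add_diff_add[symmetric] diff) (simp add: algebra_simps)
        qed (simp_all add: kd)
        have "Poly_Mapping.keys (frag_extend (k ?n) ?d) \<subseteq> fcells (Suc ?n)"
          by (rule keys_extend_subset[OF dk k])
        then have 1: "F (frag_extend fdiff (frag_extend (k ?n) ?d)) = \<one>\<^bsub>A\<^esub>" by (rule Fd)
        have gc: "singular_chain (Suc ?n) B (g (Suc ?n) c)" by (rule g[OF c])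
        have "frag_extend (f ?n) (frag_extend (g ?n) ?d) = frag_extend fdiff (frag_extend (f (Suc ?n)) (g (Suc ?n) c))"
          by (simp add: gd[OF c, symmetric] fdc[OF gc])
        moreover have "Poly_Mapping.keys (frag_extend (f (Suc ?n)) (g (Suc ?n) c)) \<subseteq> fcells (Suc ?n)"
          by (rule keys_extend_subset[OF gc[unfolded sc]]) (use f in auto)
        ultimately have 2: "F (frag_extend (f ?n) (frag_extend (g ?n) ?d)) = \<one>\<^bsub>A\<^esub>"
          using Fd by simp
        have 3: "F ?d = \<one>\<^bsub>A\<^esub>" using F(1) c by (simp add: finite_cocycle_def)
        have fx: "frag_extend (k m) (frag_extend fdiff ?d) =
            (frag_extend (f ?n) (frag_extend (g ?n) ?d) - ?d) - frag_extend fdiff (frag_extend (k ?n) ?d)"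
          using eq[OF dk] by (simp add: algebra_simps)
        have ka: "Poly_Mapping.keys (frag_extend (f ?n) (frag_extend (g ?n) ?d)) \<subseteq> fcells ?n"
          by (rule keys_extend_subset[of _ "singular_simplex_set ?n B"], rule keys_extend_subset[OF dk])
             (use g f sc in auto)
        have kb: "Poly_Mapping.keys (frag_extend fdiff (frag_extend (k ?n) ?d)) \<subseteq> fcells ?n"
          by (rule keys_extend_subset[OF keys_extend_subset[OF dk k] fdiff_keys])
        have kab: "Poly_Mapping.keys (frag_extend (f ?n) (frag_extend (g ?n) ?d) - ?d) \<subseteq> fcells ?n"
          by (rule order_trans[OF keys_diff]) (use ka dk in auto)
        show ?thesis
          unfolding F2_def fx
          by (simp add: frag_hom_diff[OF Ag Fh kab kb] frag_hom_diff[OF Ag Fh ka dk] 1 2 3)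
      qed
      then have F2: "finite_cocycle A ?n F2" using F2h by (simp add: finite_cocycle_def)
      have "\<Theta> (\<lambda>c. F2 (frag_of c)) = \<one>\<^bsub>H\<^esub>"
        unfolding ker[OF F2] by (rule bexI[OF _ wh]) (simp add: F2_def)
      moreover have "\<Phi> u = \<Theta> (\<lambda>c. F (frag_of c) \<otimes>\<^bsub>A\<^esub> F2 (frag_of c))"
        unfolding \<Phi>_def
      proof (rule ext)
        fix c assume c: "c \<in> fcells ?n"
        have kc: "Poly_Mapping.keys (k ?n c) \<subseteq> fcells (Suc ?n)" by (rule k[OF c])
        have k1: "Poly_Mapping.keys (frag_extend fdiff (k ?n c)) \<subseteq> fcells ?n"
          by (rule keys_extend_subset[OF kc fdiff_keys])
        have k2: "Poly_Mapping.keys (frag_extend (k m) (fdiff c)) \<subseteq> fcells ?n"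
          by (rule keys_extend_subset[OF fdiff_keys[OF c] k])
        have k12: "Poly_Mapping.keys (frag_extend fdiff (k ?n c) + frag_extend (k m) (fdiff c)) \<subseteq> fcells ?n"
          by (rule order_trans[OF keys_add]) (use k1 k2 in auto)
        have "frag_extend (f ?n) (g ?n c) = frag_of c + (frag_extend fdiff (k ?n c) + frag_extend (k m) (fdiff c))"
          unfolding kd[OF c] by simp
        then have "u (g ?n c) = F (frag_of c + (frag_extend fdiff (k ?n c) + frag_extend (k m) (fdiff c)))"
          using g_in[OF c] by (simp add: u_def)
        also have "\<dots> = F (frag_of c) \<otimes>\<^bsub>A\<^esub> (F (frag_extend fdiff (k ?n c)) \<otimes>\<^bsub>A\<^esub> F (frag_extend (k m) (fdiff c)))"
          using c by (simp add: frag_hom_add[OF Fh _ k12] frag_hom_add[OF Fh k1 k2])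
        also have "\<dots> = F (frag_of c) \<otimes>\<^bsub>A\<^esub> F2 (frag_of c)"
          using frag_hom_closed[OF Fh k2] by (simp add: Fd[OF kc] F2_def)
        finally show "pull u (frag_of c) = F (frag_of c) \<otimes>\<^bsub>A\<^esub> F2 (frag_of c)" by (simp add: pull_of)
      qed
      ultimately have "\<Phi> u = y" using mult[OF F(1) F2] F(2) \<open>y \<in> carrier H\<close> by simp
      then show "y \<in> \<Phi> ` carrier ?K" using u by auto
    qed
  qed
  have "kernel ?K H \<Phi> = coboundaries ?n B A"
  proof (intro equalityI subsetI)
    fix u assume "u \<in> kernel ?K H \<Phi>"
    then have u: "u \<in> cocycles ?n B A" and "\<Phi> u = \<one>\<^bsub>H\<^esub>" by (auto simp: kernel_def)
    then obtain F where F: "F \<in> hom (free_Abelian_group (fcells m)) A" "\<And>c. c \<in> fcells ?n \<Longrightarrow> u (g ?n c) = F (fdiff c)"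
      using ker[OF pull[OF u]] unfolding \<Phi>_def pull_of by blast
    have uh: "u \<in> hom (free_Abelian_group (singular_simplex_set ?n B)) A" using u cocyc CG by simp
    have h1: "(\<lambda>c. F (frag_extend (f m) c)) \<in> hom (free_Abelian_group (singular_simplex_set m B)) A"
      by (rule frag_hom_extend[OF F(1)]) (use f in auto)
    have h2: "(\<lambda>c. u (frag_extend (h m) c)) \<in> hom (free_Abelian_group (singular_simplex_set m B)) A"
      by (rule frag_hom_extend[OF uh]) (use h sc in auto)
    \<comment> \<open>With u g = F bdry on the cells, the homotopy gives, in additive notation, u =
      u g f - u bdry h - u h bdry = (F f - u h) bdry, since the cocycle u kills bdry h.\<close>
    define e where "e c = F (frag_extend (f m) c) \<otimes>\<^bsub>A\<^esub> inv\<^bsub>A\<^esub> u (frag_extend (h m) c)" for c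
    have eh: "e \<in> hom (free_Abelian_group (singular_simplex_set m B)) A"
      unfolding e_def by (rule hom_mult_inv(1)[OF A _ h1 hom_mult_inv(2)[OF A _ h2 h2]]) simp_all
    define e' where "e' = restrict e (carrier (CG m))"
    have e'h: "e' \<in> carrier (cochain_group m B A)"
      unfolding e'_def coch hom_group_def using hom_restrict[OF _ eh] by (simp add: CG)
    have ue: "u c = e (chain_boundary ?n c)" if "singular_chain ?n B c" for c
    proof (rule frag_hom_eq[OF Ag uh _ _ that[unfolded sc]])
      show "(\<lambda>c. e (chain_boundary ?n c)) \<in> hom (free_Abelian_group (singular_simplex_set ?n B)) A"
        using frag_hom_extend[OF eh, of "singular_simplex_set ?n B" "\<lambda>s. chain_boundary ?n (frag_of s)"] bd sc
        by (simp add: chain_boundary_extend)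
      fix t assume "t \<in> singular_simplex_set ?n B"
      then have t: "singular_simplex ?n B t" by simp
      let ?b = "chain_boundary ?n (frag_of t)"
      have b: "singular_chain m B ?b" by (rule bd) (simp add: singular_chain_of t)
      have hb: "singular_chain ?n B (frag_extend (h m) ?b)"
        unfolding sc by (rule keys_extend_subset[OF b[unfolded sc]]) (use h sc in auto)
      have ht: "singular_chain ?n B (chain_boundary (Suc ?n) (h ?n t))" by (rule bd[OF h[OF t]])
      have gf: "singular_chain ?n B (frag_extend (g ?n) (f ?n t))"
        unfolding sc by (rule keys_extend_subset[OF f[OF t]]) (use g sc in auto)
      have "frag_of t = (frag_extend (g ?n) (f ?n t) - frag_extend (h m) ?b) - chain_boundary (Suc ?n) (h ?n t)"
        using hd[OF t] by (simp add: algebra_simps)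
      then have "u (frag_of t) = u ((frag_extend (g ?n) (f ?n t) - frag_extend (h m) ?b) - chain_boundary (Suc ?n) (h ?n t))"
        by simp
      also have "\<dots> = (u (frag_extend (g ?n) (f ?n t)) \<otimes>\<^bsub>A\<^esub> inv\<^bsub>A\<^esub> u (frag_extend (h m) ?b)) \<otimes>\<^bsub>A\<^esub> inv\<^bsub>A\<^esub> u (chain_boundary (Suc ?n) (h ?n t))"
      proof -
        have "singular_chain ?n B (frag_extend (g ?n) (f ?n t) - frag_extend (h m) ?b)"
          by (rule singular_chain_diff[OF gf hb])
        then show ?thesis
          using frag_hom_diff[OF Ag uh] gf hb ht unfolding sc by simp
      qed
      also have "u (chain_boundary (Suc ?n) (h ?n t)) = \<one>\<^bsub>A\<^esub>" using u h[OF t] cocyc by blast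
      also have "u (frag_extend (g ?n) (f ?n t)) = F (frag_extend fdiff (f ?n t))"
      proof (rule frag_hom_eq[OF Ag _ frag_hom_extend[OF F(1) fdiff_keys] _ f[OF t]])
        show "(\<lambda>c. u (frag_extend (g ?n) c)) \<in> hom (free_Abelian_group (fcells ?n)) A"
          by (rule frag_hom_extend[OF uh]) (use g sc in auto)
      qed (use F(2) in auto)
      also have "frag_extend fdiff (f ?n t) = frag_extend (f m) ?b" by (rule fd[OF t])
      finally show "u (frag_of t) = e ?b"
        using frag_hom_closed[OF h1 b[unfolded sc]] frag_hom_closed[OF h2 b[unfolded sc]]
        by (simp add: e_def)
    qed
    have "u = cochain_coboundary m B e'"
    proof
      fix c
      show "u c = cochain_coboundary m B e' c"
        using ue[of c] bd[of m c] u cocyc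
        by (auto simp: cochain_coboundary_def e'_def CG_def extensional_def)
    qed
    then show "u \<in> coboundaries ?n B A" using e'h by (auto simp: coboundaries_def)
  next
    fix u assume "u \<in> coboundaries ?n B A"
    then obtain e where e: "e \<in> carrier (cochain_group m B A)" "u = cochain_coboundary m B e"
      by (auto simp: coboundaries_def)
    have eh: "e \<in> hom (free_Abelian_group (singular_simplex_set m B)) A"
      using e(1) by (simp add: coch hom_group_def CG)
    have uval: "u c = e (chain_boundary ?n c)" if "singular_chain ?n B c" for c
      using that by (simp add: e(2) cochain_coboundary_def)
    have h1: "(\<lambda>c. e (chain_boundary ?n c)) \<in> hom (CG ?n) A"
      using frag_hom_extend[OF eh, of "singular_simplex_set ?n B" "\<lambda>s. chain_boundary ?n (frag_of s)"] bd sc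
      by (simp add: chain_boundary_extend CG)
    have ur: "u = restrict (\<lambda>c. e (chain_boundary ?n c)) (carrier (CG ?n))"
      by (simp add: e(2) cochain_coboundary_def CG_def)
    have u: "u \<in> cocycles ?n B A"
      unfolding cocyc
    proof (intro conjI allI impI)
      show "u \<in> hom (CG ?n) A" unfolding ur by (rule hom_restrict[OF _ h1]) (simp add: CG)
      show "u \<in> extensional (carrier (CG ?n))" by (simp add: ur)
      fix c assume c: "singular_chain (Suc ?n) B c"
      then show "u (chain_boundary (Suc ?n) c) = \<one>\<^bsub>A\<^esub>"
        using uval[OF bd[OF c]] chain_boundary_boundary_alt[OF c] frag_hom_zero[OF Ag eh] by simp
    qed
    have "\<Phi> u = \<one>\<^bsub>H\<^esub>"
      unfolding \<Phi>_def ker[OF pull[OF u]]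
    proof (rule bexI)
      show "(\<lambda>c. e (frag_extend (g m) c)) \<in> hom (free_Abelian_group (fcells m)) A"
        by (rule frag_hom_extend[OF eh]) (use g sc in auto)
      show "\<forall>c\<in>fcells ?n. pull u (frag_of c) = e (frag_extend (g m) (fdiff c))"
        by (simp add: pull_of uval g gd)
    qed
    then show "u \<in> kernel ?K H \<Phi>" using u by (simp add: kernel_def)
  qed
  then show ?thesis
    using P.FactGroup_iso[OF onto] by (simp add: singular_cohomology_def)
  qed
qed

section \<open>The cohomology of the finite model\<close>

definition bset :: "nat set \<Rightarrow> bits"
  where "bset S = ((1 \<in> S, 2 \<in> S), (3 \<in> S, 4 \<in> S), (5 \<in> S, 6 \<in> S))"

lemma norm_one_inverse: "norm x = 1 \<Longrightarrow> inverse x * x = 1" for x :: complex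
  by (rule left_inverse) auto

lemma comm_group_U1: "comm_group U1"
proof (rule comm_groupI)
  show "\<exists>y\<in>carrier U1. y \<otimes>\<^bsub>U1\<^esub> x = \<one>\<^bsub>U1\<^esub>" if "x \<in> carrier U1" for x
    using that by (intro bexI[of _ "inverse x"]) (auto simp: U1_def norm_inverse norm_one_inverse)
qed (auto simp: U1_def norm_mult)

lemma carrier_U1: "x \<in> carrier U1 \<longleftrightarrow> norm x = 1"
  by (simp add: U1_def)

lemma U1_sel [simp]: "x \<otimes>\<^bsub>U1\<^esub> y = x * y" "\<one>\<^bsub>U1\<^esub> = 1"
  by (simp_all add: U1_def)

lemma inv_U1: "norm x = 1 \<Longrightarrow> inv\<^bsub>U1\<^esub> x = inverse x"
  using comm_group.axioms(2)[OF comm_group_U1]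
  by (intro group.inv_equality) (auto simp: U1_def norm_inverse norm_one_inverse)

lemma group_U1: "group U1"
  using comm_group_U1 by (simp add: comm_group_def)

lemma U1_hom_cmul:
  assumes F: "F \<in> hom (free_Abelian_group S) U1" and x: "x \<in> S" and k: "k = 1 \<or> k = -1"
  shows "F (frag_cmul k (frag_of x)) = (if k = 1 then F (frag_of x) else inverse (F (frag_of x)))"
proof -
  have n: "norm (F (frag_of x)) = 1"
    using frag_hom_closed[OF F, of "frag_of x"] x by (simp add: carrier_U1)
  have "F (0 - frag_of x) = inverse (F (frag_of x))"
    using frag_hom_diff[OF group_U1 F, of 0 "frag_of x"] x frag_hom_zero[OF group_U1 F] by (simp add: inv_U1 n)
  then show ?thesis using k by auto
qed

lemma bsgn_cases: "bsgn I = 1 \<or> bsgn I = -1"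
  by (auto simp: bsgn_def split: prod.splits)

lemma fcells_lower: "(i, I) \<in> fcells (Suc n) \<Longrightarrow> i \<noteq> 0 \<Longrightarrow> (i - 1, I) \<in> fcells n \<and> (i - 1, bswap I) \<in> fcells n"
  by (auto simp: fcells_def bdeg_bswap)

text \<open>Serves two purposes: for a cocycle the right-hand side equals 1, and for a primitive it
  gives the values of the coboundary. \<open>Z_fdiff\<close> is the additive counterpart.\<close>

lemma U1_fdiff:
  assumes F: "F \<in> hom (free_Abelian_group (fcells n)) U1" and c: "(i, I) \<in> fcells (Suc n)"
  defines "v \<equiv> \<lambda>c. F (frag_of c)" and "s \<equiv> \<lambda>k x. if k = (1::int) then x else inverse x :: complex"
  shows "F (fdiff (i, I)) = (if i = 0 then 1
     else if odd i then s (bsgn I) (v (i - 1, bswap I)) / v (i - 1, I)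
     else v (i - 1, I) * s (bsgn I) (v (i - 1, bswap I)) * s (bsgn I * bsgn (bswap I)) (v (i - 1, I)) *
       s (bsgn I * bsgn (bswap I) * bsgn I) (v (i - 1, bswap I)))"
proof (cases "i = 0")
  case True
  then show ?thesis using frag_hom_zero[OF group_U1 F] by (simp add: fdiff_def)
next
  case False
  note l = conjunct1[OF fcells_lower[OF c False]] conjunct2[OF fcells_lower[OF c False]]
  have K: "Poly_Mapping.keys (frag_cmul k (frag_of x)) \<subseteq> fcells n" "Poly_Mapping.keys (frag_of x) \<subseteq> fcells n"
    if "x \<in> fcells n" for k x
    using that keys_cmul[of k "frag_of x"] by auto
  have A: "Poly_Mapping.keys (a + b) \<subseteq> fcells n" if "Poly_Mapping.keys a \<subseteq> fcells n" "Poly_Mapping.keys b \<subseteq> fcells n" for a b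
    using that keys_add[of a b] by auto
  have n: "norm (F (frag_of x)) = 1" if "x \<in> fcells n" for x
    using frag_hom_closed[OF F K(2)[OF that]] by (simp add: carrier_U1)
  have sg: "bsgn I * bsgn (bswap I) = 1 \<or> bsgn I * bsgn (bswap I) = -1"
    "bsgn I * bsgn (bswap I) * bsgn I = 1 \<or> bsgn I * bsgn (bswap I) * bsgn I = -1"
    using bsgn_cases[of I] bsgn_cases[of "bswap I"] by auto
  have C: "F (frag_cmul k (frag_of x)) = s k (v x)" if "x \<in> fcells n" "k = 1 \<or> k = -1" for k x
    using U1_hom_cmul[OF F that] by (simp add: s_def v_def)
  show ?thesis
  proof (cases "odd i")
    case True
    have "F (fdiff (i, I)) = F (frag_cmul (bsgn I) (frag_of (i - 1, bswap I)) - frag_of (i - 1, I))"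
      using True False by (simp add: fdiff_def)
    also have "\<dots> = s (bsgn I) (v (i - 1, bswap I)) / v (i - 1, I)"
      unfolding frag_hom_diff[OF group_U1 F K(1)[OF l(2)] K(2)[OF l(1)]]
      using n[OF l(1)] by (simp only: C[OF l(2) bsgn_cases] U1_sel inv_U1 divide_inverse v_def)
    finally show ?thesis using True False by simp
  next
    case ev: False
    let ?a = "frag_of (i - 1, I)" and ?b = "frag_cmul (bsgn I) (frag_of (i - 1, bswap I))"
    let ?c = "frag_cmul (bsgn I * bsgn (bswap I)) (frag_of (i - 1, I))"
    let ?d = "frag_cmul (bsgn I * bsgn (bswap I) * bsgn I) (frag_of (i - 1, bswap I))"
    have "F (fdiff (i, I)) = F (?a + ?b + ?c + ?d)"
      using ev False by (simp add: fdiff_def)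
    also have "\<dots> = F ?a * F ?b * F ?c * F ?d"
      using frag_hom_add[OF F A[OF A[OF K(2)[OF l(1)] K(1)[OF l(2)]] K(1)[OF l(1)]] K(1)[OF l(2)]]
        frag_hom_add[OF F A[OF K(2)[OF l(1)] K(1)[OF l(2)]] K(1)[OF l(1)]]
        frag_hom_add[OF F K(2)[OF l(1)] K(1)[OF l(2)]]
      by (simp only: U1_sel)
    also have "\<dots> = v (i - 1, I) * s (bsgn I) (v (i - 1, bswap I)) * s (bsgn I * bsgn (bswap I)) (v (i - 1, I)) *
       s (bsgn I * bsgn (bswap I) * bsgn I) (v (i - 1, bswap I))"
      by (simp only: C[OF l(2) bsgn_cases] C[OF l(1) sg(1)] C[OF l(2) sg(2)]) (simp add: v_def)
    finally show ?thesis using ev False by simp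
  qed
qed

lemma Z_hom_cmul:
  assumes F: "F \<in> hom (free_Abelian_group S) integer_group" and x: "x \<in> S"
  shows "F (frag_cmul k (frag_of x)) = k * F (frag_of x)"
proof -
  have add: "F (frag_cmul (a + b) (frag_of x)) = F (frag_cmul a (frag_of x)) + F (frag_cmul b (frag_of x))" for a b
    unfolding frag_cmul_distrib using x keys_cmul[of a "frag_of x"] keys_cmul[of b "frag_of x"]
    by (subst frag_hom_add[OF F]) auto
  have z: "F (frag_cmul 0 (frag_of x)) = 0"
    using add[of 0 0] by simp
  show ?thesis
  proof (induction k rule: int_induct[of _ 0])
    case base then show ?case by (rule z[THEN trans]) simp
  next
    case (step1 i) then show ?case using add[of i 1] by (simp add: algebra_simps)
  next
    case (step2 i) then show ?case using add[of "i - 1" 1] by (simp add: algebra_simps)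
  qed
qed

lemma Z_fdiff:
  assumes F: "F \<in> hom (free_Abelian_group (fcells n)) integer_group" and c: "(i, I) \<in> fcells (Suc n)"
  defines "v \<equiv> \<lambda>c. F (frag_of c)"
  shows "F (fdiff (i, I)) = (if i = 0 then 0
     else if odd i then bsgn I * v (i - 1, bswap I) - v (i - 1, I)
     else v (i - 1, I) + bsgn I * v (i - 1, bswap I) + bsgn I * bsgn (bswap I) * v (i - 1, I) +
       bsgn I * bsgn (bswap I) * bsgn I * v (i - 1, bswap I))"
proof (cases "i = 0")
  case True
  then show ?thesis using frag_hom_zero[OF group_integer_group F] by (simp add: fdiff_def)
next
  case False
  note l = conjunct1[OF fcells_lower[OF c False]] conjunct2[OF fcells_lower[OF c False]]
  have K: "Poly_Mapping.keys (frag_cmul k (frag_of x)) \<subseteq> fcells n" "Poly_Mapping.keys (frag_of x) \<subseteq> fcells n"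
    if "x \<in> fcells n" for k x
    using that keys_cmul[of k "frag_of x"] by auto
  have A: "Poly_Mapping.keys (a + b) \<subseteq> fcells n" if "Poly_Mapping.keys a \<subseteq> fcells n" "Poly_Mapping.keys b \<subseteq> fcells n" for a b
    using that keys_add[of a b] by auto
  have C: "F (frag_cmul k (frag_of x)) = k * v x" if "x \<in> fcells n" for k x
    using Z_hom_cmul[OF F that] by (simp add: v_def)
  show ?thesis
  proof (cases "odd i")
    case True
    have "fdiff (i, I) = frag_cmul (bsgn I) (frag_of (i - 1, bswap I)) + frag_cmul (-1) (frag_of (i - 1, I))"
      using True False by (simp add: fdiff_def)
    then have "F (fdiff (i, I)) = bsgn I * v (i - 1, bswap I) + (-1) * v (i - 1, I)"
      using frag_hom_add[OF F K(1)[OF l(2)] K(1)[OF l(1)]] by (simp only: C[OF l(1)] C[OF l(2)] mult_integer_group)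
    then show ?thesis using True False by simp
  next
    case ev: False
    let ?a = "frag_of (i - 1, I)" and ?b = "frag_cmul (bsgn I) (frag_of (i - 1, bswap I))"
    let ?c = "frag_cmul (bsgn I * bsgn (bswap I)) (frag_of (i - 1, I))"
    let ?d = "frag_cmul (bsgn I * bsgn (bswap I) * bsgn I) (frag_of (i - 1, bswap I))"
    have "F (fdiff (i, I)) = F (?a + ?b + ?c + ?d)"
      using ev False by (simp add: fdiff_def)
    also have "\<dots> = F ?a + F ?b + F ?c + F ?d"
      using frag_hom_add[OF F A[OF A[OF K(2)[OF l(1)] K(1)[OF l(2)]] K(1)[OF l(1)]] K(1)[OF l(2)]]
        frag_hom_add[OF F A[OF K(2)[OF l(1)] K(1)[OF l(2)]] K(1)[OF l(1)]]
        frag_hom_add[OF F K(2)[OF l(1)] K(1)[OF l(2)]]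
      by (simp only: mult_integer_group)
    also have "\<dots> = v (i - 1, I) + bsgn I * v (i - 1, bswap I) + bsgn I * bsgn (bswap I) * v (i - 1, I) +
       bsgn I * bsgn (bswap I) * bsgn I * v (i - 1, bswap I)"
      by (simp only: C[OF l(1)] C[OF l(2)]) (simp add: v_def)
    finally show ?thesis using ev False by simp
  qed
qed

text \<open>The 1, 6, 15 and 20 basis elements of the exterior powers of M in degrees 0 to
  3.\<close>

lemma bits_cases:
  "bdeg I = 0 \<Longrightarrow> I = bset {}"
  "bdeg I = 1 \<Longrightarrow> I \<in> {bset {1}, bset {2}, bset {3}, bset {4}, bset {5}, bset {6}}"
  "bdeg I = 2 \<Longrightarrow> I \<in> {bset {1, 2}, bset {1, 3}, bset {1, 4}, bset {1, 5}, bset {1, 6}, bset {2, 3}, bset {2, 4}, bset {2,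
     5}, bset {2, 6}, bset {3, 4}, bset {3, 5}, bset {3, 6}, bset {4, 5}, bset {4, 6}, bset {5, 6}}"
  "bdeg I = 3 \<Longrightarrow> I \<in> {bset {1, 2, 3}, bset {1, 2, 4}, bset {1, 2, 5}, bset {1, 2, 6}, bset {1, 3, 4}, bset {1, 3, 5}, bset
     {1, 3, 6}, bset {1, 4, 5}, bset {1, 4, 6}, bset {1, 5, 6}, bset {2, 3, 4}, bset {2, 3, 5}, bset {2,
     3, 6}, bset {2, 4, 5}, bset {2, 4, 6}, bset {2, 5, 6}, bset {3, 4, 5}, bset {3, 4, 6}, bset {3, 5,
     6}, bset {4, 5, 6}}"
proof -
  obtain a b c d e f where I: "I = ((a, b), (c, d), (e, f))" by (metis prod.collapse)
  show "bdeg I = 0 \<Longrightarrow> I = bset {}"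
    "bdeg I = 1 \<Longrightarrow> I \<in> {bset {1}, bset {2}, bset {3}, bset {4}, bset {5}, bset {6}}"
    "bdeg I = 2 \<Longrightarrow> I \<in> {bset {1, 2}, bset {1, 3}, bset {1, 4}, bset {1, 5}, bset {1, 6}, bset {2, 3}, bset {2, 4}, bset {2,
     5}, bset {2, 6}, bset {3, 4}, bset {3, 5}, bset {3, 6}, bset {4, 5}, bset {4, 6}, bset {5, 6}}"
    "bdeg I = 3 \<Longrightarrow> I \<in> {bset {1, 2, 3}, bset {1, 2, 4}, bset {1, 2, 5}, bset {1, 2, 6}, bset {1, 3, 4}, bset {1, 3, 5}, bset
     {1, 3, 6}, bset {1, 4, 5}, bset {1, 4, 6}, bset {1, 5, 6}, bset {2, 3, 4}, bset {2, 3, 5}, bset {2,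
     3, 6}, bset {2, 4, 5}, bset {2, 4, 6}, bset {2, 5, 6}, bset {3, 4, 5}, bset {3, 4, 6}, bset {3, 5,
     6}, bset {4, 5, 6}}"
    unfolding I bset_def bdeg_def
    by (cases a; cases b; cases c; cases d; cases e; cases f; simp)+
qed

lemma less4: "i < (4::nat) \<longleftrightarrow> i = 0 \<or> i = 1 \<or> i = 2 \<or> i = 3"
  by auto

lemma less5: "i < (5::nat) \<longleftrightarrow> i = 0 \<or> i = 1 \<or> i = 2 \<or> i = 3 \<or> i = 4"
  by auto

subsection \<open>Degree three with integer coefficients\<close>

text \<open>
  A cocycle vanishes at \<open>(3, I)\<close> and \<open>(2, I)\<close>. At \<open>(0, I)\<close> it satisfies \<open>v I = bsgn I \<cdot> v (bswap I)\<close>,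
  which leaves one free value for each of the orbits represented by \<open>zfree\<close> and forces all others
  to be \<open>0\<close>. At \<open>(1, I)\<close> it is a coboundary up to the parity of \<open>v I + v (bswap I)\<close> on the four
  orbits \<open>ztors\<close>, which span copies of \<open>M\<^sub>2\<close>.
\<close>

definition zfree :: "nat \<Rightarrow> bits"
  where "zfree i = bset ([{1, 3, 5}, {1, 3, 6}, {2, 3, 5}, {2, 3, 6}] ! i)"

definition ztors :: "nat \<Rightarrow> bits \<times> bits"
  where "ztors i = ([(bset {1, 3}, bset {1, 4}), (bset {1, 5}, bset {1, 6}), (bset {2, 3}, bset {2, 4}), (bset {2, 5}, bset {2, 6})] ! i)"

text \<open>On an orbit that spans a copy of M_2 = Z[i], the class in H^1(Z/4, M_2) = Z[i]/(1 - i)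
  is the sum of the two coordinates modulo 2.\<close>

definition zinv :: "(nat \<times> bits \<Rightarrow> int) \<Rightarrow> (nat \<Rightarrow> int) \<times> (nat \<Rightarrow> int)"
  where "zinv v = (\<lambda>i\<in>{..<4}. v (0, zfree i), \<lambda>i\<in>{..<4}. (v (1, fst (ztors i)) + v (1, snd (ztors i))) mod 2)"

abbreviation "Zgroup \<equiv> product_group {..<4::nat} (\<lambda>_. integer_group) \<times>\<times> product_group {..<4::nat} (\<lambda>_. integer_mod_group 2)"

lemma group_Zgroup: "group Zgroup"
  by (intro DirProd_group product_group) auto

lemma zcells: "i < 4 \<Longrightarrow> (0, zfree i) \<in> fcells 3" "i < 4 \<Longrightarrow> (1, fst (ztors i)) \<in> fcells 3" "i < 4 \<Longrightarrow> (1, snd (ztors i)) \<in> fcells 3"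
  by (auto simp: less4 zfree_def ztors_def bset_def fcells_def bdeg_def)

lemma free_extension:
  assumes "comm_group A" "\<And>c. c \<in> S \<Longrightarrow> v c \<in> carrier A"
  obtains F where "F \<in> hom (free_Abelian_group S) A" "\<And>c. c \<in> S \<Longrightarrow> F (frag_of c) = v c"
  using comm_group.free_Abelian_group_universal[OF assms(1), of v S] assms(2) by blast

lemmas cell_simps = bset_def bdeg_def bswap_def bsgn_def

lemma zinv_surj:
  assumes "y \<in> carrier Zgroup"
  shows "\<exists>F. finite_cocycle integer_group 3 F \<and> zinv (\<lambda>c. F (frag_of c)) = y"
proof -
  obtain p q where y: "y = (p, q)" "p \<in> extensional {..<4}" "q \<in> (\<Pi>\<^sub>E i\<in>{..<4}. {0..<2})"
    using assms by (auto simp: carrier_integer_mod_group PiE_def)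
  \<comment> \<open>Each representative in \<open>zfree\<close> receives its value, and its partner
    under \<open>bswap\<close> the value forced by \<open>v I = bsgn I * v (bswap I)\<close>; this
    explains the signs.\<close>
  define P where "P = (\<lambda>_. 0)(bset {1, 3, 5} := p 0, bset {1, 4, 6} := - p 0,
     bset {1, 3, 6} := p 1, bset {1, 4, 5} := p 1, bset {2, 3, 5} := p 2, bset {2, 4, 6} := - p 2,
     bset {2, 3, 6} := p 3, bset {2, 4, 5} := p 3)"
  \<comment> \<open>Any values on a \<open>ztors\<close> orbit satisfy the cocycle condition, since
    t^2 = -1 makes the norm vanish. So q i may sit on one of the two cells, with 0 on the
    other.\<close>
  define Q where "Q = (\<lambda>_. 0)(bset {1, 3} := q 0, bset {1, 5} := q 1, bset {2, 3} := q 2, bset {2, 5} := q 3)"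
  define v where "v = (\<lambda>(i, I). if i = 0 then P I else if i = (1::nat) then Q I else 0)"
  have P: "bsgn I * P (bswap I) = P I" if "bdeg I = 3" for I
    using bits_cases(4)[OF that] unfolding P_def
    by (elim insertE emptyE; simp only:; simp add: cell_simps)
  have Q: "Q I + bsgn I * Q (bswap I) + bsgn I * bsgn (bswap I) * Q I + bsgn I * bsgn (bswap I) * bsgn I * Q (bswap I) = 0"
    if "bdeg I = 2" for I
    using bits_cases(3)[OF that] unfolding Q_def
    by (elim insertE emptyE; simp only:; simp add: cell_simps)
  obtain F where F: "F \<in> hom (free_Abelian_group (fcells 3)) integer_group" "\<And>c. c \<in> fcells 3 \<Longrightarrow> F (frag_of c) = v c"
    using free_extension[of integer_group "fcells 3" v] by (auto simp: abelian_integer_group)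
  have "\<forall>c\<in>fcells 4. F (fdiff c) = 0"
  proof
    fix c assume c: "c \<in> fcells 4"
    obtain i I where iI: "c = (i, I)" by (metis prod.collapse)
    then have c': "(i, I) \<in> fcells (Suc 3)" using c by simp
    have "F (fdiff (i, I)) = (if i = 0 then 0
     else if odd i then bsgn I * v (i - 1, bswap I) - v (i - 1, I)
     else v (i - 1, I) + bsgn I * v (i - 1, bswap I) + bsgn I * bsgn (bswap I) * v (i - 1, I) +
       bsgn I * bsgn (bswap I) * bsgn I * v (i - 1, bswap I))"
      unfolding Z_fdiff[OF F(1) c'] using fcells_lower[OF c'] F(2) by (cases "i = 0") simp_all
    also have "\<dots> = 0"
    proof -
      have i: "i + bdeg I = 4" using c' by (simp add: fcells_def)
      consider "i = 0" | "i = 1" | "i = 2" | "i \<ge> 3" by linarith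
      then show ?thesis
      proof cases
        case 2 then show ?thesis using P[of I] i by (simp add: v_def)
      next
        case 3 then show ?thesis using Q[of I] i by (simp add: v_def)
      next
        case 4
        then have "i - 1 \<noteq> 0" "i - 1 \<noteq> 1" "i \<noteq> 0" by auto
        then show ?thesis by (simp only: v_def split if_False) simp
      qed simp
    qed
    finally show "F (fdiff c) = 0" using iI by simp
  qed
  then have "finite_cocycle integer_group 3 F" using F(1) by (simp add: finite_cocycle_def)
  moreover have "zinv (\<lambda>c. F (frag_of c)) = y"
  proof -
    have "(\<lambda>i\<in>{..<4}. F (frag_of (0, zfree i))) = p"
    proof
      fix i
      have "P (zfree 0) = p 0" "P (zfree 1) = p 1" "P (zfree 2) = p 2" "P (zfree 3) = p 3"
        by (simp_all add: P_def zfree_def bset_def)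
      then have "i < 4 \<Longrightarrow> P (zfree i) = p i" unfolding less4 by blast
      then show "(\<lambda>i\<in>{..<4}. F (frag_of (0, zfree i))) i = p i"
        using y(2) zcells(1)[of i] by (auto simp: F(2) extensional_def v_def)
    qed
    moreover have "(\<lambda>i\<in>{..<4}. (F (frag_of (1, fst (ztors i))) + F (frag_of (1, snd (ztors i)))) mod 2) = q"
    proof
      fix i
      have "i < 4 \<Longrightarrow> v (1, fst (ztors i)) = q i \<and> v (1, snd (ztors i)) = 0"
        by (auto simp: less4 v_def Q_def ztors_def bset_def)
      moreover have "i < 4 \<Longrightarrow> q i mod 2 = q i" using y(3) by (auto simp: PiE_def Pi_def)
      ultimately show "(\<lambda>i\<in>{..<4}. (F (frag_of (1, fst (ztors i))) + F (frag_of (1, snd (ztors i)))) mod 2) i = q i"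
        using y(3) zcells(2,3)[of i] by (auto simp: F(2) PiE_def extensional_def)
    qed
    ultimately show ?thesis by (simp add: zinv_def y)
  qed
  ultimately show ?thesis by blast
qed

lemma zinv_kernel:
  assumes F: "finite_cocycle integer_group 3 F"
  shows "zinv (\<lambda>c. F (frag_of c)) = \<one>\<^bsub>Zgroup\<^esub> \<longleftrightarrow>
    (\<exists>F'\<in>hom (free_Abelian_group (fcells 2)) integer_group. \<forall>c\<in>fcells 3. F (frag_of c) = F' (fdiff c))"
proof -
  define v where "v c = F (frag_of c)" for c
  have Fh: "F \<in> hom (free_Abelian_group (fcells 3)) integer_group" using F by (simp add: finite_cocycle_def)
  have coc: "(if i = 0 then 0
     else if odd i then bsgn I * v (i - 1, bswap I) - v (i - 1, I)
     else v (i - 1, I) + bsgn I * v (i - 1, bswap I) + bsgn I * bsgn (bswap I) * v (i - 1, I) +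
       bsgn I * bsgn (bswap I) * bsgn I * v (i - 1, bswap I)) = 0" if "i + bdeg I = 4" for i I
  proof -
    have c: "(i, I) \<in> fcells (Suc 3)" using that by (simp add: fcells_def)
    then have "F (fdiff (i, I)) = 0" using F by (auto simp: finite_cocycle_def)
    then show ?thesis unfolding Z_fdiff[OF Fh c] v_def .
  qed
  have one: "\<one>\<^bsub>Zgroup\<^esub> = (\<lambda>i\<in>{..<4}. 0, \<lambda>i\<in>{..<4}. 0)" by simp
  show ?thesis
  proof
    assume "zinv (\<lambda>c. F (frag_of c)) = \<one>\<^bsub>Zgroup\<^esub>"
    then have z: "(\<lambda>i\<in>{..<4}. v (0, zfree i)) = (\<lambda>i\<in>{..<4}. 0)"
      "(\<lambda>i\<in>{..<4}. (v (1, fst (ztors i)) + v (1, snd (ztors i))) mod 2) = (\<lambda>i\<in>{..<4}. 0)"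
      unfolding one zinv_def v_def by simp_all
    have zf: "v (0, zfree i) = 0" if "i < 4" for i using fun_cong[OF z(1), of i] that by simp
    have zt: "even (v (1, fst (ztors i)) + v (1, snd (ztors i)))" if "i < 4" for i
      using fun_cong[OF z(2), of i] that by (simp add: even_iff_mod_2_eq_zero)
    \<comment> \<open>Off the four \<open>zfree\<close> orbits, either \<open>bswap\<close> fixes I
      with sign -1, or the two signs along the orbit multiply to -1; both give v = - v.\<close>
    have v0: "v (0, I) = 0" if I: "bdeg I = 3" for I
    proof -
      have "bsgn I * v (0, bswap I) = v (0, I)" "bsgn (bswap I) * v (0, I) = v (0, bswap I)"
        using coc[of 1 I] coc[of 1 "bswap I"] I by (simp_all add: bdeg_bswap)
      then show ?thesis
        using bits_cases(4)[OF I] zf[of 0] zf[of 1] zf[of 2] zf[of 3]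
        by (elim insertE emptyE; simp only:; simp add: cell_simps zfree_def)
    qed
    \<comment> \<open>Here every orbit is of this kind: M has no nonzero invariants.\<close>
    have v2: "v (2, I) = 0" if I: "bdeg I = 1" for I
    proof -
      have "bsgn I * v (2, bswap I) = v (2, I)" "bsgn (bswap I) * v (2, I) = v (2, bswap I)"
        using coc[of 3 I] coc[of 3 "bswap I"] I by (simp_all add: bdeg_bswap)
      then show ?thesis
        using bits_cases(2)[OF I] by (elim insertE emptyE; simp only:; simp add: cell_simps)
    qed
    \<comment> \<open>On the empty set the generator acts trivially, so the norm is multiplication
      by 4.\<close>
    have v3: "v (3, I) = 0" if I: "bdeg I = 0" for I
      using coc[of 4 I] I bits_cases(1)[OF I] by (simp add: cell_simps)
    have v1: "v (1, I) + bsgn I * v (1, bswap I) + bsgn I * bsgn (bswap I) * v (1, I) +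
       bsgn I * bsgn (bswap I) * bsgn I * v (1, bswap I) = 0" if I: "bdeg I = 2" for I
      using coc[of 2 I] I by simp
    \<comment> \<open>On a \<open>ztors\<close> pair with cells a and b the equations are v a = G b
      - G a and v b = - G a - G b. Adding them gives G a = - h, and the parity hypothesis makes the
      division by 2 exact; then G b = v a - h.\<close>
    define h where "h k l = (v (1, bset {k, l}) + v (1, bset {k, l + 1})) div 2" for k l :: nat
    \<comment> \<open>The orbits of {3, 5} and {3, 6} are permutation modules up to sign: G may
      vanish on one cell, and the norm condition yields the second equation. On {1, 2}, {3, 4} and
      {5, 6} that condition reads 4 v = 0, so v is 0 there.\<close>
    define G where "G = (\<lambda>_. 0)(
      bset {1, 3} := - h 1 3, bset {1, 4} := v (1, bset {1, 3}) - h 1 3,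
      bset {1, 5} := - h 1 5, bset {1, 6} := v (1, bset {1, 5}) - h 1 5,
      bset {2, 3} := - h 2 3, bset {2, 4} := v (1, bset {2, 3}) - h 2 3,
      bset {2, 5} := - h 2 5, bset {2, 6} := v (1, bset {2, 5}) - h 2 5,
      bset {4, 6} := v (1, bset {3, 5}), bset {4, 5} := - v (1, bset {3, 6}))"
    have h: "v (1, bset {1, 4}) = 2 * h 1 3 - v (1, bset {1, 3})" "v (1, bset {1, 6}) = 2 * h 1 5 - v (1, bset {1, 5})"
      "v (1, bset {2, 4}) = 2 * h 2 3 - v (1, bset {2, 3})" "v (1, bset {2, 6}) = 2 * h 2 5 - v (1, bset {2, 5})"
      using zt[of 0] zt[of 1] zt[of 2] zt[of 3] by (simp_all add: h_def ztors_def)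
    have G: "v (1, I) = bsgn I * G (bswap I) - G I" if I: "bdeg I = 2" for I
      using bits_cases(3)[OF I] v1[OF I] v1[of "bswap I"] h I unfolding G_def bdeg_bswap
      by (elim insertE emptyE; simp only:; simp add: cell_simps)
    \<comment> \<open>The values of v in cyclic degrees 0, 2 and 3 vanish, so the primitive can be
      supported in cyclic degree 0.\<close>
    define g where "g = (\<lambda>(i, I). if i = (0::nat) then G I else 0)"
    obtain F' where F': "F' \<in> hom (free_Abelian_group (fcells 2)) integer_group" "\<And>c. c \<in> fcells 2 \<Longrightarrow> F' (frag_of c) = g c"
      using free_extension[of integer_group "fcells 2" g] by (auto simp: abelian_integer_group)
    have "F (frag_of c) = F' (fdiff c)" if c: "c \<in> fcells 3" for c
    proof -
      obtain i I where iI: "c = (i, I)" by (metis prod.collapse)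
      then have c': "(i, I) \<in> fcells (Suc 2)" using c by simp
      have "v (i, I) = (if i = 0 then 0
       else if odd i then bsgn I * g (i - 1, bswap I) - g (i - 1, I)
       else g (i - 1, I) + bsgn I * g (i - 1, bswap I) + bsgn I * bsgn (bswap I) * g (i - 1, I) +
         bsgn I * bsgn (bswap I) * bsgn I * g (i - 1, bswap I))"
      proof -
        have i: "i + bdeg I = 3" using c' by (simp add: fcells_def)
        consider "i = 0" | "i = 1" | "i = 2" | "i = 3" using i by linarith
        then show ?thesis
        proof cases
          case 1 then show ?thesis using v0[of I] i by simp
        next
          case 2 then show ?thesis using G[of I] i by (simp add: g_def)
        next
          case 3 then show ?thesis using v2[of I] i by (simp add: g_def)
        next
          case 4 then show ?thesis using v3[of I] i by (simp add: g_def)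
        qed
      qed
      also have "\<dots> = F' (fdiff (i, I))"
        unfolding Z_fdiff[OF F'(1) c'] using fcells_lower[OF c'] F'(2) by (cases "i = 0") simp_all
      finally show ?thesis by (simp add: v_def iI)
    qed
    then show "\<exists>F'\<in>hom (free_Abelian_group (fcells 2)) integer_group. \<forall>c\<in>fcells 3. F (frag_of c) = F' (fdiff c)"
      using F'(1) by blast
  next
    assume "\<exists>F'\<in>hom (free_Abelian_group (fcells 2)) integer_group. \<forall>c\<in>fcells 3. F (frag_of c) = F' (fdiff c)"
    then obtain F' where F': "F' \<in> hom (free_Abelian_group (fcells 2)) integer_group" "\<And>c. c \<in> fcells 3 \<Longrightarrow> v c = F' (fdiff c)"
      by (auto simp: v_def)
    have val: "v (i, I) = (if i = 0 then 0
       else if odd i then bsgn I * F' (frag_of (i - 1, bswap I)) - F' (frag_of (i - 1, I))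
       else F' (frag_of (i - 1, I)) + bsgn I * F' (frag_of (i - 1, bswap I)) + bsgn I * bsgn (bswap I) * F' (frag_of (i - 1, I)) +
         bsgn I * bsgn (bswap I) * bsgn I * F' (frag_of (i - 1, bswap I)))" if "(i, I) \<in> fcells 3" for i I
      using F'(2)[OF that] Z_fdiff[OF F'(1), of i I] that by simp
    have "v (0, zfree i) = 0" if "i < 4" for i
      using val[OF zcells(1)[OF that]] by simp
    \<comment> \<open>The two coboundary values add up to minus twice the primitive at the first
      cell of the orbit.\<close>
    moreover have "(v (1, fst (ztors i)) + v (1, snd (ztors i))) mod 2 = 0" if "i < 4" for i
      using that val[OF zcells(2)[OF that]] val[OF zcells(3)[OF that]]
      by (auto simp: less4 ztors_def cell_simps)
    ultimately show "zinv (\<lambda>c. F (frag_of c)) = \<one>\<^bsub>Zgroup\<^esub>"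
      unfolding one zinv_def v_def by (auto simp: fun_eq_iff)
  qed
qed

theorem (in borel_cover) third_cohomology: "singular_cohomology 3 B integer_group \<cong> Zgroup"
proof -
  have "singular_cohomology (Suc 2) B integer_group \<cong> Zgroup"
  proof (rule cohomology_iso[where \<Theta> = zinv])
    show "comm_group integer_group" by (rule abelian_integer_group)
    show "group Zgroup" by (rule group_Zgroup)
    show "zinv (\<lambda>c. F (frag_of c)) \<in> carrier Zgroup" for F :: "(nat \<times> bits \<Rightarrow>\<^sub>0 int) \<Rightarrow> int"
      by (auto simp: zinv_def carrier_integer_mod_group)
    show "zinv (\<lambda>c. F (frag_of c) \<otimes>\<^bsub>integer_group\<^esub> F' (frag_of c)) = zinv (\<lambda>c. F (frag_of c)) \<otimes>\<^bsub>Zgroup\<^esub> zinv (\<lambda>c. F' (frag_of c))"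
      for F F' :: "(nat \<times> bits \<Rightarrow>\<^sub>0 int) \<Rightarrow> int"
      by (auto simp: zinv_def fun_eq_iff mod_add_eq) (simp add: ac_simps)
    show "zinv v = zinv w" if "\<And>c. c \<in> fcells (Suc 2) \<Longrightarrow> v c = w c" for v w
      using that zcells by (auto simp: zinv_def fun_eq_iff)
    show "\<exists>F. finite_cocycle integer_group (Suc 2) F \<and> zinv (\<lambda>c. F (frag_of c)) = y" if "y \<in> carrier Zgroup" for y
      using zinv_surj[OF that] by simp
    show "zinv (\<lambda>c. F (frag_of c)) = \<one>\<^bsub>Zgroup\<^esub> \<longleftrightarrow>
       (\<exists>F'\<in>hom (free_Abelian_group (fcells 2)) integer_group. \<forall>c\<in>fcells (Suc 2). F (frag_of c) = F' (fdiff c))"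
      if "finite_cocycle integer_group (Suc 2) F" for F
      using zinv_kernel[of F] that by simp
  qed
  then show ?thesis by simp
qed

subsection \<open>Degree two with coefficients in the circle group\<close>

text \<open>
  As the circle group is divisible, a cocycle is determined up to coboundaries by its values at
  \<open>(0, I)\<close>: these are free on the orbits \<open>ufree\<close> and signs on the orbits \<open>utors\<close>.
\<close>

definition ufree :: "nat \<Rightarrow> bits"
  where "ufree i = bset ([{1, 2}, {3, 4}, {5, 6}, {3, 5}, {3, 6}] ! i)"

definition utors :: "nat \<Rightarrow> bits"
  where "utors i = bset ([{1, 3}, {1, 5}, {2, 3}, {2, 5}] ! i)"

text \<open>On \<open>utors\<close> a cocycle takes the values 1 and -1 only
  (\<open>U1_cocycle_sign\<close>); comparing with 1 is the isomorphism from this group of signs to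
  Z/2.\<close>

definition uinv :: "(nat \<times> bits \<Rightarrow> complex) \<Rightarrow> (nat \<Rightarrow> complex) \<times> (nat \<Rightarrow> int)"
  where "uinv v = (\<lambda>i\<in>{..<5}. v (0, ufree i), \<lambda>i\<in>{..<4}. if v (0, utors i) = 1 then 0 else 1)"

abbreviation "Ugroup \<equiv> product_group {..<5::nat} (\<lambda>_. U1) \<times>\<times> product_group {..<4::nat} (\<lambda>_. integer_mod_group 2)"

lemma group_Ugroup: "group Ugroup"
  by (intro DirProd_group product_group) (auto simp: group_U1)

lemma ucells: "i < 5 \<Longrightarrow> (0, ufree i) \<in> fcells 2" "i < 4 \<Longrightarrow> (0, utors i) \<in> fcells 2"
  by (auto simp: less4 less5 ufree_def utors_def bset_def fcells_def bdeg_def)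

lemma U1_cocycle_norm:
  assumes "finite_cocycle U1 n F" "c \<in> fcells n" shows "norm (F (frag_of c)) = 1"
  using frag_hom_closed[of F "fcells n" U1 "frag_of c"] assms by (simp add: finite_cocycle_def carrier_U1)

text \<open>The cocycle condition at the cells (1, I), where the boundary is t - 1: the values in
  cyclic degree 0 are invariant under the signed swap.\<close>

lemma U1_cocycle_swap:
  assumes F: "finite_cocycle U1 2 F" and I: "bdeg I = 2"
  shows "(if bsgn I = 1 then F (frag_of (0, bswap I)) else inverse (F (frag_of (0, bswap I)))) = F (frag_of (0, I))"
proof -
  have Fh: "F \<in> hom (free_Abelian_group (fcells 2)) U1" using F by (simp add: finite_cocycle_def)
  have c: "(1, I) \<in> fcells (Suc 2)" "(0, I) \<in> fcells 2" using I by (simp_all add: fcells_def)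
  have "F (fdiff (1, I)) = 1" using F c by (simp add: finite_cocycle_def numeral_3_eq_3[symmetric])
  moreover have "F (frag_of (0, I)) \<noteq> 0" using U1_cocycle_norm[OF F c(2)] by auto
  ultimately show ?thesis unfolding U1_fdiff[OF Fh c(1)] by (cases "bsgn I = 1") simp_all
qed

text \<open>Two swaps return to the same cell with total sign -1, so the value equals its own
  inverse.\<close>

lemma U1_cocycle_sign:
  assumes F: "finite_cocycle U1 2 F" and i: "i < 4"
  shows "F (frag_of (0, utors i)) = 1 \<or> F (frag_of (0, utors i)) = -1"
proof -
  let ?I = "utors i"
  have d: "bdeg ?I = 2" "bsgn ?I = 1" "bsgn (bswap ?I) = -1"
    using i by (auto simp: less4 utors_def cell_simps)
  define x where "x = F (frag_of (0, ?I))"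
  have "F (frag_of (0, bswap ?I)) = x" "inverse x = F (frag_of (0, bswap ?I))"
    using U1_cocycle_swap[OF F d(1)] U1_cocycle_swap[OF F, of "bswap ?I"] d by (simp_all add: bdeg_bswap x_def)
  moreover have "x \<noteq> 0" using U1_cocycle_norm[OF F ucells(2)[OF i]] by (auto simp: x_def)
  ultimately have "x * x = 1" by (metis right_inverse)
  then show ?thesis using square_eq_1_iff x_def by blast
qed

lemma norm_fun_upd: "norm (f I) = 1 \<Longrightarrow> norm a = 1 \<Longrightarrow> norm ((f(x := a)) I) = 1"
  by simp

lemma uinv_surj:
  assumes "y \<in> carrier Ugroup"
  shows "\<exists>F. finite_cocycle U1 2 F \<and> uinv (\<lambda>c. F (frag_of c)) = y"
proof -
  obtain p q where y: "y = (p, q)" "p \<in> (\<Pi>\<^sub>E i\<in>{..<5}. carrier U1)" "q \<in> (\<Pi>\<^sub>E i\<in>{..<4}. {0..<2})"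
    using assms by (auto simp: carrier_integer_mod_group)
  have p: "norm (p i) = 1" if "i < 5" for i using y(2) that by (auto simp: PiE_def Pi_def carrier_U1)
  define \<sigma> where "\<sigma> i = (if q i = 0 then 1 else -1 :: complex)" for i
  \<comment> \<open>Partners under \<open>bswap\<close> carry equal or inverse values, according to
    \<open>bsgn\<close>. On a \<open>utors\<close> orbit both cells carry the same sign, which is
    its own inverse.\<close>
  define P where "P = (\<lambda>_. 1)(bset {1, 2} := p 0, bset {3, 4} := p 1, bset {5, 6} := p 2,
     bset {3, 5} := p 3, bset {4, 6} := p 3, bset {3, 6} := p 4, bset {4, 5} := inverse (p 4),
     bset {1, 3} := \<sigma> 0, bset {1, 4} := \<sigma> 0, bset {1, 5} := \<sigma> 1, bset {1, 6} := \<sigma> 1,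
     bset {2, 3} := \<sigma> 2, bset {2, 4} := \<sigma> 2, bset {2, 5} := \<sigma> 3, bset {2, 6} := \<sigma> 3)"
  define v where "v = (\<lambda>(i, I). if i = (0::nat) then P I else 1)"
  have Pn: "norm (P I) = 1" for I
    unfolding P_def by (intro norm_fun_upd p) (simp_all add: norm_inverse \<sigma>_def p)
  have P: "(if bsgn I = 1 then P (bswap I) else inverse (P (bswap I))) = P I" if "bdeg I = 2" for I
    using bits_cases(3)[OF that] unfolding P_def
    by (elim insertE emptyE; simp only:; simp add: cell_simps \<sigma>_def)
  have vc: "v c \<in> carrier U1" for c by (cases c) (simp add: v_def carrier_U1 Pn)
  obtain F where F: "F \<in> hom (free_Abelian_group (fcells 2)) U1" "\<And>c. c \<in> fcells 2 \<Longrightarrow> F (frag_of c) = v c"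
    using free_extension[OF comm_group_U1, of "fcells 2" v] vc by blast
  have "\<forall>c\<in>fcells 3. F (fdiff c) = 1"
  proof
    fix c assume c: "c \<in> fcells 3"
    obtain i I where iI: "c = (i, I)" by (metis prod.collapse)
    then have c': "(i, I) \<in> fcells (Suc 2)" using c by simp
    show "F (fdiff c) = 1"
    proof (cases "i = 0")
      case True
      then show ?thesis unfolding iI U1_fdiff[OF F(1) c'] by simp
    next
      case False
      note l = fcells_lower[OF c' False]
      have i: "i + bdeg I = 3" using c' by (simp add: fcells_def)
      show ?thesis
      proof (cases "i = 1")
        case True
        have "P I \<noteq> 0" using Pn[of I] by auto
        then show ?thesis unfolding iI U1_fdiff[OF F(1) c'] using l P[of I] i True
          by (cases "bsgn I = 1") (simp_all add: F(2) v_def)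
      next
        case i1: False
        then have "i - 1 \<noteq> 0" using False by simp
        then have "F (frag_of (i - 1, I)) = 1" "F (frag_of (i - 1, bswap I)) = 1" using l by (simp_all add: F(2) v_def)
        then show ?thesis unfolding iI U1_fdiff[OF F(1) c'] by simp
      qed
    qed
  qed
  then have "finite_cocycle U1 2 F" using F(1) by (simp add: finite_cocycle_def)
  moreover have "uinv (\<lambda>c. F (frag_of c)) = y"
  proof -
    have "(\<lambda>i\<in>{..<5}. F (frag_of (0, ufree i))) = p"
    proof
      fix i
      have "P (ufree 0) = p 0" "P (ufree 1) = p 1" "P (ufree 2) = p 2" "P (ufree 3) = p 3" "P (ufree 4) = p 4"
        by (simp_all add: P_def ufree_def bset_def)
      then have "i < 5 \<Longrightarrow> P (ufree i) = p i" unfolding less5 by blast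
      then show "(\<lambda>i\<in>{..<5}. F (frag_of (0, ufree i))) i = p i"
        using y(2) ucells(1)[of i] by (auto simp: F(2) v_def PiE_def extensional_def)
    qed
    moreover have "(\<lambda>i\<in>{..<4}. if F (frag_of (0, utors i)) = 1 then 0 else 1) = q"
    proof
      fix i
      have "P (utors 0) = \<sigma> 0" "P (utors 1) = \<sigma> 1" "P (utors 2) = \<sigma> 2" "P (utors 3) = \<sigma> 3"
        by (simp_all add: P_def utors_def bset_def)
      then have "i < 4 \<Longrightarrow> P (utors i) = \<sigma> i" unfolding less4 by blast
      moreover have "i < 4 \<Longrightarrow> q i = 0 \<or> q i = 1" using y(3) by (auto simp: PiE_def Pi_def)
      ultimately show "(\<lambda>i\<in>{..<4}. if F (frag_of (0, utors i)) = 1 then 0 else 1) i = q i"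
        using y(3) ucells(2)[of i] by (auto simp: F(2) v_def \<sigma>_def PiE_def extensional_def)
    qed
    ultimately show ?thesis by (simp add: uinv_def y)
  qed
  ultimately show ?thesis by blast
qed

lemma uinv_kernel:
  assumes F: "finite_cocycle U1 2 F"
  shows "uinv (\<lambda>c. F (frag_of c)) = \<one>\<^bsub>Ugroup\<^esub> \<longleftrightarrow>
    (\<exists>F'\<in>hom (free_Abelian_group (fcells 1)) U1. \<forall>c\<in>fcells 2. F (frag_of c) = F' (fdiff c))"
proof -
  define v where "v c = F (frag_of c)" for c
  have one: "\<one>\<^bsub>Ugroup\<^esub> = (\<lambda>i\<in>{..<5}. 1, \<lambda>i\<in>{..<4}. 0)" by simp
  have nv: "norm (v c) = 1" if "c \<in> fcells 2" for c using U1_cocycle_norm[OF F that] by (simp add: v_def)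
  show ?thesis
  proof
    assume "uinv (\<lambda>c. F (frag_of c)) = \<one>\<^bsub>Ugroup\<^esub>"
    then have z: "(\<lambda>i\<in>{..<5}. v (0, ufree i)) = (\<lambda>i\<in>{..<5}. 1)"
      "(\<lambda>i\<in>{..<4}. if v (0, utors i) = 1 then 0 else 1) = (\<lambda>i\<in>{..<4}. 0 :: int)"
      unfolding one uinv_def v_def by simp_all
    have zf: "v (0, ufree i) = 1" if "i < 5" for i using fun_cong[OF z(1), of i] that by simp
    have zt: "v (0, utors i) = 1" if "i < 4" for i using fun_cong[OF z(2), of i] that by (simp split: if_splits)
    have v0: "v (0, I) = 1" if I: "bdeg I = 2" for I
      using bits_cases(3)[OF I] U1_cocycle_swap[OF F I] zf[of 0] zf[of 1] zf[of 2] zf[of 3] zf[of 4]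
        zt[of 0] zt[of 1] zt[of 2] zt[of 3] unfolding v_def[symmetric]
      by (elim insertE emptyE; simp only:; simp add: cell_simps ufree_def utors_def)
    \<comment> \<open>Divisibility of the circle enters here: on {1} and {2} the generator acts by
      inversion, so a primitive G has to satisfy 1 / G^2 = v.\<close>
    define r where "r x = inverse (csqrt x)" for x
    have r: "inverse (r x) / r x = x" for x
      by (simp add: r_def divide_inverse flip: power2_eq_square)
    have nr: "norm (r x) = 1" if "norm x = 1" for x using that by (simp add: r_def norm_inverse)
    define x where "x k = v (1, bset {k})" for k :: nat
    have nx: "norm (x k) = 1" if "k \<in> {1, 2, 3, 4, 5, 6}" for k
      unfolding x_def by (rule nv) (use that in \<open>auto simp: fcells_def cell_simps\<close>)
    \<comment> \<open>On the empty set the generator acts trivially, so the norm is the fourth power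
      and a fourth root is required.\<close>
    define w where "w = csqrt (csqrt (v (2, bset {})))"
    have nw: "norm w = 1" using nv[of "(2, bset {})"] by (simp add: w_def fcells_def cell_simps)
    have w4: "w * w * w * w = v (2, bset {})"
    proof -
      have "w * w * w * w = ((csqrt (csqrt (v (2, bset {}))))\<^sup>2)\<^sup>2"
        by (simp only: w_def power2_eq_square mult.assoc)
      then show ?thesis by simp
    qed
    \<comment> \<open>Writing G3 and G4 for the values at {3} and {4}, the equations are 1 / (G4 G3)
      = x 3 and G3 / G4 = x 4. With b4 = G4 the second gives \<open>G3 = x 4 * b4\<close>, and the
      first becomes 1 / b4^2 = x 3 x 4. The pair {5}, {6} is treated alike.\<close>
    define b4 where "b4 = r (x 3 * x 4)"
    define b6 where "b6 = r (x 5 * x 6)"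
    have nb: "norm b4 = 1" "norm b6 = 1"
      unfolding b4_def b6_def by (rule nr, simp add: norm_mult nx)+
    have nz: "b4 \<noteq> 0" "b6 \<noteq> 0" "x 4 \<noteq> 0" "x 6 \<noteq> 0" using nb nx[of 4] nx[of 6] by auto
    define G where "G = (\<lambda>_. 1)(bset {1} := r (x 1), bset {2} := r (x 2), bset {3} := x 4 * b4, bset {4} := b4,
       bset {5} := x 6 * b6, bset {6} := b6)"
    have nG: "norm (G I) = 1" for I
      unfolding G_def by (intro norm_fun_upd) (simp_all add: norm_mult nb nx nr)
    have e: "inverse b4 / (x 4 * b4) = x 3" "inverse b6 / (x 6 * b6) = x 5"
    proof -
      have "inverse b4 / b4 = x 3 * x 4" "inverse b6 / b6 = x 5 * x 6" unfolding b4_def b6_def by (rule r)+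
      then show "inverse b4 / (x 4 * b4) = x 3" "inverse b6 / (x 6 * b6) = x 5"
        using nz by (simp_all add: field_simps)
    qed
    have G: "(if bsgn I = 1 then G (bswap I) else inverse (G (bswap I))) / G I = v (1, I)" if I: "bdeg I = 1" for I
      using bits_cases(2)[OF I] r[of "x 1"] r[of "x 2"] e nz unfolding G_def
      by (elim insertE emptyE; simp only: x_def; simp add: cell_simps)
    define g where "g = (\<lambda>(i, I). if i = (0::nat) then G I else w)"
    have gc: "g c \<in> carrier U1" for c by (cases c) (simp add: g_def carrier_U1 nG nw)
    obtain F' where F': "F' \<in> hom (free_Abelian_group (fcells 1)) U1" "\<And>c. c \<in> fcells 1 \<Longrightarrow> F' (frag_of c) = g c"
      using free_extension[OF comm_group_U1, of "fcells 1" g] gc by blast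
    have "F (frag_of c) = F' (fdiff c)" if c: "c \<in> fcells 2" for c
    proof -
      obtain i I where iI: "c = (i, I)" by (metis prod.collapse)
      then have c': "(i, I) \<in> fcells (Suc 1)" using c by (simp add: numeral_2_eq_2)
      have i: "i + bdeg I = 2" using c' by (simp add: fcells_def)
      consider "i = 0" | "i = 1" | "i = 2" using i by linarith
      then have "F' (fdiff (i, I)) = v (i, I)"
      proof cases
        case 1
        then show ?thesis unfolding U1_fdiff[OF F'(1) c'] using v0[of I] i by simp
      next
        case 2
        then show ?thesis
          unfolding U1_fdiff[OF F'(1) c'] using G[of I] i fcells_lower[OF c']
          by (cases "bsgn I = 1") (simp_all add: F'(2) g_def)
      next
        case 3
        then have "I = bset {}" using i bits_cases(1) by simp
        then show ?thesis
          unfolding U1_fdiff[OF F'(1) c'] using w4 3 fcells_lower[OF c'] by (simp add: F'(2) g_def) (simp add: cell_simps)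
      qed
      then show ?thesis by (simp add: iI v_def)
    qed
    then show "\<exists>F'\<in>hom (free_Abelian_group (fcells 1)) U1. \<forall>c\<in>fcells 2. F (frag_of c) = F' (fdiff c)"
      using F'(1) by blast
  next
    assume "\<exists>F'\<in>hom (free_Abelian_group (fcells 1)) U1. \<forall>c\<in>fcells 2. F (frag_of c) = F' (fdiff c)"
    then obtain F' where F': "F' \<in> hom (free_Abelian_group (fcells 1)) U1" "\<And>c. c \<in> fcells 2 \<Longrightarrow> v c = F' (fdiff c)"
      by (auto simp: v_def)
    have "v (0, I) = 1" if "(0, I) \<in> fcells 2" for I
      using F'(2)[OF that] frag_hom_zero[OF group_U1 F'(1)] by (simp add: fdiff_def)
    then show "uinv (\<lambda>c. F (frag_of c)) = \<one>\<^bsub>Ugroup\<^esub>"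
      unfolding one uinv_def v_def using ucells by (auto simp: fun_eq_iff)
  qed
qed

theorem (in borel_cover) second_cohomology: "singular_cohomology 2 B U1 \<cong> Ugroup"
proof -
  have two: "Suc 1 = 2" by simp
  have "singular_cohomology (Suc 1) B U1 \<cong> Ugroup"
  proof (rule cohomology_iso[where \<Theta> = uinv])
    show "comm_group U1" by (rule comm_group_U1)
    show "group Ugroup" by (rule group_Ugroup)
    show "uinv (\<lambda>c. F (frag_of c)) \<in> carrier Ugroup" if "finite_cocycle U1 (Suc 1) F" for F
      using U1_cocycle_norm[of 2 F] that ucells unfolding two
      by (auto simp: uinv_def carrier_integer_mod_group carrier_U1)
    show "uinv (\<lambda>c. F (frag_of c) \<otimes>\<^bsub>U1\<^esub> F' (frag_of c)) = uinv (\<lambda>c. F (frag_of c)) \<otimes>\<^bsub>Ugroup\<^esub> uinv (\<lambda>c. F' (frag_of c))"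
      if "finite_cocycle U1 (Suc 1) F" "finite_cocycle U1 (Suc 1) F'" for F F'
    proof -
      \<comment> \<open>Both factors are signs, so passing to Z/2 turns their product into a
        sum.\<close>
      have "(if F (frag_of (0, utors i)) * F' (frag_of (0, utors i)) = 1 then 0 else 1) =
         ((if F (frag_of (0, utors i)) = 1 then 0 else 1) + (if F' (frag_of (0, utors i)) = 1 then 0 else 1)) mod (2::int)"
        if "i < 4" for i
        using U1_cocycle_sign[of F i] U1_cocycle_sign[of F' i] \<open>finite_cocycle U1 (Suc 1) F\<close> \<open>finite_cocycle U1 (Suc 1) F'\<close> that
        unfolding two by auto
      then show ?thesis
        by (auto simp: uinv_def fun_eq_iff)
    qed
    show "uinv v = uinv w" if "\<And>c. c \<in> fcells (Suc 1) \<Longrightarrow> v c = w c" for v w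
      using that ucells unfolding two by (auto simp: uinv_def fun_eq_iff)
    show "\<exists>F. finite_cocycle U1 (Suc 1) F \<and> uinv (\<lambda>c. F (frag_of c)) = y" if "y \<in> carrier Ugroup" for y
      using uinv_surj[OF that] unfolding two .
    show "uinv (\<lambda>c. F (frag_of c)) = \<one>\<^bsub>Ugroup\<^esub> \<longleftrightarrow>
       (\<exists>F'\<in>hom (free_Abelian_group (fcells 1)) U1. \<forall>c\<in>fcells (Suc 1). F (frag_of c) = F' (fdiff c))"
      if "finite_cocycle U1 (Suc 1) F" for F
      using that unfolding two by (rule uinv_kernel)
  qed
  then show ?thesis unfolding two .
qed

theorem mainTheorem2:
  fixes E :: "'e topology" and \<epsilon> :: "int \<Rightarrow> 'e \<Rightarrow> 'e"
  assumes "is_EG (integer_mod_group 4) E \<epsilon>"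
  shows "FGb (integer_mod_group 4) E \<epsilon> torus6 torus6_action \<cong>
           product_group {..<5::nat} (\<lambda>_. U1) \<times>\<times>
           product_group {..<4::nat} (\<lambda>_. integer_mod_group 2) \<and>
         Gb (integer_mod_group 4) E \<epsilon> torus6 torus6_action \<cong>
           product_group {..<4::nat} (\<lambda>_. integer_group) \<times>\<times>
           product_group {..<4::nat} (\<lambda>_. integer_mod_group 2)"
proof -
  interpret borel_cover E \<epsilon> by (rule borel_cover.intro) (rule assms)
  show ?thesis
    unfolding FGb_def Gb_def using second_cohomology third_cohomology by blast
qed

end
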